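(* As operators on the fermionic Fock space $\mathfrak F$, $$\mathbf T_+(x/y|\boldsymbol\alpha;\boldsymbol\beta)=e^{H_+(x/y|\boldsymbol\alpha;\boldsymbol\beta)}\qquad\text{and}\qquad\mathbf T_-(x/y|\boldsymbol\alpha;\boldsymbol\beta)=e^{H_-(x/y|\boldsymbol\alpha;\boldsymbol\beta)}.$$
   Context: $\boldsymbol\alpha=(\alpha_i)_{i\in\mathbb Z}$, $\boldsymbol\beta=(\beta_i)_{i\in\mathbb Z}$ are sequences in $\mathbb C$; $x,y$ are parameters. Equality means equality of all matrix coefficients, where the rational functions of $x,y$ on the left are expanded as power series in $x,y$. Fock space: the Clifford algebra is generated by $\psi_i,\psi_i^*$ ($i\in\mathbb Z$) with $[\psi_i,\psi_j]_+=[\psi_i^*,\psi_j^*]_+=0$, $[\psi_i,\psi_j^*]_+=\delta_{ij}$. $\mathfrak F=\bigoplus_{m\in\mathbb Z}\mathfrak F_m$, $\mathfrak F_m$ with basis $|\lambda\rangle_m=v_{m+\lambda_1}\wedge v_{m-1+\lambda_2}\wedge\cdots$ ($\lambda$ a partition); $\psi_j$ acts by $v_j\wedge$, $\psi_j^*$ by contraction against $v_j$; ${}_m\langle\lambda|$ is the dual basis. Site $j$ is occupied in $|\lambda\rangle_m$ if $v_j$ appears. Normal ordering: $:\!\psi_i\psi_j^*\!:\,=\psi_i\psi_j^*$ if $i>0$, $=-\psi_j^*\psi_i$ if $i\le0$. Currents and Hamiltonians: with $(z;\boldsymbol\alpha)^k=\prod_{i=1}^k(1-z\alpha_i)$ for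 $k\ge0$, $\prod_{i=k+1}^0(1-z\alpha_i)^{-1}$ for $k<0$, and $(z|\boldsymbol\beta)^k=\prod_{i=1}^k(z-\beta_i)$ for $k\ge0$, $\prod_{i=k+1}^0(z-\beta_i)^{-1}$ for $k<0$, let $\psi(z|\boldsymbol\alpha;\boldsymbol\beta)=\sum_i z\frac{(z|\boldsymbol\beta)^{i-1}}{(z;\boldsymbol\alpha)^i}\psi_i$, $\psi^*(w|\boldsymbol\alpha;\boldsymbol\beta)=\sum_j(1-\alpha_j\beta_j)\frac{(w;\boldsymbol\alpha)^{j-1}}{(w|\boldsymbol\beta)^j}\psi_j^*$, and let $J_k^{(\boldsymbol\alpha;\boldsymbol\beta)}$ be the coefficient of $z^{-k}$ in $:\!\psi(z|\boldsymbol\alpha;\boldsymbol\beta)\psi^*(z|\boldsymbol\alpha;\boldsymbol\beta)\!:$ (expanded for $|\beta_a|<|z|<|\alpha_b^{-1}|$, all $a,b$). Explicitly, for $k\ne0$, $J_k^{(\boldsymbol\alpha;\boldsymbol\beta)}=\sum_{i,j}A_{ij}^k:\!\psi_i\psi_j^*\!:$ where for $k>0$, $i\ne j$: $A_{ij}^k=(1-\alpha_j\beta_j)\sum_{r-s=j-i-k}e_r(-\alpha_{i+1},\dots,-\alpha_{j-1})h_s(\beta_i,\dots,\beta_j)$ (zero if $j<i$), $A_{ij}^{-k}=(1-\alpha_j\beta_j)\sum_{r-s=j-i+k}h_r(\alpha_j,\dots,\alpha_i)e_s(-\beta_{j+1},\dots,-\beta_{i-1})$ (zero if $j>i$), $A_{ii}^k=\beta_i^k$,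 $A_{ii}^{-k}=\alpha_i^k$. Put $H_\pm(x/y|\boldsymbol\alpha;\boldsymbol\beta)=\sum_{k\ge1}\frac{x^k-(-y)^k}{k}J_{\pm k}^{(\boldsymbol\alpha;\boldsymbol\beta)}$. Row transfer matrices: consider one horizontal line crossed by vertical lines (columns) indexed by $\mathbb Z$, the column index increasing from right to left. Every edge is colored $\circ$ (empty) or $\bullet$ (occupied). Write a vertex as $(L,R,T,B)$ for its left, right, top, bottom edges. The unscaled weight $\widetilde b_+(x/y|\alpha,\beta)$ is: $(\circ,\circ,\circ,\circ)\mapsto 1-\beta x$; $(\bullet,\bullet,\bullet,\bullet)\mapsto y+\alpha$; $(\circ,\circ,\bullet,\bullet)\mapsto 1+\beta y$; $(\bullet,\bullet,\circ,\circ)\mapsto x-\alpha$; $(\bullet,\circ,\circ,\bullet)\mapsto x+y$; $(\circ,\bullet,\bullet,\circ)\mapsto 1-\alpha\beta$; all others $0$. The unscaled weight $\widetilde b_-(x/y|\alpha,\beta)$ is: $(\circ,\circ,\circ,\circ)\mapsto 1-\alpha x$; $(\bullet,\bullet,\bullet,\bullet)\mapsto y+\beta$; $(\circ,\circ,\bullet,\bullet)\mapsto 1+\alpha y$; $(\bullet,\bullet,\circ,\circ)\mapsto x-\beta$; $(\bullet,\circ,\bullet,\circ)\mapsto 1-\alpha\beta$; $(\circ,\bullet,\circ,\bullet)\mapsto x+y$; all others $0$. With $\omega_j(x/y|\gamma)=\frac1{1-\gamma x}$ if $j>0$ and $\frac1{1+\gamma y}$ if $j\le0$, the Boltzmann weight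 in column $j$ is $\omega_j(x/y|\beta_j)\,\widetilde b_+(x/y|\alpha_j,\beta_j)$ for $\mathbf T_+$ and $\omega_j(x/y|\alpha_j)\,\widetilde b_-(x/y|\alpha_j,\beta_j)$ for $\mathbf T_-$. The matrix coefficient ${}_\ell\langle\mu|\mathbf T_\pm(x/y|\boldsymbol\alpha;\boldsymbol\beta)|\lambda\rangle_m$ is the sum, over colorings of the horizontal edges with only finitely many $\bullet$, of the product of the Boltzmann weights of all vertices, where the top edge in column $j$ is $\bullet$ iff site $j$ is occupied in $|\lambda\rangle_m$, and the bottom edge in column $j$ is $\bullet$ iff site $j$ is occupied in $|\mu\rangle_\ell$ (there is at most one such coloring with nonzero weight, and it is $0$ if $\ell\ne m$; all but finitely many vertices have weight $1$). *)

theory Defs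
  imports
    "HOL-Analysis.Analysis"
    "HOL-Computational_Algebra.Formal_Power_Series"
    "HOL-Library.Groups_Big_Fun"
    "HOL-Library.Multiset"
begin

text \<open>A partition is given by its parts \<open>\<nu> 0 \<ge> \<nu> 1 \<ge> \<dots>\<close>, so \<open>\<nu> k\<close> is the part usually written with
  index \<open>k + 1\<close>.\<close>

definition is_partition :: "(nat \<Rightarrow> nat) \<Rightarrow> bool" where
  "is_partition \<nu> \<longleftrightarrow> antimono \<nu> \<and> finite {k. \<nu> k \<noteq> 0}"

text \<open>The basis vector \<open>|\<nu>\<rangle>\<^sub>m\<close> is a wedge of \<open>v\<^sub>j\<close> with strictly decreasing indices \<open>j\<close>, and is
  encoded by the set of its occupied sites.\<close>

definition sites :: "int \<Rightarrow> (nat \<Rightarrow> nat) \<Rightarrow> int set" where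
  "sites m \<nu> = range (\<lambda>k. m - int k + int (\<nu> k))"

definition fock_basis :: "int set set" where
  "fock_basis = {sites m \<nu> | m \<nu>. is_partition \<nu>}"

text \<open>Vectors are given by their coordinates in the basis; \<open>v S\<close> is the pairing of \<open>v\<close> with the dual
  basis vector of \<open>S\<close>.  The Fock space consists of the finitely supported vectors on
  \<open>fock_basis\<close>; it is preserved by \<open>psi\<close> and \<open>psi_star\<close> below.\<close>

type_synonym fock = "int set \<Rightarrow> complex"

definition ket :: "int set \<Rightarrow> fock" where
  "ket S = (\<lambda>S'. if S' = S then 1 else 0)"

text \<open>The sign for moving \<open>v\<^sub>j\<close> past all the factors \<open>v\<^sub>s\<close> with \<open>s > j\<close>.\<close>

definition wedge_sign :: "int \<Rightarrow> int set \<Rightarrow> complex" where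
  "wedge_sign j S = (- 1) ^ card {s \<in> S. j < s}"

text \<open>Linear extensions of \<open>v\<^sub>S \<mapsto> v\<^sub>j \<and> v\<^sub>S\<close> and of the contraction against \<open>v\<^sub>j\<close>.\<close>

definition psi :: "int \<Rightarrow> fock \<Rightarrow> fock" where
  "psi j v = (\<lambda>S. if j \<in> S then wedge_sign j S * v (S - {j}) else 0)"

definition psi_star :: "int \<Rightarrow> fock \<Rightarrow> fock" where
  "psi_star j v = (\<lambda>S. if j \<in> S then 0 else wedge_sign j S * v (insert j S))"

definition normal_psi_psi_star :: "int \<Rightarrow> int \<Rightarrow> fock \<Rightarrow> fock" where
  "normal_psi_psi_star i j v =
     (if i > 0 then psi i (psi_star j v) else (\<lambda>S. - psi_star j (psi i v) S))"

definition esym :: "int set \<Rightarrow> (int \<Rightarrow> complex) \<Rightarrow> nat \<Rightarrow> complex" where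
  "esym I f r = (\<Sum>S | S \<subseteq> I \<and> card S = r. \<Prod>a\<in>S. f a)"

definition hsym :: "int set \<Rightarrow> (int \<Rightarrow> complex) \<Rightarrow> nat \<Rightarrow> complex" where
  "hsym I f s = (\<Sum>M\<in>multisets_of_size I s. \<Prod>a\<in>#M. f a)"

text \<open>\<open>current_coeff \<alpha> \<beta> k i j\<close> is the coefficient of \<open>:\<psi>\<^sub>i \<psi>\<^sub>j\<^sup>*:\<close> in the current \<open>J\<^sub>k\<close>, that is, the
  coefficient of \<open>z\<^sup>-\<^sup>k\<close> in the product of the coefficients of \<open>\<psi>\<^sub>i\<close> and \<open>\<psi>\<^sub>j\<^sup>*\<close> in the two fields;
  lemma \<open>current_coeff_laurent\<close> below proves this.  The closed formula makes sense for
  arbitrary sequences, also when the annulus of expansion is empty.\<close>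

definition current_coeff ::
  "(int \<Rightarrow> complex) \<Rightarrow> (int \<Rightarrow> complex) \<Rightarrow> int \<Rightarrow> int \<Rightarrow> int \<Rightarrow> complex" where
  "current_coeff \<alpha> \<beta> k i j =
     (if k > 0 then
        (if i = j then \<beta> i ^ nat k
         else if j < i then 0
         else (1 - \<alpha> j * \<beta> j) * Sum_any (\<lambda>(r, s).
           if int r - int s = j - i - k
           then esym {i+1..j-1} (\<lambda>a. - \<alpha> a) r * hsym {i..j} \<beta> s else 0))
      else if k < 0 then
        (if i = j then \<alpha> i ^ nat (- k)
         else if j > i then 0
         else (1 - \<alpha> j * \<beta> j) * Sum_any (\<lambda>(r, s).
           if int r - int s = j - i + (- k)
           then hsym {j..i} \<alpha> r * esym {j+1..i-1} (\<lambda>a. - \<beta> a) s else 0))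
      else (if i = j then 1 else 0))"

text \<open>The matrix coefficient \<open>\<langle>\<mu>| J\<^sub>k |\<nu>\<rangle>\<close>.  Only finitely many pairs \<open>(i, j)\<close> contribute when \<open>\<mu>\<close> and
  \<open>\<nu>\<close> are in \<open>fock_basis\<close>.\<close>

definition current ::
  "(int \<Rightarrow> complex) \<Rightarrow> (int \<Rightarrow> complex) \<Rightarrow> int \<Rightarrow> int set \<Rightarrow> int set \<Rightarrow> complex" where
  "current \<alpha> \<beta> k \<mu> \<nu> =
     Sum_any (\<lambda>(i, j). current_coeff \<alpha> \<beta> k i j * normal_psi_psi_star i j (ket \<nu>) \<mu>)"

definition int_prod :: "(int \<Rightarrow> complex) \<Rightarrow> int \<Rightarrow> complex" where
  "int_prod g k = (if k \<ge> 0 then \<Prod>a=1..k. g a else \<Prod>a=k+1..0. inverse (g a))"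

text \<open>The coefficients of \<open>\<psi>\<^sub>i\<close> in \<open>\<psi>(z|\<alpha>;\<beta>)\<close> and of \<open>\<psi>\<^sub>j\<^sup>*\<close> in \<open>\<psi>\<^sup>*(w|\<alpha>;\<beta>)\<close>; the shifted powers are
  \<open>(z;\<alpha>)\<^sup>k = int_prod (\<lambda>a. 1 - z * \<alpha> a) k\<close> and \<open>(z|\<beta>)\<^sup>k = int_prod (\<lambda>a. z - \<beta> a) k\<close>.\<close>

definition psi_field_coeff ::
  "(int \<Rightarrow> complex) \<Rightarrow> (int \<Rightarrow> complex) \<Rightarrow> complex \<Rightarrow> int \<Rightarrow> complex" where
  "psi_field_coeff \<alpha> \<beta> z i =
     z * int_prod (\<lambda>a. z - \<beta> a) (i - 1) / int_prod (\<lambda>a. 1 - z * \<alpha> a) i"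

definition psi_star_field_coeff ::
  "(int \<Rightarrow> complex) \<Rightarrow> (int \<Rightarrow> complex) \<Rightarrow> complex \<Rightarrow> int \<Rightarrow> complex" where
  "psi_star_field_coeff \<alpha> \<beta> w j =
     (1 - \<alpha> j * \<beta> j) * int_prod (\<lambda>a. 1 - w * \<alpha> a) (j - 1) / int_prod (\<lambda>a. w - \<beta> a) j"

lemma esym_eq_0:
  assumes "finite I" "r > card I"
  shows "esym I f r = 0"
proof -
  have "{S. S \<subseteq> I \<and> card S = r} = {}"
    using assms card_mono by (auto simp: not_le[symmetric])
  then show ?thesis by (simp only: esym_def sum.empty)
qed

lemma esym_generating:
  assumes "finite I"
  shows "(\<Sum>r\<le>card I. esym I f r * t ^ r) = (\<Prod>a\<in>I. 1 + f a * t)"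
proof -
  have "(\<Prod>a\<in>I. 1 + f a * t) = (\<Prod>a\<in>I. f a * t + 1)"
    by (simp add: add.commute)
  also have "\<dots> = (\<Sum>S\<in>Pow I. \<Prod>a\<in>S. f a * t)"
    by (subst prod_add[OF assms]) simp
  also have "\<dots> = (\<Sum>S\<in>Pow I. (\<Prod>a\<in>S. f a) * t ^ card S)"
    by (simp add: prod.distrib)
  also have "\<dots> = (\<Sum>r\<le>card I. \<Sum>S | S \<in> Pow I \<and> card S = r. (\<Prod>a\<in>S. f a) * t ^ card S)"
    using assms by (intro sum.group[symmetric]) (auto intro: card_mono)
  also have "\<dots> = (\<Sum>r\<le>card I. esym I f r * t ^ r)"
    by (simp add: esym_def sum_distrib_right)
  finally show ?thesis by simp
qed

lemma hsym_empty: "hsym {} f s = (if s = 0 then 1 else 0)"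
  by (simp add: hsym_def)

lemma hsym_insert:
  assumes "finite I" "a \<notin> I"
  shows "hsym (insert a I) f n = (\<Sum>k\<le>n. f a ^ k * hsym I f (n - k))"
proof -
  have fin: "finite (multisets_of_size I k)" for k
    using finite_multisets_of_size[OF assms(1)] .
  have "hsym (insert a I) f n =
      (\<Sum>(k, M)\<in>(SIGMA k:{0..n}. multisets_of_size I (n - k)). \<Prod>b\<in>#(M + replicate_mset k a). f b)"
    unfolding hsym_def
    by (subst sum.reindex_bij_betw[OF bij_betw_multisets_of_size_insert[OF assms(2)], symmetric])
       (simp add: case_prod_unfold)
  also have "\<dots> = (\<Sum>k\<in>{0..n}. \<Sum>M\<in>multisets_of_size I (n - k). \<Prod>b\<in>#(M + replicate_mset k a). f b)"
    by (subst sum.Sigma) (auto intro: fin)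
  also have "\<dots> = (\<Sum>k\<le>n. f a ^ k * hsym I f (n - k))"
    by (simp add: hsym_def sum_distrib_left atLeast0AtMost mult.commute)
  finally show ?thesis .
qed

lemma hsym_generating:
  assumes "finite I" "\<And>a. a \<in> I \<Longrightarrow> norm (f a * t) < 1"
  shows "summable (\<lambda>s. norm (hsym I f s * t ^ s)) \<and>
         (\<lambda>s. hsym I f s * t ^ s) sums (\<Prod>a\<in>I. inverse (1 - f a * t))"
  using assms
proof (induction I rule: finite_induct)
  case empty
  have "summable (\<lambda>s. norm (hsym {} f s * t ^ s))"
    by (rule summable_finite[of "{0}"]) (auto simp: hsym_empty)
  moreover have "(\<lambda>s. hsym {} f s * t ^ s) = (\<lambda>s. if s = 0 then 1 else 0)"
    by (auto simp: hsym_empty)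
  ultimately show ?case
    using sums_single[of 0 "\<lambda>_. 1::complex"] by simp
next
  case (insert a I)
  define A where "A = (\<lambda>k. (f a * t) ^ k)"
  define B where "B = (\<lambda>k. hsym I f k * t ^ k)"
  have na: "norm (f a * t) < 1" using insert.prems by blast
  have sA: "summable (\<lambda>k. norm (A k))"
    using na by (simp add: A_def norm_power summable_geometric)
  have sB: "summable (\<lambda>k. norm (B k))" and B: "B sums (\<Prod>a\<in>I. inverse (1 - f a * t))"
    using insert by (auto simp: B_def)
  have A: "suminf A = inverse (1 - f a * t)"
    using suminf_geometric[OF na] by (simp add: A_def inverse_eq_divide)
  have eq: "hsym (insert a I) f n * t ^ n = (\<Sum>k\<le>n. A k * B (n - k))" for n
    unfolding hsym_insert[OF insert.hyps] A_def B_def sum_distrib_right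
    by (intro sum.cong refl) (simp add: power_mult_distrib power_add[symmetric] mult_ac)
  have "summable (\<lambda>n. norm (\<Sum>k\<le>n. A k * B (n - k)))"
  proof (rule summable_comparison_test)
    show "summable (\<lambda>n. \<Sum>k\<le>n. norm (A k) * norm (B (n - k)))"
      by (rule summable_Cauchy_product) (use sA sB in simp_all)
    show "\<exists>N. \<forall>n\<ge>N. norm (norm (\<Sum>k\<le>n. A k * B (n - k))) \<le> (\<Sum>k\<le>n. norm (A k) * norm (B (n - k)))"
      by (auto intro!: sum_norm_le simp: norm_mult)
  qed
  moreover have "(\<lambda>n. \<Sum>k\<le>n. A k * B (n - k)) sums (\<Prod>a\<in>insert a I. inverse (1 - f a * t))"
    using Cauchy_product_sums[OF sA sB] B insert.hyps by (simp add: A sums_iff)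
  ultimately show ?case by (simp only: eq)
qed

lemma int_prod_pred:
  assumes "g k \<noteq> 0"
  shows "int_prod g k = int_prod g (k - 1) * g k"
proof (cases "k \<ge> 1")
  case True
  then have "{1..k} = insert k {1..k-1}" by auto
  then show ?thesis using True by (simp add: int_prod_def mult.commute)
next
  case False
  then have "{k..0} = insert k {k+1..0}" by auto
  then show ?thesis using False assms by (auto simp: int_prod_def)
qed

lemma int_prod_nz:
  assumes "\<And>a. g a \<noteq> 0"
  shows "int_prod g k \<noteq> 0"
  using assms by (auto simp: int_prod_def)

lemma int_prod_split:
  assumes "\<And>a. g a \<noteq> 0" "i \<le> j"
  shows "int_prod g j = int_prod g i * (\<Prod>a=i+1..j. g a)"
  using assms(2)
proof (induction j rule: int_ge_induct)
  case (step j)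
  have "{i+1..j+1} = insert (j+1) {i+1..j}" using step by auto
  then show ?case using int_prod_pred[of g "j+1"] step assms(1) by (simp add: mult_ac)
qed simp

lemma convolution_sum:
  assumes "\<And>p. p > n \<Longrightarrow> e p = (0::complex)"
  shows "Sum_any (\<lambda>(p, q). if int q - int p = d then e p * h q else 0) =
         (\<Sum>p\<le>n. if int p + d \<ge> 0 then e p * h (nat (int p + d)) else 0)" (is "Sum_any ?F = _")
proof -
  let ?A = "(\<lambda>p. (p, nat (int p + d))) ` {p. p \<le> n \<and> int p + d \<ge> 0}"
  have fin: "finite ?A" by simp
  have "Sum_any ?F = sum ?F ?A"
  proof (rule Sum_any.expand_superset[OF fin])
    show "{a. ?F a \<noteq> 0} \<subseteq> ?A"
    proof clarify
      fix p q assume "(if int q - int p = d then e p * h q else 0) \<noteq> 0"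
      then have "int q = int p + d" "e p \<noteq> 0" by (auto split: if_splits)
      moreover from this assms have "p \<le> n" by (meson not_le)
      ultimately show "(p, q) \<in> ?A" by (auto simp: image_iff)
    qed
  qed
  also have "\<dots> = (\<Sum>p | p \<le> n \<and> int p + d \<ge> 0. e p * h (nat (int p + d)))"
    by (subst sum.reindex) (auto simp: inj_on_def)
  also have "\<dots> = (\<Sum>p\<in>{..n} \<inter> {p. int p + d \<ge> 0}. e p * h (nat (int p + d)))"
    by (rule sum.cong) auto
  finally show ?thesis by (simp add: sum.If_cases)
qed

lemma has_sum_finite_sum:
  fixes f :: "'a \<Rightarrow> 'b \<Rightarrow> complex"
  assumes "finite I" "\<And>p. p \<in> I \<Longrightarrow> (f p has_sum s p) A"
  shows "((\<lambda>k. \<Sum>p\<in>I. f p k) has_sum (\<Sum>p\<in>I. s p)) A"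
  using assms by (induction I rule: finite_induct) (auto intro: has_sum_add)

lemma convolution_has_sum:
  assumes e0: "\<And>p. p > n \<Longrightarrow> e p = (0::complex)" and w: "w \<noteq> 0"
    and h: "((\<lambda>q. h q * w ^ q) has_sum S) UNIV"
  shows "((\<lambda>k. Sum_any (\<lambda>(p, q). if int q - int p = k - D then e p * h q else 0) * w powi k)
           has_sum (w powi D * (\<Sum>p\<le>n. e p * inverse w ^ p) * S)) UNIV"
proof -
  have *: "((\<lambda>k. (if int p + (k - D) \<ge> 0 then e p * h (nat (int p + (k - D))) else 0) * w powi k)
           has_sum (w powi D * (e p * inverse w ^ p) * S)) UNIV" for p
  proof -
    have "((\<lambda>q. w powi D * (e p * inverse w ^ p) * (h q * w ^ q))
            has_sum (w powi D * (e p * inverse w ^ p) * S)) UNIV"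
      by (intro has_sum_cmult_right h)
    also have "?this \<longleftrightarrow> ((\<lambda>k. e p * h (nat (int p + (k - D))) * w powi k)
           has_sum (w powi D * (e p * inverse w ^ p) * S)) {k. int p + (k - D) \<ge> 0}"
    proof (rule has_sum_reindex_bij_witness[where i = "\<lambda>k. nat (int p + (k - D))"
            and j = "\<lambda>q. int q + D - int p"])
      fix q :: nat
      have "w powi (int q + D - int p) = w ^ q * w powi D * inverse w ^ p"
        using w by (simp add: power_int_diff power_int_add divide_inverse power_inverse)
      then show "e p * h (nat (int p + (int q + D - int p - D))) * w powi (int q + D - int p)
          = w powi D * (e p * inverse w ^ p) * (h q * w ^ q)"
        by simp
    qed auto
    also have "\<dots> \<longleftrightarrow> ((\<lambda>k. (if int p + (k - D) \<ge> 0 then e p * h (nat (int p + (k - D))) else 0) * w powi k)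
           has_sum (w powi D * (e p * inverse w ^ p) * S)) UNIV"
      by (rule has_sum_cong_neutral) auto
    finally show ?thesis .
  qed
  have "((\<lambda>k. \<Sum>p\<le>n. (if int p + (k - D) \<ge> 0 then e p * h (nat (int p + (k - D))) else 0) * w powi k)
           has_sum (\<Sum>p\<le>n. w powi D * (e p * inverse w ^ p) * S)) UNIV"
    by (intro has_sum_finite_sum *) simp
  then show ?thesis
    by (simp add: convolution_sum[OF e0] sum_distrib_right sum_distrib_left mult_ac)
qed

lemma convolution_nonpos:
  assumes "finite I" "k \<le> 0" "D > int (card I)"
  shows "Sum_any (\<lambda>(p, q). if int q - int p = k - D then esym I f p * h q else 0) = 0"
proof -
  have "(\<lambda>(p, q). if int q - int p = k - D then esym I f p * h q else 0) = (\<lambda>_. 0)"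
    using assms esym_eq_0[OF assms(1)] by (intro ext) auto
  then show ?thesis by simp
qed

lemma current_coeff_laurent:
  assumes z: "\<And>a. norm (\<beta> a) < norm z" "\<And>b. norm (\<alpha> b) * norm z < 1"
  shows "((\<lambda>k. current_coeff \<alpha> \<beta> k i j * z powi (- k)) has_sum
           (psi_field_coeff \<alpha> \<beta> z i * psi_star_field_coeff \<alpha> \<beta> z j)) UNIV"
proof -
  define c where "c = 1 - \<alpha> j * \<beta> j"
  have z0: "z \<noteq> 0" using z(1)[of 0] by auto
  have na: "norm (\<alpha> b * z) < 1" for b using z(2)[of b] by (simp add: norm_mult)
  have nb: "norm (\<beta> a * inverse z) < 1" for a
    using z(1)[of a] z0 by (simp add: norm_mult norm_divide field_simps)
  have ga: "1 - z * \<alpha> a \<noteq> 0" for a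
    using na[of a] by (metis eq_iff_diff_eq_0 less_irrefl mult.commute norm_one)
  have gb: "z - \<beta> a \<noteq> 0" for a using z(1)[of a] by auto
  let ?A = "int_prod (\<lambda>a. 1 - z * \<alpha> a)" and ?B = "int_prod (\<lambda>a. z - \<beta> a)"
  have A0: "?A k \<noteq> 0" and B0: "?B k \<noteq> 0" for k using ga gb by (auto intro!: int_prod_nz)
  have R: "psi_field_coeff \<alpha> \<beta> z i * psi_star_field_coeff \<alpha> \<beta> z j =
             c * z * (?A (j - 1) / ?A i) * (?B (i - 1) / ?B j)"
    by (simp add: psi_field_coeff_def psi_star_field_coeff_def c_def)
  consider "i < j" | "j < i" | "i = j" by linarith
  then show ?thesis
  proof cases
    case 1
    let ?I = "{i+1..j-1}"
    let ?conv = "\<lambda>k. Sum_any (\<lambda>(p, q). if int q - int p = k - (j - i)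
                        then esym ?I (\<lambda>a. - \<alpha> a) p * hsym {i..j} \<beta> q else 0)"
    have card: "int (card ?I) = j - i - 1" using 1 by simp
    have "((\<lambda>q. hsym {i..j} \<beta> q * inverse z ^ q) has_sum (\<Prod>a=i..j. inverse (1 - \<beta> a * inverse z))) UNIV"
      using hsym_generating[of "{i..j}" \<beta> "inverse z"] nb by (intro norm_summable_imp_has_sum) auto
    from convolution_has_sum[OF _ _ this, of "card ?I" "esym ?I (\<lambda>a. - \<alpha> a)" "j - i"]
    have "((\<lambda>k. ?conv k * inverse z powi k) has_sum
        (inverse z powi (j - i) * (\<Sum>p\<le>card ?I. esym ?I (\<lambda>a. - \<alpha> a) p * z ^ p) *
          (\<Prod>a=i..j. inverse (1 - \<beta> a * inverse z)))) UNIV"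
      using z0 by (simp add: esym_eq_0)
    then have "((\<lambda>k. ?conv k * inverse z powi k) has_sum
        (inverse z powi (j - i) * (\<Prod>a\<in>?I. 1 + (- \<alpha> a) * z) *
          (\<Prod>a=i..j. inverse (1 - \<beta> a * inverse z)))) UNIV"
      by (simp only: esym_generating finite_atLeastAtMost_int)
    moreover have "current_coeff \<alpha> \<beta> k i j = c * ?conv k" for k
    proof (cases "k > 0")
      case True
      have "(int r - int s = j - i - k) = (int s - int r = k - (j - i))" for r s by auto
      with True 1 show ?thesis by (simp add: current_coeff_def c_def)
    next
      case False
      then have "?conv k = 0" using card by (intro convolution_nonpos) auto
      with False 1 show ?thesis by (simp add: current_coeff_def)
    qed
    ultimately have "((\<lambda>k. current_coeff \<alpha> \<beta> k i j * z powi (- k)) has_sum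
        (c * (inverse z powi (j - i) * (\<Prod>a\<in>?I. 1 + (- \<alpha> a) * z) *
          (\<Prod>a=i..j. inverse (1 - \<beta> a * inverse z))))) UNIV"
      using has_sum_cmult_right[where c = c]
      by (fastforce simp: power_int_minus power_int_inverse mult.assoc)
    moreover have "?A (j - 1) = ?A i * (\<Prod>a\<in>?I. 1 + (- \<alpha> a) * z)"
      using int_prod_split[of "\<lambda>a. 1 - z * \<alpha> a" i "j - 1"] ga 1 by (simp add: mult.commute)
    moreover have "?B (i - 1) / ?B j = inverse z powi (j - i + 1) * (\<Prod>a=i..j. inverse (1 - \<beta> a * inverse z))"
    proof -
      have "(\<Prod>a=i..j. z - \<beta> a) = (\<Prod>a=i..j. z * (1 - \<beta> a * inverse z))"
        using z0 by (intro prod.cong refl) (simp add: right_diff_distrib)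
      also have "\<dots> = z ^ nat (j - i + 1) * (\<Prod>a=i..j. 1 - \<beta> a * inverse z)"
        using 1 by (simp add: prod.distrib diff_add_eq)
      also have "z ^ nat (j - i + 1) = z powi (j - i + 1)"
        using 1 by (simp add: power_int_def)
      finally show ?thesis
        using int_prod_split[of "\<lambda>a. z - \<beta> a" "i - 1" j] gb 1 B0[of "i - 1"]
        by (simp add: power_int_inverse prod_inversef[unfolded o_def] divide_inverse)
    qed
    moreover have "inverse z powi (j - i) = z * inverse z powi (j - i + 1)"
      using z0 by (simp add: power_int_add)
    ultimately show ?thesis using A0[of i] R by (simp add: mult_ac)
  next
    case 2
    let ?I = "{j+1..i-1}"
    let ?conv = "\<lambda>k. Sum_any (\<lambda>(p, q). if int q - int p = k - (i - j)
                        then esym ?I (\<lambda>a. - \<beta> a) p * hsym {j..i} \<alpha> q else 0)"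
    have card: "int (card ?I) = i - j - 1" using 2 by simp
    have "((\<lambda>q. hsym {j..i} \<alpha> q * z ^ q) has_sum (\<Prod>a=j..i. inverse (1 - \<alpha> a * z))) UNIV"
      using hsym_generating[of "{j..i}" \<alpha> z] na by (intro norm_summable_imp_has_sum) auto
    from convolution_has_sum[OF _ _ this, of "card ?I" "esym ?I (\<lambda>a. - \<beta> a)" "i - j"]
    have "((\<lambda>k. ?conv k * z powi k) has_sum
        (z powi (i - j) * (\<Sum>p\<le>card ?I. esym ?I (\<lambda>a. - \<beta> a) p * inverse z ^ p) *
          (\<Prod>a=j..i. inverse (1 - \<alpha> a * z)))) UNIV"
      using z0 by (simp add: esym_eq_0)
    then have S: "((\<lambda>k. ?conv k * z powi k) has_sum
        (z powi (i - j) * (\<Prod>a\<in>?I. 1 + (- \<beta> a) * inverse z) *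
          (\<Prod>a=j..i. inverse (1 - \<alpha> a * z)))) UNIV"
      by (simp only: esym_generating finite_atLeastAtMost_int)
    have C: "current_coeff \<alpha> \<beta> (- k) i j = c * ?conv k" for k
    proof (cases "k > 0")
      case True
      have swap: "Sum_any (\<lambda>(r, s). if int r - int s = j - i + k
             then hsym {j..i} \<alpha> r * esym ?I (\<lambda>a. - \<beta> a) s else 0) = ?conv k"
      proof -
        have "Sum_any (\<lambda>(r, s). if int r - int s = j - i + k
             then hsym {j..i} \<alpha> r * esym ?I (\<lambda>a. - \<beta> a) s else 0) =
             Sum_any ((\<lambda>(r, s). if int r - int s = j - i + k
             then hsym {j..i} \<alpha> r * esym ?I (\<lambda>a. - \<beta> a) s else 0) \<circ> prod.swap)"
          by (rule Sum_any.reindex_cong[OF bij_swap refl])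
        also have "\<dots> = ?conv k"
          by (rule arg_cong[where f = Sum_any]) (auto simp: fun_eq_iff mult.commute)
        finally show ?thesis .
      qed
      with True 2 show ?thesis by (simp add: current_coeff_def c_def)
    next
      case False
      then have "?conv k = 0" using card by (intro convolution_nonpos) auto
      with False 2 show ?thesis by (simp add: current_coeff_def)
    qed
    have "((\<lambda>k. c * (?conv k * z powi k)) has_sum
        (c * (z powi (i - j) * (\<Prod>a\<in>?I. 1 + (- \<beta> a) * inverse z) *
          (\<Prod>a=j..i. inverse (1 - \<alpha> a * z))))) UNIV"
      by (rule has_sum_cmult_right[OF S])
    also have "?this \<longleftrightarrow> ((\<lambda>k. current_coeff \<alpha> \<beta> k i j * z powi (- k)) has_sum
        (c * (z powi (i - j) * (\<Prod>a\<in>?I. 1 + (- \<beta> a) * inverse z) *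
          (\<Prod>a=j..i. inverse (1 - \<alpha> a * z))))) UNIV"
      by (rule has_sum_reindex_bij_witness[where i = uminus and j = uminus]) (auto simp: C)
    finally have T: \<dots> .
    have a: "?A i = ?A (j - 1) * (\<Prod>a=j..i. 1 - \<alpha> a * z)"
      using int_prod_split[of "\<lambda>a. 1 - z * \<alpha> a" "j - 1" i] ga 2 by (simp add: mult.commute)
    have b: "?B (i - 1) = ?B j * (z powi (i - j - 1) * (\<Prod>a\<in>?I. 1 + (- \<beta> a) * inverse z))"
    proof -
      have "(\<Prod>a\<in>?I. z - \<beta> a) = (\<Prod>a\<in>?I. z * (1 + (- \<beta> a) * inverse z))"
        using z0 by (intro prod.cong refl) (simp add: right_diff_distrib)
      also have "\<dots> = z ^ nat (i - j - 1) * (\<Prod>a\<in>?I. 1 + (- \<beta> a) * inverse z)"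
        using 2 by (simp add: prod.distrib)
      also have "z ^ nat (i - j - 1) = z powi (i - j - 1)"
        using 2 by (simp add: power_int_def)
      finally show ?thesis
        using int_prod_split[of "\<lambda>a. z - \<beta> a" j "i - 1"] gb 2 by simp
    qed
    have p: "z powi (i - j) = z * z powi (i - j - 1)"
      using z0 by (simp add: power_int_diff)
    have "?A (j - 1) / ?A i = (\<Prod>a=j..i. inverse (1 - \<alpha> a * z))"
      unfolding a using A0[of "j - 1"] by (simp add: prod_inversef[unfolded o_def] divide_inverse)
    moreover have "?B (i - 1) / ?B j = z powi (i - j - 1) * (\<Prod>a\<in>?I. 1 + (- \<beta> a) * inverse z)"
      unfolding b using B0[of j] by simp
    ultimately show ?thesis using T unfolding R p by (simp only: mult_ac)
  next
    case 3
    let ?u = "\<beta> i * inverse z" and ?v = "\<alpha> i * z"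
    have geo: "((\<lambda>n. w ^ n) has_sum (1 / (1 - w))) UNIV" if "norm w < 1" for w :: complex
      using that by (intro norm_summable_imp_has_sum geometric_sums)
        (auto simp: norm_power summable_geometric)
    have "((\<lambda>n. ?u ^ n) has_sum (1 / (1 - ?u))) UNIV" by (rule geo[OF nb])
    also have "?this \<longleftrightarrow> ((\<lambda>k. current_coeff \<alpha> \<beta> k i j * z powi (- k)) has_sum (1 / (1 - ?u))) {0..}"
      by (rule has_sum_reindex_bij_witness[where i = nat and j = int])
         (auto simp: current_coeff_def 3 power_mult_distrib power_int_minus power_inverse)
    finally have P: \<dots> .
    have "((\<lambda>n. ?v * ?v ^ n) has_sum (?v * (1 / (1 - ?v)))) UNIV"
      by (intro has_sum_cmult_right geo[OF na])
    also have "?this \<longleftrightarrow> ((\<lambda>k. current_coeff \<alpha> \<beta> k i j * z powi (- k)) has_sum (?v * (1 / (1 - ?v)))) {..<0}"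
    proof (rule has_sum_reindex_bij_witness[where i = "\<lambda>k. nat (- k) - 1" and j = "\<lambda>n. - int (Suc n)"])
      fix n :: nat
      have n: "- int (Suc n) < 0" "nat (- (- int (Suc n))) = Suc n" by auto
      have "z powi (- (- int (Suc n))) = z ^ Suc n" by (simp only: minus_minus power_int_of_nat)
      with n show "current_coeff \<alpha> \<beta> (- int (Suc n)) i j * z powi (- (- int (Suc n))) = ?v * ?v ^ n"
        unfolding current_coeff_def 3 by (simp add: power_mult_distrib)
    qed auto
    finally have N: \<dots> .
    have "((\<lambda>k. current_coeff \<alpha> \<beta> k i j * z powi (- k)) has_sum
             (1 / (1 - ?u) + ?v * (1 / (1 - ?v)))) ({0..} \<union> {..<0})"
      by (intro has_sum_Un_disjoint P N) auto
    moreover have "{0..} \<union> {..<0} = (UNIV :: int set)" by auto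
    moreover have "1 / (1 - ?u) + ?v * (1 / (1 - ?v)) = 
        psi_field_coeff \<alpha> \<beta> z i * psi_star_field_coeff \<alpha> \<beta> z j"
    proof -
      have "?A i = ?A (i - 1) * (1 - z * \<alpha> i)" "?B i = ?B (i - 1) * (z - \<beta> i)"
        using ga gb by (auto intro: int_prod_pred)
      then have "?A (i - 1) / ?A i = 1 / (1 - z * \<alpha> i)" "?B (i - 1) / ?B i = 1 / (z - \<beta> i)"
        using A0[of "i - 1"] B0[of "i - 1"] by auto
      then have "psi_field_coeff \<alpha> \<beta> z i * psi_star_field_coeff \<alpha> \<beta> z j =
          (1 - \<alpha> i * \<beta> i) * z / ((1 - z * \<alpha> i) * (z - \<beta> i))"
        unfolding R using 3 by (simp add: c_def)
      moreover have "1 / (1 - ?u) = z / (z - \<beta> i)"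
        using z0 gb[of i] by (simp add: field_simps)
      moreover have "z / (z - \<beta> i) + ?v * (1 / (1 - ?v)) = (1 - \<alpha> i * \<beta> i) * z / ((1 - z * \<alpha> i) * (z - \<beta> i))"
        using ga[of i] gb[of i] by (simp add: divide_simps mult.commute) (simp add: algebra_simps)
      ultimately show ?thesis by simp
    qed
    ultimately show ?thesis by simp
  qed
qed

text \<open>The ring \<open>\<complex>[[x,y]]\<close> is represented as \<open>\<complex>[[x]][[y]]\<close>.\<close>

type_synonym series = "complex fps fps"

definition cst :: "complex \<Rightarrow> series" where
  "cst c = fps_const (fps_const c)"

definition var_x :: series where
  "var_x = fps_const fps_X"

definition var_y :: series where
  "var_y = fps_X"

text \<open>Coefficientwise sum of a family in which every monomial occurs only finitely often.\<close>

definition series_sum :: "(nat \<Rightarrow> series) \<Rightarrow> series" where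
  "series_sum f = Abs_fps (\<lambda>b. Abs_fps (\<lambda>a. Sum_any (\<lambda>n. fps_nth (fps_nth (f n) b) a)))"

text \<open>An operator is given by its matrix coefficients: \<open>A \<mu> \<nu>\<close> stands for \<open>\<langle>\<mu>| A |\<nu>\<rangle>\<close>.  This allows
  operators, such as \<open>T_minus\<close>, that map basis vectors to infinite sums.  In the powers of
  \<open>H_plus\<close> and of \<open>H_minus\<close> only finitely many intermediate states contribute.\<close>

type_synonym fock_matrix = "int set \<Rightarrow> int set \<Rightarrow> series"

definition mat_mult :: "fock_matrix \<Rightarrow> fock_matrix \<Rightarrow> fock_matrix" where
  "mat_mult A B \<mu> \<nu> = Sum_any (\<lambda>\<kappa>. if \<kappa> \<in> fock_basis then A \<mu> \<kappa> * B \<kappa> \<nu> else 0)"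

primrec mat_power :: "fock_matrix \<Rightarrow> nat \<Rightarrow> fock_matrix" where
  "mat_power A 0 = (\<lambda>\<mu> \<nu>. if \<mu> = \<nu> then 1 else 0)"
| "mat_power A (Suc n) = mat_mult A (mat_power A n)"

definition mat_exp :: "fock_matrix \<Rightarrow> fock_matrix" where
  "mat_exp A \<mu> \<nu> = series_sum (\<lambda>n. cst (1 / fact n) * mat_power A n \<mu> \<nu>)"

definition H_plus :: "(int \<Rightarrow> complex) \<Rightarrow> (int \<Rightarrow> complex) \<Rightarrow> fock_matrix" where
  "H_plus \<alpha> \<beta> \<mu> \<nu> = series_sum (\<lambda>k. if k \<ge> 1
     then cst (1 / of_nat k) * (var_x ^ k - (- var_y) ^ k) * cst (current \<alpha> \<beta> (int k) \<mu> \<nu>) else 0)"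

definition H_minus :: "(int \<Rightarrow> complex) \<Rightarrow> (int \<Rightarrow> complex) \<Rightarrow> fock_matrix" where
  "H_minus \<alpha> \<beta> \<mu> \<nu> = series_sum (\<lambda>k. if k \<ge> 1
     then cst (1 / of_nat k) * (var_x ^ k - (- var_y) ^ k) * cst (current \<alpha> \<beta> (- int k) \<mu> \<nu>) else 0)"

text \<open>Colors are booleans, \<open>True\<close> meaning occupied.  The last four arguments are the colors of the
  left, right, top and bottom edges.\<close>

fun weight_plus ::
  "'a::comm_ring_1 \<Rightarrow> 'a \<Rightarrow> 'a \<Rightarrow> 'a \<Rightarrow> bool \<Rightarrow> bool \<Rightarrow> bool \<Rightarrow> bool \<Rightarrow> 'a" where
  "weight_plus x y \<alpha> \<beta> False False False False = 1 - \<beta> * x"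
| "weight_plus x y \<alpha> \<beta> True  True  True  True  = y + \<alpha>"
| "weight_plus x y \<alpha> \<beta> False False True  True  = 1 + \<beta> * y"
| "weight_plus x y \<alpha> \<beta> True  True  False False = x - \<alpha>"
| "weight_plus x y \<alpha> \<beta> True  False False True  = x + y"
| "weight_plus x y \<alpha> \<beta> False True  True  False = 1 - \<alpha> * \<beta>"
| "weight_plus x y \<alpha> \<beta> _ _ _ _ = 0"

fun weight_minus ::
  "'a::comm_ring_1 \<Rightarrow> 'a \<Rightarrow> 'a \<Rightarrow> 'a \<Rightarrow> bool \<Rightarrow> bool \<Rightarrow> bool \<Rightarrow> bool \<Rightarrow> 'a" where
  "weight_minus x y \<alpha> \<beta> False False False False = 1 - \<alpha> * x"
| "weight_minus x y \<alpha> \<beta> True  True  True  True  = y + \<beta>"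
| "weight_minus x y \<alpha> \<beta> False False True  True  = 1 + \<alpha> * y"
| "weight_minus x y \<alpha> \<beta> True  True  False False = x - \<beta>"
| "weight_minus x y \<alpha> \<beta> True  False True  False = 1 - \<alpha> * \<beta>"
| "weight_minus x y \<alpha> \<beta> False True  False True  = x + y"
| "weight_minus x y \<alpha> \<beta> _ _ _ _ = 0"

text \<open>Both denominators have constant term 1, so \<open>inverse\<close> is the inverse in \<open>\<complex>[[x,y]]\<close>.\<close>

definition omega :: "int \<Rightarrow> complex \<Rightarrow> series" where
  "omega j \<gamma> = (if j > 0 then inverse (1 - cst \<gamma> * var_x) else inverse (1 + cst \<gamma> * var_y))"

text \<open>A coloring \<open>c\<close> of the horizontal edges assigns to \<open>j\<close> the color of the left edge of column \<open>j\<close>.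
  Columns increase from right to left, so the right edge of column \<open>j\<close> is the left edge of
  column \<open>j - 1\<close>.  If \<open>c\<close> has finitely many occupied edges and \<open>\<mu>\<close>, \<open>\<nu>\<close> are in \<open>fock_basis\<close>, then
  all but finitely many factors are 1.\<close>

definition row_transfer ::
  "(int \<Rightarrow> bool \<Rightarrow> bool \<Rightarrow> bool \<Rightarrow> bool \<Rightarrow> series) \<Rightarrow> fock_matrix" where
  "row_transfer w \<mu> \<nu> = Sum_any (\<lambda>c :: int \<Rightarrow> bool.
     if finite {j. c j} then Prod_any (\<lambda>j. w j (c j) (c (j - 1)) (j \<in> \<nu>) (j \<in> \<mu>)) else 0)"

definition T_plus :: "(int \<Rightarrow> complex) \<Rightarrow> (int \<Rightarrow> complex) \<Rightarrow> fock_matrix" where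
  "T_plus \<alpha> \<beta> = row_transfer (\<lambda>j L R T B.
     omega j (\<beta> j) * weight_plus var_x var_y (cst (\<alpha> j)) (cst (\<beta> j)) L R T B)"

definition T_minus :: "(int \<Rightarrow> complex) \<Rightarrow> (int \<Rightarrow> complex) \<Rightarrow> fock_matrix" where
  "T_minus \<alpha> \<beta> = row_transfer (\<lambda>j L R T B.
     omega j (\<alpha> j) * weight_minus var_x var_y (cst (\<alpha> j)) (cst (\<beta> j)) L R T B)"

end

theory Submission
  imports Defs
begin

text \<open>
  Only finitely many sites matter.  If \<open>N\<close> is large, the two states occupy every site below \<open>- N\<close>
  and none above \<open>N\<close>; every state met on the way from one to the other by \<open>H_plus\<close>, which moves
  particles down, or by \<open>H_minus\<close>, which moves them up, has the same form.  So both sides become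
  finite matrices indexed by the subsets of the window \<open>W = {- N..N}\<close>.  The reflection
  \<open>j \<mapsto> - j\<close> together with the exchange of \<open>\<alpha>\<close> and \<open>\<beta>\<close> carries \<open>T_minus\<close> to \<open>T_plus\<close> and \<open>H_minus\<close> to
  \<open>H_plus\<close>, up to the position of the filled sites.  Hence a single identity suffices, lemma
  \<open>window_transfer_eq_exp\<close>, in which the set \<open>Z\<close> of sites with the normalization of the filled ones
  is a parameter.

  Both sides of that identity solve the same differential equation.  Let \<open>E = x \<partial>\<^sub>x + y \<partial>\<^sub>y\<close> be the
  Euler operator, \<open>K = \<Sum> x\<^sup>k J\<^sub>k\<close> and \<open>L = - \<Sum> (- y)\<^sup>k J\<^sub>k\<close>, the sums being over \<open>k \<ge> 1\<close>.  A matrix \<open>F\<close> of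
  series with \<open>E F = K F + F L\<close> is determined by its constant term, by induction on the total
  degree (\<open>euler_ode_unique\<close>).  For \<open>F = exp H\<close> the equation follows from \<open>E H = K + L\<close>, because the
  currents \<open>J\<^sub>k\<close> with \<open>k \<ge> 0\<close> commute.

  For the transfer matrix the reason is that it is free fermionic.  Let \<open>C\<close> and \<open>B\<close> be the
  bidiagonal matrices with entries \<open>C k k = 1\<close>, \<open>C k (k + 1) = \<alpha> (k + 1)\<close>, \<open>B k k = \<beta> k\<close> and
  \<open>B k (k + 1) = 1\<close>.  A check on two adjacent columns (\<open>two_column_relation\<close>) gives
  \<open>\<psi>\<^sup>*((C - x B)\<^sub>k) T = T \<psi>\<^sup>*((C + y B)\<^sub>k)\<close>, where \<open>\<psi>\<^sup>*(v) = \<Sum> v\<^sub>i \<psi>\<^sub>i\<^sup>*\<close> and the index \<open>k\<close> selects a row.  The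
  one-particle matrix \<open>A\<^sub>k\<close> of \<open>J\<^sub>k\<close> satisfies \<open>C A\<^sub>n\<^sub>+\<^sub>1 = B A\<^sub>n\<close> (\<open>current_coeff_row_relation\<close>), that is,
  \<open>A\<^sub>k = X\<^sup>k\<close> for \<open>X = C\<^sup>-\<^sup>1 B\<close>.  On one particle \<open>T\<close> is therefore \<open>(1 + y X) (1 - x X)\<^sup>-\<^sup>1\<close>, whose logarithm
  is \<open>\<Sum> (x\<^sup>k - (- y)\<^sup>k) / k X\<^sup>k\<close>, and this is the identity on one particle.  To pass to many particles
  without determinants, a matrix which vanishes on the vacuum row and satisfies an intertwining
  relation as above is zero (\<open>intertwiner_eq_0\<close>).  Applied to \<open>E T - K T - T L\<close> this gives the
  equation for \<open>T\<close>; applied to the commutators of the currents it shows that they commute as the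
  matrices \<open>X\<^sup>k\<close> do.
\<close>

section \<open>Annihilation operators on finite states\<close>

text \<open>The sign \<open>wedge_sign\<close> with values in any commutative ring, since it occurs in matrices of
  numbers and of series.\<close>

definition fsign :: "int \<Rightarrow> int set \<Rightarrow> 'a::comm_ring_1" where
  "fsign j S = (- 1) ^ card {s \<in> S. j < s}"

text \<open>For a matrix \<open>F\<close> indexed by finite states, \<open>ann_left i F\<close> and \<open>ann_right i F\<close> are the
  products \<open>\<psi>\<^sub>i\<^sup>* F\<close> and \<open>F \<psi>\<^sub>i\<^sup>*\<close>. Writing them by entries keeps every state finite, so that
  the signs are defined.\<close>

definition ann_left :: "int \<Rightarrow> (int set \<Rightarrow> int set \<Rightarrow> 'a::comm_ring_1) \<Rightarrow> int set \<Rightarrow> int set \<Rightarrow> 'a" where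
  "ann_left i F \<mu> \<nu> = (if i \<in> \<mu> then 0 else fsign i \<mu> * F (insert i \<mu>) \<nu>)"

definition ann_right :: "int \<Rightarrow> (int set \<Rightarrow> int set \<Rightarrow> 'a::comm_ring_1) \<Rightarrow> int set \<Rightarrow> int set \<Rightarrow> 'a" where
  "ann_right i F \<mu> \<nu> = (if i \<in> \<nu> then fsign i \<nu> * F \<mu> (\<nu> - {i}) else 0)"

definition id_op :: "int set \<Rightarrow> int set \<Rightarrow> 'a::comm_ring_1" where
  "id_op \<mu> \<nu> = (if \<mu> = \<nu> then 1 else 0)"

definition op_mult :: "int set \<Rightarrow> (int set \<Rightarrow> int set \<Rightarrow> 'a::comm_ring_1) \<Rightarrow> (int set \<Rightarrow> int set \<Rightarrow> 'a) \<Rightarrow> int set \<Rightarrow> int set \<Rightarrow> 'a" where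
  "op_mult W A B \<mu> \<nu> = (\<Sum>\<kappa>\<in>Pow W. A \<mu> \<kappa> * B \<kappa> \<nu>)"

lemma ann_left_diff: "ann_left i (\<lambda>\<mu> \<nu>. F \<mu> \<nu> - G \<mu> \<nu>) \<mu> \<nu> = ann_left i F \<mu> \<nu> - ann_left i G \<mu> \<nu>"
  by (simp add: ann_left_def right_diff_distrib)

lemma ann_right_diff: "ann_right i (\<lambda>\<mu> \<nu>. F \<mu> \<nu> - G \<mu> \<nu>) \<mu> \<nu> = ann_right i F \<mu> \<nu> - ann_right i G \<mu> \<nu>"
  by (simp add: ann_right_def right_diff_distrib)

lemma fsign_remove: "fsign i (\<nu> - {i}) = fsign i \<nu>"
proof -
  have "{s \<in> \<nu> - {i}. i < s} = {s \<in> \<nu>. i < s}" by auto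
  then show ?thesis by (simp add: fsign_def)
qed

lemma fsign_insert_same: "fsign i (insert i \<nu>) = fsign i \<nu>"
proof -
  have "{s \<in> insert i \<nu>. i < s} = {s \<in> \<nu>. i < s}" by auto
  then show ?thesis by (simp add: fsign_def)
qed

lemma fsign_insert:
  assumes "finite {s \<in> S. i < s}" "j \<notin> S"
  shows "fsign i (insert j S) = (if i < j then - fsign i S else fsign i S)"
proof (cases "i < j")
  case True
  then have "{s \<in> insert j S. i < s} = insert j {s \<in> S. i < s}" by auto
  with True assms show ?thesis by (simp add: fsign_def)
next
  case False
  then have "{s \<in> insert j S. i < s} = {s \<in> S. i < s}" by auto
  with False show ?thesis by (simp add: fsign_def)
qed

lemma fsign_mult_self [simp]: "fsign i S * fsign i S = 1"
  by (simp add: fsign_def power_mult_distrib[symmetric])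

lemma op_mult_assoc:
  "op_mult W (op_mult W A B) C = op_mult W A (op_mult W B C)"
proof (intro ext)
  fix \<mu> \<nu>
  have "op_mult W (op_mult W A B) C \<mu> \<nu> = (\<Sum>\<kappa>\<in>Pow W. \<Sum>\<rho>\<in>Pow W. A \<mu> \<rho> * B \<rho> \<kappa> * C \<kappa> \<nu>)"
    by (simp add: op_mult_def sum_distrib_right)
  also have "\<dots> = (\<Sum>\<rho>\<in>Pow W. \<Sum>\<kappa>\<in>Pow W. A \<mu> \<rho> * B \<rho> \<kappa> * C \<kappa> \<nu>)"
    by (rule sum.swap)
  also have "\<dots> = op_mult W A (op_mult W B C) \<mu> \<nu>"
    by (simp add: op_mult_def sum_distrib_left mult.assoc)
  finally show "op_mult W (op_mult W A B) C \<mu> \<nu> = op_mult W A (op_mult W B C) \<mu> \<nu>" .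
qed

lemma op_mult_id_left: "finite W \<Longrightarrow> \<mu> \<subseteq> W \<Longrightarrow> op_mult W id_op A \<mu> \<nu> = A \<mu> \<nu>"
  by (simp add: op_mult_def id_op_def if_distrib[of "\<lambda>t. t * _"] cong: if_cong)

lemma op_mult_id_right: "finite W \<Longrightarrow> \<nu> \<subseteq> W \<Longrightarrow> op_mult W A id_op \<mu> \<nu> = A \<mu> \<nu>"
  by (simp add: op_mult_def id_op_def if_distrib[of "\<lambda>t. _ * t"] cong: if_cong)

lemma ann_left_op_mult: "ann_left i (op_mult W A B) = op_mult W (ann_left i A) B"
  by (auto simp: ann_left_def op_mult_def fun_eq_iff sum_distrib_left mult.assoc)

lemma ann_right_op_mult: "ann_right i (op_mult W A B) = op_mult W A (ann_right i B)"
  by (auto simp: ann_right_def op_mult_def fun_eq_iff sum_distrib_left mult_ac)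

text \<open>Associativity \<open>(A \<psi>\<^sub>i\<^sup>*) B = A (\<psi>\<^sub>i\<^sup>* B)\<close>: the intermediate states with and without the
  site \<open>i\<close> are matched by adding \<open>i\<close>.\<close>

lemma op_mult_ann_middle:
  assumes "finite W" "i \<in> W"
  shows "op_mult W (ann_right i A) B = op_mult W A (ann_left i B)"
proof (intro ext)
  fix \<mu> \<nu>
  have "op_mult W (ann_right i A) B \<mu> \<nu> =
      (\<Sum>\<kappa> | \<kappa> \<subseteq> W \<and> i \<in> \<kappa>. fsign i \<kappa> * A \<mu> (\<kappa> - {i}) * B \<kappa> \<nu>)"
    unfolding op_mult_def using assms
    by (intro sum.mono_neutral_cong_right) (auto simp: ann_right_def)
  also have "\<dots> = (\<Sum>\<kappa> | \<kappa> \<subseteq> W \<and> i \<notin> \<kappa>. A \<mu> \<kappa> * (fsign i \<kappa> * B (insert i \<kappa>) \<nu>))"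
    using assms(2)
    by (intro sum.reindex_bij_witness[where i = "insert i" and j = "\<lambda>\<kappa>. \<kappa> - {i}"])
       (auto simp: fsign_remove insert_absorb mult_ac)
  also have "\<dots> = op_mult W A (ann_left i B) \<mu> \<nu>"
    unfolding op_mult_def using assms
    by (intro sum.mono_neutral_cong_left) (auto simp: ann_left_def)
  finally show "op_mult W (ann_right i A) B \<mu> \<nu> = op_mult W A (ann_left i B) \<mu> \<nu>" .
qed

text \<open>The commutator form of \<open>J = \<Sum> A\<^sub>i\<^sub>j \<psi>\<^sub>i \<psi>\<^sub>j\<^sup>* + const\<close>, namely \<open>[\<psi>\<^sub>i\<^sup>*, J] = \<Sum>\<^sub>j
  A\<^sub>i\<^sub>j \<psi>\<^sub>j\<^sup>*\<close>; the matrix \<open>ann_right j id_op\<close> is that of \<open>\<psi>\<^sub>j\<^sup>*\<close>. In this form the normal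
  ordering constant has disappeared.\<close>

definition second_quantizes ::
  "int set \<Rightarrow> (int set \<Rightarrow> int set \<Rightarrow> 'a::comm_ring_1) \<Rightarrow> (int \<Rightarrow> int \<Rightarrow> 'a) \<Rightarrow> bool" where
  "second_quantizes W J A \<longleftrightarrow> (\<forall>i\<in>W. \<forall>\<mu>\<in>Pow W. \<forall>\<nu>\<in>Pow W.
     ann_left i J \<mu> \<nu> = ann_right i J \<mu> \<nu> + (\<Sum>j\<in>W. A i j * ann_right j id_op \<mu> \<nu>))"

lemma second_quantizesD:
  assumes "second_quantizes W J A" "i \<in> W" "\<mu> \<subseteq> W" "\<nu> \<subseteq> W"
  shows "ann_left i J \<mu> \<nu> = ann_right i J \<mu> \<nu> + (\<Sum>j\<in>W. A i j * ann_right j id_op \<mu> \<nu>)"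
  using assms by (simp add: second_quantizes_def)

lemma second_quantized_mult_left:
  assumes W: "finite W" and q: "second_quantizes W J A" and i: "i \<in> W" and \<mu>: "\<mu> \<subseteq> W"
  shows "ann_left i (op_mult W J F) \<mu> \<nu> =
     op_mult W J (ann_left i F) \<mu> \<nu> + (\<Sum>j\<in>W. A i j * ann_left j F \<mu> \<nu>)"
proof -
  have "ann_left i (op_mult W J F) \<mu> \<nu> =
      op_mult W (ann_right i J) F \<mu> \<nu> + (\<Sum>\<kappa>\<in>Pow W. \<Sum>j\<in>W. A i j * (ann_right j id_op \<mu> \<kappa> * F \<kappa> \<nu>))"
    unfolding ann_left_op_mult using \<mu> i
    by (simp add: op_mult_def second_quantizesD[OF q] distrib_right sum.distrib sum_distrib_right mult.assoc)
  also have "(\<Sum>\<kappa>\<in>Pow W. \<Sum>j\<in>W. A i j * (ann_right j id_op \<mu> \<kappa> * F \<kappa> \<nu>)) =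
      (\<Sum>j\<in>W. A i j * op_mult W (ann_right j id_op) F \<mu> \<nu>)"
    by (subst sum.swap) (simp add: op_mult_def sum_distrib_left)
  also have "\<dots> = (\<Sum>j\<in>W. A i j * ann_left j F \<mu> \<nu>)"
    using W \<mu> by (intro sum.cong refl) (simp add: op_mult_ann_middle op_mult_id_left)
  finally show ?thesis using W i by (simp add: op_mult_ann_middle)
qed

lemma second_quantized_mult_right:
  assumes W: "finite W" and q: "second_quantizes W J A" and i: "i \<in> W" and \<nu>: "\<nu> \<subseteq> W"
  shows "op_mult W (ann_right i F) J \<mu> \<nu> =
     ann_right i (op_mult W F J) \<mu> \<nu> + (\<Sum>j\<in>W. A i j * ann_right j F \<mu> \<nu>)"
proof -
  have "op_mult W F (ann_left i J) \<mu> \<nu> =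
      op_mult W F (ann_right i J) \<mu> \<nu> + (\<Sum>\<kappa>\<in>Pow W. \<Sum>j\<in>W. A i j * (F \<mu> \<kappa> * ann_right j id_op \<kappa> \<nu>))"
    using \<nu> i
    by (simp add: op_mult_def second_quantizesD[OF q] distrib_left sum.distrib sum_distrib_left mult_ac)
  also have "(\<Sum>\<kappa>\<in>Pow W. \<Sum>j\<in>W. A i j * (F \<mu> \<kappa> * ann_right j id_op \<kappa> \<nu>)) =
      (\<Sum>j\<in>W. A i j * op_mult W F (ann_right j id_op) \<mu> \<nu>)"
    by (subst sum.swap) (simp add: op_mult_def sum_distrib_left)
  also have "\<dots> = (\<Sum>j\<in>W. A i j * ann_right j F \<mu> \<nu>)"
  proof (intro sum.cong refl)
    fix j
    have "ann_right j (op_mult W F id_op) \<mu> \<nu> = ann_right j F \<mu> \<nu>"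
      using op_mult_id_right[OF W, of "\<nu> - {j}" F \<mu>] \<nu> by (simp add: ann_right_def Diff_subset[THEN subset_trans])
    then show "A i j * op_mult W F (ann_right j id_op) \<mu> \<nu> = A i j * ann_right j F \<mu> \<nu>"
      by (simp add: ann_right_op_mult)
  qed
  finally show ?thesis using W i by (simp add: op_mult_ann_middle ann_right_op_mult)
qed

text \<open>The relation expresses a row of \<open>D\<close> with \<open>n + 1\<close> particles by rows with \<open>n\<close> particles, so
  that everything is determined by the vacuum row. The coefficient matrix is upper triangular
  with nonzero diagonal, so that the new particle can be treated site by site, starting from the
  largest.\<close>

lemma intertwiner_eq_0:
  fixes D :: "int set \<Rightarrow> int set \<Rightarrow> 'a::idom"
  assumes W: "W = {a..b}"
    and diag: "\<And>k. k \<in> W \<Longrightarrow> P k k \<noteq> 0"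
    and tri: "\<And>k i. i < k \<Longrightarrow> P k i = 0"
    and rel: "\<And>k \<mu> \<nu>. k \<in> W \<Longrightarrow> \<mu> \<subseteq> W \<Longrightarrow> \<nu> \<subseteq> W \<Longrightarrow>
       (\<Sum>i\<in>W. P k i * ann_left i D \<mu> \<nu>) = (\<Sum>i\<in>W. Q k i * ann_right i D \<mu> \<nu>)"
    and vac: "\<And>\<nu>. \<nu> \<subseteq> W \<Longrightarrow> D {} \<nu> = 0"
    and "\<mu> \<subseteq> W" "\<nu> \<subseteq> W"
  shows "D \<mu> \<nu> = 0"
  using \<open>\<mu> \<subseteq> W\<close> \<open>\<nu> \<subseteq> W\<close>
proof (induction "card \<mu>" arbitrary: \<mu> \<nu>)
  case 0
  then have "\<mu> = {}" using W finite_subset by fastforce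
  with vac 0 show ?case by simp
next
  case (Suc n)
  have fW: "finite W" by (simp add: W)
  \<comment> \<open>Downward induction on the new site, since row \<open>k\<close> of \<open>P\<close> involves only sites from \<open>k\<close> upwards.\<close>
  have *: "D (insert k \<rho>) \<nu> = 0"
    if "\<rho> \<subseteq> W" "card \<rho> = n" "k \<in> W" "k \<notin> \<rho>" for k \<rho>
    using that(3,4)
  proof (induction "nat (b - k)" arbitrary: k rule: less_induct)
    case less
    have "(\<Sum>i\<in>W. P k i * ann_left i D \<rho> \<nu>) = P k k * ann_left k D \<rho> \<nu>"
    proof (subst sum.remove[OF fW \<open>k \<in> W\<close>], subst sum.neutral)
      show "\<forall>i\<in>W - {k}. P k i * ann_left i D \<rho> \<nu> = 0"
      proof
        fix i assume i: "i \<in> W - {k}"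
        show "P k i * ann_left i D \<rho> \<nu> = 0"
        proof (cases "i < k")
          case False
          with i less.hyps[of i] less.prems W have "i \<notin> \<rho> \<Longrightarrow> D (insert i \<rho>) \<nu> = 0" by auto
          then show ?thesis by (simp add: ann_left_def)
        qed (simp add: tri)
      qed
    qed simp
    moreover have "(\<Sum>i\<in>W. Q k i * ann_right i D \<rho> \<nu>) = 0"
    proof (rule sum.neutral, rule ballI)
      fix i assume "i \<in> W"
      have "D \<rho> (\<nu> - {i}) = 0"
        using Suc.hyps(1)[of \<rho> "\<nu> - {i}"] that Suc.prems by blast
      then show "Q k i * ann_right i D \<rho> \<nu> = 0" by (simp add: ann_right_def)
    qed
    ultimately have "P k k * ann_left k D \<rho> \<nu> = 0"
      using rel[OF \<open>k \<in> W\<close> \<open>\<rho> \<subseteq> W\<close> \<open>\<nu> \<subseteq> W\<close>] by simp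
    with diag less.prems have "ann_left k D \<rho> \<nu> = 0" by simp
    then have "fsign k \<rho> * (fsign k \<rho> * D (insert k \<rho>) \<nu>) = 0"
      using less.prems by (simp add: ann_left_def)
    then show ?case by (simp add: mult.assoc[symmetric])
  qed
  obtain k \<rho> where k: "\<mu> = insert k \<rho>" "k \<notin> \<rho>" "card \<rho> = n"
    using Suc.hyps(2) by (metis card_Suc_eq)
  with Suc.prems *[of \<rho> k] show ?case by simp
qed

text \<open>By the commutator relations \<open>\<psi>\<^sub>i\<^sup>*\<close> commutes with \<open>[J, K]\<close> as soon as \<open>A\<close> and \<open>B\<close> commute;
  on the vacuum row both products are the same multiple of the identity.\<close>

lemma second_quantized_commute:
  fixes J K :: "int set \<Rightarrow> int set \<Rightarrow> 'a::idom"
  assumes W: "W = {a..b}"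
    and J: "second_quantizes W J A" and K: "second_quantizes W K B"
    and AB: "\<And>i j. i \<in> W \<Longrightarrow> j \<in> W \<Longrightarrow> (\<Sum>l\<in>W. A i l * B l j) = (\<Sum>l\<in>W. B i l * A l j)"
    and J0: "\<And>\<nu>. \<nu> \<subseteq> W \<Longrightarrow> J {} \<nu> = s * id_op {} \<nu>"
    and K0: "\<And>\<nu>. \<nu> \<subseteq> W \<Longrightarrow> K {} \<nu> = t * id_op {} \<nu>"
    and \<mu>: "\<mu> \<subseteq> W" and \<nu>: "\<nu> \<subseteq> W"
  shows "op_mult W J K \<mu> \<nu> = op_mult W K J \<mu> \<nu>"
proof -
  have fW: "finite W" by (simp add: W)
  have exp: "ann_left i (op_mult W J K) \<mu> \<nu> = ann_right i (op_mult W J K) \<mu> \<nu>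
       + (\<Sum>j\<in>W. B i j * ann_right j J \<mu> \<nu>) + (\<Sum>j\<in>W. A i j * ann_right j K \<mu> \<nu>)
       + (\<Sum>l\<in>W. (\<Sum>j\<in>W. A i j * B j l) * ann_right l id_op \<mu> \<nu>)"
    if J: "second_quantizes W J A" and K: "second_quantizes W K B" and "i \<in> W" "\<mu> \<subseteq> W" "\<nu> \<subseteq> W"
    for J K :: "int set \<Rightarrow> int set \<Rightarrow> 'a" and A B i \<mu> \<nu>
  proof -
    have "ann_left i (op_mult W J K) \<mu> \<nu> =
        op_mult W J (ann_left i K) \<mu> \<nu> + (\<Sum>j\<in>W. A i j * ann_left j K \<mu> \<nu>)"
      by (rule second_quantized_mult_left[OF fW J that(3,4)])
    also have "op_mult W J (ann_left i K) \<mu> \<nu> =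
        ann_right i (op_mult W J K) \<mu> \<nu> + (\<Sum>j\<in>W. B i j * ann_right j J \<mu> \<nu>)"
      using second_quantized_mult_right[OF fW K that(3,5), of J] fW that(3)
      by (simp add: op_mult_ann_middle)
    also have "(\<Sum>j\<in>W. A i j * ann_left j K \<mu> \<nu>) = (\<Sum>j\<in>W. A i j * ann_right j K \<mu> \<nu>)
       + (\<Sum>j\<in>W. \<Sum>l\<in>W. A i j * B j l * ann_right l id_op \<mu> \<nu>)"
      using that by (simp add: second_quantizesD[OF K] distrib_left sum.distrib sum_distrib_left mult.assoc)
    also have "(\<Sum>j\<in>W. \<Sum>l\<in>W. A i j * B j l * ann_right l id_op \<mu> \<nu>) =
        (\<Sum>l\<in>W. (\<Sum>j\<in>W. A i j * B j l) * ann_right l id_op \<mu> \<nu>)"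
      by (subst sum.swap) (simp add: sum_distrib_right)
    finally show ?thesis by (simp add: add_ac)
  qed
  \<comment> \<open>The commutator intertwines with the identity matrix as coefficients.\<close>
  define D where "D = (\<lambda>\<mu> \<nu>. op_mult W J K \<mu> \<nu> - op_mult W K J \<mu> \<nu>)"
  have "D \<mu> \<nu> = 0"
  proof (rule intertwiner_eq_0[OF W, where P = "\<lambda>k i. if i = k then 1 else 0" and Q = "\<lambda>k i. if i = k then 1 else 0"])
    fix k \<mu> \<nu> assume k: "k \<in> W" "\<mu> \<subseteq> W" "\<nu> \<subseteq> W"
    have "(\<Sum>l\<in>W. (\<Sum>j\<in>W. A k j * B j l) * ann_right l id_op \<mu> \<nu>) =
          (\<Sum>l\<in>W. (\<Sum>j\<in>W. B k j * A j l) * ann_right l id_op \<mu> \<nu>)"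
      using AB k by (intro sum.cong refl) simp
    then have "ann_left k D \<mu> \<nu> = ann_right k D \<mu> \<nu>"
      using exp[OF J K k] exp[OF K J k]
      by (simp add: D_def ann_left_diff ann_right_diff)
    then show "(\<Sum>i\<in>W. (if i = k then 1 else 0) * ann_left i D \<mu> \<nu>) =
        (\<Sum>i\<in>W. (if i = k then 1 else 0) * ann_right i D \<mu> \<nu>)"
      using k fW by (simp add: if_distrib[of "\<lambda>t. t * _"] cong: if_cong)
  next
    fix \<nu> assume "\<nu> \<subseteq> W"
    have "op_mult W J K {} \<nu> = s * t * id_op {} \<nu>" "op_mult W K J {} \<nu> = s * t * id_op {} \<nu>"
      using fW \<open>\<nu> \<subseteq> W\<close> J0 K0
      by (simp_all add: op_mult_def id_op_def if_distrib[of "\<lambda>t. _ * t"] if_distrib[of "\<lambda>t. t * _"] cong: if_cong)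
    then show "D {} \<nu> = 0" by (simp add: D_def)
  qed (use \<mu> \<nu> in auto)
  then show ?thesis by (simp add: D_def)
qed

section \<open>Quadratic operators in the fermions\<close>

lemma wedge_sign_fsign: "wedge_sign = fsign"
  by (simp add: fun_eq_iff wedge_sign_def fsign_def)

lemma psi_star_anticommute:
  assumes "\<And>k. finite {s \<in> S. k < s}"
  shows "psi_star i (psi_star j v) S = - psi_star j (psi_star i v) S"
  using assms by (auto simp: psi_star_def wedge_sign_fsign fsign_insert insert_commute)

lemma psi_star_psi:
  assumes "\<And>k. finite {s \<in> S. k < s}"
  shows "psi_star i (psi k v) S = (if i = k then v S else 0) - psi k (psi_star i v) S"
proof (cases "i = k")
  case True
  then show ?thesis
    by (auto simp: psi_def psi_star_def wedge_sign_fsign fsign_remove fsign_insert_same insert_absorb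
        mult.assoc[symmetric])
next
  case False
  show ?thesis
  proof (cases "k \<in> S \<and> i \<notin> S")
    case True
    then obtain R where R: "S = insert k R" "k \<notin> R" by (metis Set.set_insert)
    have "finite {s \<in> R. c < s}" for c
      by (rule finite_subset[OF _ assms[of c]]) (use R in auto)
    moreover have "finite {s \<in> insert k R. c < s}" for c
      using assms[of c] R by simp
    moreover have "i \<notin> R" using True R by auto
    ultimately show ?thesis using R False
      by (auto simp: psi_def psi_star_def wedge_sign_fsign fsign_insert fsign_insert_same insert_commute
          insert_Diff_if)
  next
    case f: False
    then show ?thesis using False by (auto simp: psi_def psi_star_def)
  qed
qed

lemma psi_star_ket:
  "psi_star j (ket \<nu>) = (\<lambda>S. if j \<in> \<nu> then fsign j \<nu> * ket (\<nu> - {j}) S else 0)"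
  by (auto simp: fun_eq_iff psi_star_def ket_def wedge_sign_fsign fsign_remove insert_absorb fsign_insert_same)

text \<open>The matrix of \<open>\<Sum> A\<^sub>i\<^sub>j :\<psi>\<^sub>i \<psi>\<^sub>j\<^sup>*:\<close> on the window \<open>W\<close>, where the normal ordering
  subtracts the vacuum value for the sites in \<open>Z\<close>.\<close>

definition bilinear_op ::
  "int set \<Rightarrow> int set \<Rightarrow> (int \<Rightarrow> int \<Rightarrow> complex) \<Rightarrow> int set \<Rightarrow> int set \<Rightarrow> complex" where
  "bilinear_op W Z A \<mu> \<nu> = (\<Sum>i\<in>W. \<Sum>j\<in>W. A i j * psi i (psi_star j (ket \<nu>)) \<mu>)
     - (\<Sum>i\<in>W \<inter> Z. A i i) * id_op \<mu> \<nu>"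

text \<open>Moving \<open>\<psi>\<^sub>i\<^sup>*\<close> through \<open>\<psi>\<^sub>k \<psi>\<^sub>j\<^sup>*\<close> by the Clifford relations.\<close>

lemma ann_left_hop:
  assumes "finite \<mu>"
  shows "ann_left i (\<lambda>\<mu> \<nu>. psi k (psi_star j (ket \<nu>)) \<mu>) \<mu> \<nu> =
    ann_right i (\<lambda>\<mu> \<nu>. psi k (psi_star j (ket \<nu>)) \<mu>) \<mu> \<nu> + (if i = k then ann_right j id_op \<mu> \<nu> else 0)"
proof -
  have "ann_left i (\<lambda>\<mu> \<nu>. psi k (psi_star j (ket \<nu>)) \<mu>) \<mu> \<nu> = psi_star i (psi k (psi_star j (ket \<nu>))) \<mu>"
    by (simp add: ann_left_def psi_star_def wedge_sign_fsign)
  also have "\<dots> = (if i = k then psi_star j (ket \<nu>) \<mu> else 0) - psi k (psi_star i (psi_star j (ket \<nu>))) \<mu>"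
    by (rule psi_star_psi) (use assms in simp)
  also have "psi k (psi_star i (psi_star j (ket \<nu>))) \<mu> = - psi k (psi_star j (psi_star i (ket \<nu>))) \<mu>"
    using assms psi_star_anticommute[of "\<mu> - {k}" i j "ket \<nu>"] by (simp add: psi_def)
  also have "psi_star j (ket \<nu>) \<mu> = ann_right j id_op \<mu> \<nu>"
    unfolding psi_star_ket by (auto simp: ann_right_def id_op_def ket_def)
  also have "psi k (psi_star j (psi_star i (ket \<nu>))) \<mu> =
      ann_right i (\<lambda>\<mu> \<nu>. psi k (psi_star j (ket \<nu>)) \<mu>) \<mu> \<nu>"
    unfolding psi_star_ket[of i] by (simp add: ann_right_def psi_def psi_star_def)
  finally show ?thesis by simp
qed

lemma bilinear_op_second_quantizes:
  assumes "finite W"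
  shows "second_quantizes W (bilinear_op W Z A) A"
  unfolding second_quantizes_def
proof (intro ballI)
  fix i \<mu> \<nu> assume i: "i \<in> W" and "\<mu> \<in> Pow W" "\<nu> \<in> Pow W"
  then have fin: "finite \<mu>" using assms by (auto intro: finite_subset)
  have id: "ann_left i id_op \<mu> \<nu> = (ann_right i id_op \<mu> \<nu> :: complex)"
    by (auto simp: ann_left_def ann_right_def id_op_def fsign_insert_same)
  let ?h = "\<lambda>k j \<mu> \<nu>. psi k (psi_star j (ket \<nu>)) \<mu>"
  let ?c = "\<Sum>i\<in>W \<inter> Z. A i i"
  have "ann_left i (bilinear_op W Z A) \<mu> \<nu> =
      (\<Sum>k\<in>W. \<Sum>j\<in>W. A k j * ann_left i (?h k j) \<mu> \<nu>) - ?c * ann_left i id_op \<mu> \<nu>"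
    by (simp add: ann_left_def bilinear_op_def right_diff_distrib sum_distrib_left mult_ac)
  also have "(\<Sum>k\<in>W. \<Sum>j\<in>W. A k j * ann_left i (?h k j) \<mu> \<nu>) =
      (\<Sum>k\<in>W. \<Sum>j\<in>W. A k j * ann_right i (?h k j) \<mu> \<nu>) +
      (\<Sum>k\<in>W. \<Sum>j\<in>W. A k j * (if i = k then ann_right j id_op \<mu> \<nu> else 0))"
    by (simp only: ann_left_hop[OF fin] distrib_left sum.distrib)
  also have "(\<Sum>k\<in>W. \<Sum>j\<in>W. A k j * (if i = k then ann_right j id_op \<mu> \<nu> else 0)) =
     (\<Sum>k\<in>W. if k = i then (\<Sum>j\<in>W. A i j * ann_right j id_op \<mu> \<nu>) else 0)"
    by (intro sum.cong refl) auto
  also have "\<dots> = (\<Sum>j\<in>W. A i j * ann_right j id_op \<mu> \<nu>)"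
    using assms i by simp
  also have "(\<Sum>k\<in>W. \<Sum>j\<in>W. A k j * ann_right i (?h k j) \<mu> \<nu>) - ?c * ann_left i id_op \<mu> \<nu> =
      ann_right i (bilinear_op W Z A) \<mu> \<nu>"
    unfolding id
    by (simp add: ann_right_def bilinear_op_def right_diff_distrib sum_distrib_left mult_ac)
  ultimately show "ann_left i (bilinear_op W Z A) \<mu> \<nu> =
      ann_right i (bilinear_op W Z A) \<mu> \<nu> + (\<Sum>j\<in>W. A i j * ann_right j id_op \<mu> \<nu>)" by simp
qed

lemma bilinear_op_vacuum: "bilinear_op W Z A {} \<nu> = - (\<Sum>i\<in>W \<inter> Z. A i i) * id_op {} \<nu>"
  by (simp add: bilinear_op_def psi_def)

section \<open>The one-particle matrices of the currents\<close>

lemma fps_const_sum: "fps_const (\<Sum>a\<in>A. f a) = (\<Sum>a\<in>A. fps_const (f a))"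
  by (induction A rule: infinite_finite_induct) (simp_all add: fps_const_add[symmetric] del: fps_const_add)

text \<open>The elementary symmetric functions enter the currents in reversed order, hence the factors
  \<open>z - f a\<close> in place of \<open>1 - f a z\<close>.\<close>

lemma fps_X_esym_generating:
  assumes "finite I"
  shows "(\<Prod>a\<in>I. fps_X - fps_const (f a)) = (\<Sum>r\<le>card I. fps_const (esym I (\<lambda>a. - f a) r) * fps_X ^ (card I - r))"
proof -
  have "(\<Prod>a\<in>I. fps_X - fps_const (f a)) = (\<Prod>a\<in>I. fps_const (- f a) + fps_X)"
    by (intro prod.cong refl) (simp add: fps_const_neg[symmetric] del: fps_const_neg)
  also have "\<dots> = (\<Sum>S\<in>Pow I. (\<Prod>a\<in>S. fps_const (- f a)) * (\<Prod>a\<in>I - S. fps_X))"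
    by (rule prod_add[OF assms])
  also have "\<dots> = (\<Sum>S\<in>Pow I. fps_const (\<Prod>a\<in>S. - f a) * fps_X ^ (card I - card S))"
  proof (intro sum.cong refl)
    fix S assume "S \<in> Pow I"
    moreover from this have "finite S" using assms finite_subset by auto
    moreover from this have "(\<Prod>a\<in>S. fps_const (- f a)) = fps_const (\<Prod>a\<in>S. - f a)"
      by (induction S rule: finite_induct) auto
    ultimately show "(\<Prod>a\<in>S. fps_const (- f a)) * (\<Prod>a\<in>I - S. fps_X) =
        fps_const (\<Prod>a\<in>S. - f a) * fps_X ^ (card I - card S)"
      by (simp add: card_Diff_subset)
  qed
  also have "\<dots> = (\<Sum>r\<le>card I. \<Sum>S | S \<in> Pow I \<and> card S = r. fps_const (\<Prod>a\<in>S. - f a) * fps_X ^ (card I - card S))"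
    using assms by (intro sum.group[symmetric]) (auto intro: card_mono)
  also have "\<dots> = (\<Sum>r\<le>card I. fps_const (esym I (\<lambda>a. - f a) r) * fps_X ^ (card I - r))"
    by (simp add: esym_def fps_const_sum sum_distrib_right)
  finally show ?thesis .
qed

lemma fps_hsym_generating:
  assumes "finite I"
  shows "Abs_fps (hsym I f) * (\<Prod>a\<in>I. 1 - fps_const (f a) * fps_X) = 1"
  using assms
proof (induction I rule: finite_induct)
  case empty
  have "Abs_fps (hsym {} f) = 1" by (rule fps_ext) (simp add: hsym_empty)
  then show ?case by simp
next
  case (insert a I)
  have "Abs_fps (hsym (insert a I) f) = Abs_fps (\<lambda>k. f a ^ k) * Abs_fps (hsym I f)"
    by (rule fps_ext) (simp add: fps_mult_nth hsym_insert insert.hyps atLeast0AtMost)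
  moreover have "Abs_fps (\<lambda>k. f a ^ k) * (1 - fps_const (f a) * fps_X) = 1"
  proof (rule fps_ext)
    fix n
    show "fps_nth (Abs_fps (\<lambda>k. f a ^ k) * (1 - fps_const (f a) * fps_X)) n = fps_nth 1 n"
      by (cases n) (simp_all add: right_diff_distrib mult.assoc[symmetric] mult.commute[of _ "fps_const _"])
  qed
  ultimately have "Abs_fps (hsym (insert a I) f) * (\<Prod>b\<in>insert a I. 1 - fps_const (f b) * fps_X) =
     (Abs_fps (\<lambda>k. f a ^ k) * (1 - fps_const (f a) * fps_X)) * (Abs_fps (hsym I f) * (\<Prod>b\<in>I. 1 - fps_const (f b) * fps_X))"
    using insert.hyps by (simp add: mult_ac)
  with insert show ?case by (simp add: \<open>Abs_fps (\<lambda>k. f a ^ k) * (1 - fps_const (f a) * fps_X) = 1\<close>)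
qed

text \<open>The generating function \<open>\<Sum> A\<^sup>k\<^sub>i\<^sub>j z\<^sup>k\<close> of the one-particle matrices of the currents.
  In closed form, for \<open>i < j\<close>, it is \<open>(1 - \<alpha>\<^sub>j \<beta>\<^sub>j) z\<close> times the product of \<open>z - \<alpha>\<^sub>a\<close> over \<open>i <
  a < j\<close>, divided by the product of \<open>1 - \<beta>\<^sub>a z\<close> over \<open>i \<le> a \<le> j\<close>.\<close>

definition hop_fps :: "(int \<Rightarrow> complex) \<Rightarrow> (int \<Rightarrow> complex) \<Rightarrow> int \<Rightarrow> int \<Rightarrow> complex fps" where
  "hop_fps \<alpha> \<beta> i j = (if i = j then Abs_fps (\<lambda>n. \<beta> i ^ n)
     else if j < i then 0
     else fps_const (1 - \<alpha> j * \<beta> j) * fps_X * (\<Prod>a\<in>{i+1..j-1}. fps_X - fps_const (\<alpha> a)) * Abs_fps (hsym {i..j} \<beta>))"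

lemma current_coeff_hop_fps: "current_coeff \<alpha> \<beta> (int k) i j = fps_nth (hop_fps \<alpha> \<beta> i j) k"
proof (cases "i < j")
  case True
  define N where "N = nat (j - i - 1)"
  let ?I = "{i+1..j-1}"
  let ?e = "esym ?I (\<lambda>a. - \<alpha> a)" and ?h = "hsym {i..j} \<beta>"
  have N: "card ?I = N" "int N = j - i - 1" using True by (auto simp: N_def)
  have e0: "?e r = 0" if "r > N" for r using that N(1) by (simp add: esym_eq_0)
  let ?S = "\<Sum>r\<le>N. if int r + (int k - (j - i)) \<ge> 0 then ?e r * ?h (nat (int r + (int k - (j - i)))) else 0"
  have "fps_X * (\<Prod>a\<in>?I. fps_X - fps_const (\<alpha> a)) * Abs_fps ?h =
      (\<Sum>r\<le>N. fps_const (?e r) * (fps_X ^ (Suc N - r) * Abs_fps ?h))"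
    unfolding fps_X_esym_generating[OF finite_atLeastAtMost_int] N(1) sum_distrib_left sum_distrib_right
    by (intro sum.cong refl) (simp add: Suc_diff_le mult_ac)
  then have nth: "fps_nth (fps_X * (\<Prod>a\<in>?I. fps_X - fps_const (\<alpha> a)) * Abs_fps ?h) k =
      (\<Sum>r\<le>N. ?e r * (if k < Suc N - r then 0 else ?h (k - (Suc N - r))))"
    by (simp add: fps_sum_nth fps_X_power_mult_nth cong: if_cong)
  also have "\<dots> = ?S"
  proof (intro sum.cong refl)
    fix r assume "r \<in> {..N}"
    then have "int (Suc N - r) = j - i - int r" using N by auto
    then have "k < Suc N - r \<longleftrightarrow> \<not> int r + (int k - (j - i)) \<ge> 0"
      and "k \<ge> Suc N - r \<Longrightarrow> nat (int r + (int k - (j - i))) = k - (Suc N - r)" by linarith+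
    then show "?e r * (if k < Suc N - r then 0 else ?h (k - (Suc N - r))) =
       (if int r + (int k - (j - i)) \<ge> 0 then ?e r * ?h (nat (int r + (int k - (j - i)))) else 0)"
      by auto
  qed
  finally have S: "fps_nth (hop_fps \<alpha> \<beta> i j) k = (1 - \<alpha> j * \<beta> j) * ?S"
    using True by (simp add: hop_fps_def mult.assoc)
  have conv: "Sum_any (\<lambda>(r, s). if int r - int s = j - i - int k then ?e r * ?h s else 0) = ?S"
  proof -
    have "(\<lambda>(r, s). if int r - int s = j - i - int k then ?e r * ?h s else 0) =
      (\<lambda>(r, s). if int s - int r = int k - (j - i) then ?e r * ?h s else 0)"
      by (auto simp: fun_eq_iff)
    then show ?thesis using convolution_sum[of N ?e "int k - (j - i)" ?h, OF e0] by simp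
  qed
  show ?thesis
  proof (cases "k = 0")
    case True
    have "?S = 0"
      by (intro sum.neutral ballI) (use True N in auto)
    then show ?thesis using S True \<open>i < j\<close> by (simp add: current_coeff_def)
  next
    case False
    then show ?thesis using S conv True by (simp add: current_coeff_def)
  qed
qed (auto simp: current_coeff_def hop_fps_def)

text \<open>Passing from row \<open>k + 1\<close> to row \<open>k\<close> multiplies the product formula by \<open>(z - \<alpha> (k + 1)) /
  (1 - \<beta> k z)\<close>, except next to the diagonal. In matrix form this is \<open>(C - z B) R(z) = C\<close>, so
  that \<open>R(z)\<close> is the resolvent \<open>(1 - z C\<^sup>-\<^sup>1 B)\<^sup>-\<^sup>1\<close>.\<close>

lemma hop_fps_row_relation:
  "(1 - fps_const (\<beta> k) * fps_X) * hop_fps \<alpha> \<beta> k j + (fps_const (\<alpha> (k + 1)) - fps_X) * hop_fps \<alpha> \<beta> (k + 1) j =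
   (if j = k then 1 else if j = k + 1 then fps_const (\<alpha> j) else 0)"
proof -
  have geo: "Abs_fps (\<lambda>n. \<beta> i ^ n) = Abs_fps (hsym {i} \<beta>)" for i
    using hsym_insert[of "{}" i \<beta>]
    by (intro fps_ext) (simp add: hsym_empty if_distrib[of "\<lambda>t. _ * t"] cong: if_cong)
  have geo1: "(1 - fps_const (\<beta> i) * fps_X) * Abs_fps (hsym {i} \<beta>) = 1" for i
    using fps_hsym_generating[of "{i}" \<beta>] by (simp add: mult.commute)
  have step: "(1 - fps_const (\<beta> k) * fps_X) * Abs_fps (hsym {k..j} \<beta>) = Abs_fps (hsym {k+1..j} \<beta>)" if "k \<le> j" for j
  proof -
    let ?p = "\<lambda>I. \<Prod>a\<in>I. 1 - fps_const (\<beta> a) * fps_X"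
    let ?h = "\<lambda>I. Abs_fps (hsym I \<beta>)"
    have "{k..j} = insert k {k+1..j}" using that by auto
    then have p: "?p {k..j} = (1 - fps_const (\<beta> k) * fps_X) * ?p {k+1..j}" by simp
    have "(1 - fps_const (\<beta> k) * fps_X) * ?h {k..j} =
        (1 - fps_const (\<beta> k) * fps_X) * ?h {k..j} * (?h {k+1..j} * ?p {k+1..j})"
      by (simp only: fps_hsym_generating[OF finite_atLeastAtMost_int] mult_1_right)
    also have "\<dots> = ?h {k..j} * ((1 - fps_const (\<beta> k) * fps_X) * ?p {k+1..j}) * ?h {k+1..j}"
      by (simp only: mult_ac)
    also have "\<dots> = ?h {k+1..j}"
      by (simp only: p[symmetric] fps_hsym_generating[OF finite_atLeastAtMost_int] mult_1_left)
    finally show ?thesis .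
  qed
  consider "j < k" | "j = k" | "j = k + 1" | "j > k + 1" by linarith
  then show ?thesis
  proof cases
    case 2
    then show ?thesis by (simp add: hop_fps_def geo geo1)
  next
    case 3
    have "(1 - fps_const (\<beta> k) * fps_X) * hop_fps \<alpha> \<beta> k j =
        fps_const (1 - \<alpha> j * \<beta> j) * fps_X * Abs_fps (hsym {j} \<beta>)"
      using step[of j] 3 by (simp add: hop_fps_def mult_ac)
    moreover have "hop_fps \<alpha> \<beta> (k + 1) j = Abs_fps (hsym {j} \<beta>)" using 3 by (simp add: hop_fps_def geo)
    moreover have "fps_const (1 - \<alpha> j * \<beta> j) * fps_X + (fps_const (\<alpha> j) - fps_X) =
        fps_const (\<alpha> j) * (1 - fps_const (\<beta> j) * fps_X)"
      by (simp add: algebra_simps fps_const_sub[symmetric] fps_const_mult[symmetric] del: fps_const_sub fps_const_mult)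
    ultimately have "(1 - fps_const (\<beta> k) * fps_X) * hop_fps \<alpha> \<beta> k j + (fps_const (\<alpha> j) - fps_X) * hop_fps \<alpha> \<beta> (k + 1) j =
        fps_const (\<alpha> j) * ((1 - fps_const (\<beta> j) * fps_X) * Abs_fps (hsym {j} \<beta>))"
      by (simp only: distrib_right[symmetric] mult.assoc[symmetric])
    then show ?thesis using 3 by (simp only: geo1) simp
  next
    case 4
    let ?c = "fps_const (1 - \<alpha> j * \<beta> j) * fps_X * (\<Prod>a\<in>{k+2..j-1}. fps_X - fps_const (\<alpha> a))"
    have "{k+1..j-1} = insert (k+1) {k+2..j-1}" using 4 by auto
    then have k: "hop_fps \<alpha> \<beta> k j = ?c * (fps_X - fps_const (\<alpha> (k + 1))) * Abs_fps (hsym {k..j} \<beta>)"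
      using 4 by (simp add: hop_fps_def mult_ac)
    have k1: "hop_fps \<alpha> \<beta> (k + 1) j = ?c * Abs_fps (hsym {k+1..j} \<beta>)"
      using 4 by (simp add: hop_fps_def add.commute[of 2])
    have "(1 - fps_const (\<beta> k) * fps_X) * hop_fps \<alpha> \<beta> k j =
        ?c * (fps_X - fps_const (\<alpha> (k + 1))) * ((1 - fps_const (\<beta> k) * fps_X) * Abs_fps (hsym {k..j} \<beta>))"
      unfolding k by (simp only: mult_ac)
    also have "\<dots> = ?c * (fps_X - fps_const (\<alpha> (k + 1))) * Abs_fps (hsym {k+1..j} \<beta>)"
      using 4 by (simp only: step)
    finally show ?thesis using 4 unfolding k1 by (simp add: algebra_simps)
  qed (simp add: hop_fps_def)
qed

text \<open>The coefficient of \<open>z\<^sup>n\<^sup>+\<^sup>1\<close> in the resolvent identity: \<open>C A\<^sub>n\<^sub>+\<^sub>1 = B A\<^sub>n\<close>.\<close>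

lemma current_coeff_row_relation:
  "current_coeff \<alpha> \<beta> (int (Suc n)) k j + \<alpha> (k + 1) * current_coeff \<alpha> \<beta> (int (Suc n)) (k + 1) j =
   \<beta> k * current_coeff \<alpha> \<beta> (int n) k j + current_coeff \<alpha> \<beta> (int n) (k + 1) j"
  using arg_cong[OF hop_fps_row_relation[of \<beta> k \<alpha> j], of "\<lambda>f. fps_nth f (Suc n)"]
  unfolding current_coeff_hop_fps
  by (simp add: left_diff_distrib mult.assoc split: if_splits) (simp_all add: algebra_simps)

lemma current_coeff_upper: "j < i \<Longrightarrow> current_coeff \<alpha> \<beta> (int n) i j = 0"
  by (simp add: current_coeff_hop_fps hop_fps_def)

lemma current_coeff_0: "current_coeff \<alpha> \<beta> 0 i j = (if i = j then 1 else 0)"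
  by (simp add: current_coeff_def)

text \<open>Both sides are solutions \<open>M\<close> of \<open>C M = B A\<^sub>n\<close>, and \<open>C\<close> is unitriangular. The sum may be
  restricted to the interval \<open>W\<close> since the matrices are upper triangular.\<close>

lemma current_coeff_Suc:
  assumes W: "W = {a..b}" and i: "i \<in> W" and j: "j \<in> W"
  shows "current_coeff \<alpha> \<beta> (int (Suc n)) i j =
     (\<Sum>l\<in>W. current_coeff \<alpha> \<beta> 1 i l * current_coeff \<alpha> \<beta> (int n) l j)"
  using i
proof (induction "nat (b - i)" arbitrary: i rule: less_induct)
  case less
  let ?A = "\<lambda>n. current_coeff \<alpha> \<beta> (int n)"
  let ?R = "\<lambda>i. \<Sum>l\<in>W. ?A 1 i l * ?A n l j"
  have fW: "finite W" by (simp add: W)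
  have "?R i + \<alpha> (i + 1) * ?R (i + 1) = (\<Sum>l\<in>W. (?A (Suc 0) i l + \<alpha> (i + 1) * ?A (Suc 0) (i + 1) l) * ?A n l j)"
    by (simp add: distrib_right distrib_left sum.distrib sum_distrib_left mult_ac)
  also have "\<dots> = (\<Sum>l\<in>W. (\<beta> i * ?A 0 i l + ?A 0 (i + 1) l) * ?A n l j)"
    by (simp only: current_coeff_row_relation)
  also have "\<dots> = \<beta> i * ?A n i j + (if i + 1 \<in> W then ?A n (i + 1) j else 0)"
    using fW less.prems
    by (simp add: current_coeff_0 distrib_right sum.distrib if_distrib[of "\<lambda>t. t * _"] if_distrib[of "\<lambda>t. _ * t"] cong: if_cong)
  also have "(if i + 1 \<in> W then ?A n (i + 1) j else 0) = ?A n (i + 1) j"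
    using less.prems W j by (auto simp: current_coeff_upper)
  also have "\<beta> i * ?A n i j + \<dots> = ?A (Suc n) i j + \<alpha> (i + 1) * ?A (Suc n) (i + 1) j"
    by (simp only: current_coeff_row_relation)
  finally have rel: "?R i + \<alpha> (i + 1) * ?R (i + 1) = ?A (Suc n) i j + \<alpha> (i + 1) * ?A (Suc n) (i + 1) j" .
  have "?R (i + 1) = ?A (Suc n) (i + 1) j"
  proof (cases "i + 1 \<in> W")
    case True
    then show ?thesis using less.hyps[of "i + 1"] W by (auto simp add: of_nat_1[unfolded One_nat_def] simp del: of_nat_Suc)
  next
    case False
    then have "i = b" using W less.prems by auto
    then show ?thesis using W j
      by (auto intro!: sum.neutral simp: current_coeff_upper[where n = 1, simplified] current_coeff_upper simp del: of_nat_Suc)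
  qed
  with rel show ?case by simp
qed

lemma current_coeff_add:
  assumes W: "W = {a..b}" and i: "i \<in> W" and j: "j \<in> W"
  shows "current_coeff \<alpha> \<beta> (int (m + n)) i j =
     (\<Sum>l\<in>W. current_coeff \<alpha> \<beta> (int m) i l * current_coeff \<alpha> \<beta> (int n) l j)"
  using i
proof (induction m arbitrary: i)
  case 0
  then show ?case using W
    by (simp add: current_coeff_0 if_distrib[of "\<lambda>t. t * _"] del: atLeastAtMost_iff cong: if_cong)
next
  case (Suc m)
  let ?A = "\<lambda>n. current_coeff \<alpha> \<beta> (int n)"
  have "(\<Sum>l\<in>W. ?A (Suc m) i l * ?A n l j) = (\<Sum>l\<in>W. \<Sum>p\<in>W. ?A 1 i p * ?A m p l * ?A n l j)"
  proof (intro sum.cong refl)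
    fix l assume "l \<in> W"
    then have "?A (Suc m) i l = (\<Sum>p\<in>W. ?A 1 i p * ?A m p l)"
      using current_coeff_Suc[OF W Suc.prems] by simp
    then show "?A (Suc m) i l * ?A n l j = (\<Sum>p\<in>W. ?A 1 i p * ?A m p l * ?A n l j)"
      by (simp only: sum_distrib_right)
  qed
  also have "\<dots> = (\<Sum>p\<in>W. \<Sum>l\<in>W. ?A 1 i p * ?A m p l * ?A n l j)"
    by (rule sum.swap)
  also have "\<dots> = (\<Sum>p\<in>W. ?A 1 i p * ?A (m + n) p j)"
    by (intro sum.cong refl) (simp only: Suc.IH sum_distrib_left mult.assoc)
  also have "\<dots> = ?A (Suc (m + n)) i j" using current_coeff_Suc[OF W Suc.prems j, of \<alpha> \<beta> "m + n"] by (simp add: add.assoc)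
  finally show ?case by simp
qed

section \<open>Series in two variables and the Euler operator\<close>

abbreviation coeff2 :: "series \<Rightarrow> nat \<Rightarrow> nat \<Rightarrow> complex" where
  "coeff2 f b a \<equiv> fps_nth (fps_nth f b) a"

lemma series_eqI: "(\<And>b a. coeff2 f b a = coeff2 g b a) \<Longrightarrow> f = g"
  by (simp add: fps_eq_iff)

lemma coeff2_mult:
  "coeff2 (f * g) b a = (\<Sum>i=0..b. \<Sum>j=0..a. coeff2 f i j * coeff2 g (b - i) (a - j))"
  by (simp add: fps_mult_nth fps_sum_nth)

lemma coeff2_cst_mult: "coeff2 (cst c * f) b a = c * coeff2 f b a"
  by (simp add: cst_def)

lemma coeff2_var_x_mult: "coeff2 (var_x * f) b a = (if a = 0 then 0 else coeff2 f b (a - 1))"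
  by (simp add: var_x_def)

lemma coeff2_var_y_mult: "coeff2 (var_y * f) b a = (if b = 0 then 0 else coeff2 f (b - 1) a)"
  by (simp add: var_y_def)

lemma cst_hom: "cst (c + d) = cst c + cst d" "cst (c - d) = cst c - cst d" "cst (c * d) = cst c * cst d"
  "cst (- c) = - cst c" "cst 0 = 0" "cst 1 = 1"
  by (simp_all add: cst_def)

lemma cst_power: "cst (c ^ n) = cst c ^ n"
  by (induction n) (simp_all add: cst_hom)

lemma fsign_series: "(fsign i S :: series) = cst (fsign i S)"
  by (simp add: fsign_def cst_power cst_hom)

lemma of_nat_series: "(of_nat n :: series) = cst (of_nat n)"
  by (induction n) (simp_all add: cst_hom)

text \<open>The Euler operator \<open>x \<partial>\<^sub>x + y \<partial>\<^sub>y\<close>, which multiplies a monomial by its total degree.\<close>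

definition euler :: "series \<Rightarrow> series" where
  "euler f = Abs_fps (\<lambda>b. Abs_fps (\<lambda>a. of_nat (a + b) * coeff2 f b a))"

lemma coeff2_euler: "coeff2 (euler f) b a = of_nat (a + b) * coeff2 f b a"
  by (simp add: euler_def)

lemma euler_add: "euler (f + g) = euler f + euler g"
  by (rule series_eqI) (simp add: coeff2_euler ring_distribs)

lemma euler_diff: "euler (f - g) = euler f - euler g"
  by (rule series_eqI) (simp add: coeff2_euler ring_distribs)

lemma euler_cst_mult: "euler (cst c * f) = cst c * euler f"
  by (rule series_eqI) (simp add: coeff2_euler coeff2_cst_mult)

lemma euler_0: "euler 0 = 0"
  by (rule series_eqI) (simp add: coeff2_euler)

lemma euler_sum: "euler (\<Sum>i\<in>I. f i) = (\<Sum>i\<in>I. euler (f i))"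
  by (induction I rule: infinite_finite_induct) (simp_all add: euler_add euler_0)

lemma euler_cst: "euler (cst c) = 0"
  by (rule series_eqI) (simp add: coeff2_euler cst_def fps_const_def)

lemma euler_1: "euler 1 = 0"
  using euler_cst[of 1] by (simp add: cst_hom)

lemma euler_mult: "euler (f * g) = euler f * g + f * euler g"
proof (rule series_eqI)
  fix b a
  have "coeff2 (euler (f * g)) b a = (\<Sum>i=0..b. \<Sum>j=0..a.
      of_nat (j + i) * coeff2 f i j * coeff2 g (b - i) (a - j) +
      coeff2 f i j * (of_nat (a - j + (b - i)) * coeff2 g (b - i) (a - j)))"
    unfolding coeff2_euler coeff2_mult sum_distrib_left
    by (intro sum.cong refl) (auto simp: of_nat_diff algebra_simps)
  then show "coeff2 (euler (f * g)) b a = coeff2 (euler f * g + f * euler g) b a"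
    by (simp add: coeff2_mult coeff2_euler sum.distrib del: of_nat_add)
qed

lemma euler_var_x: "euler var_x = var_x"
  by (rule series_eqI) (auto simp: coeff2_euler var_x_def fps_const_def fps_X_def)

lemma euler_var_y: "euler var_y = var_y"
  by (rule series_eqI) (auto simp: coeff2_euler var_y_def fps_X_def)

text \<open>The series lies in the \<open>n\<close>-th power of the ideal generated by \<open>x\<close> and \<open>y\<close>.\<close>

definition vanishes_below :: "nat \<Rightarrow> series \<Rightarrow> bool" where
  "vanishes_below n f \<longleftrightarrow> (\<forall>a b. a + b < n \<longrightarrow> coeff2 f b a = 0)"

lemma vanishes_below_mult:
  assumes "vanishes_below m f" "vanishes_below n g"
  shows "vanishes_below (m + n) (f * g)"
  unfolding vanishes_below_def
proof (intro allI impI)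
  fix a b :: nat assume ab: "a + b < m + n"
  have "coeff2 f i j * coeff2 g (b - i) (a - j) = 0" if "i \<le> b" "j \<le> a" for i j
  proof (cases "j + i < m")
    case False
    with ab that have "(a - j) + (b - i) < n" by linarith
    with assms show ?thesis by (simp add: vanishes_below_def)
  qed (use assms in \<open>simp add: vanishes_below_def\<close>)
  then show "coeff2 (f * g) b a = 0" unfolding coeff2_mult by (intro sum.neutral ballI) auto
qed

lemma vanishes_below_0: "vanishes_below 0 f"
  by (simp add: vanishes_below_def)

lemma vanishes_below_mono: "vanishes_below n f \<Longrightarrow> m \<le> n \<Longrightarrow> vanishes_below m f"
  by (simp add: vanishes_below_def)

lemma vanishes_below_sum: "(\<And>i. i \<in> I \<Longrightarrow> vanishes_below n (f i)) \<Longrightarrow> vanishes_below n (\<Sum>i\<in>I. f i)"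
  by (simp add: vanishes_below_def fps_sum_nth)

lemma vanishes_below_diff: "vanishes_below n f \<Longrightarrow> vanishes_below n g \<Longrightarrow> vanishes_below n (f - g)"
  by (simp add: vanishes_below_def)

lemma vanishes_below_euler: "vanishes_below n f \<Longrightarrow> vanishes_below n (euler f)"
  by (simp add: vanishes_below_def coeff2_euler)

lemma eq_0_if_vanishes: "(\<And>n. vanishes_below n f) \<Longrightarrow> f = 0"
  by (rule series_eqI) (auto simp: vanishes_below_def)

lemma vanishes_below_1: "vanishes_below (Suc 0) f \<longleftrightarrow> coeff2 f 0 0 = 0"
  by (auto simp: vanishes_below_def)

text \<open>The Euler operator is injective on every positive total degree, and \<open>K\<close> and \<open>L\<close> raise the
  degree.\<close>

lemma euler_ode_unique:
  fixes G K L :: fock_matrix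
  assumes ode: "\<And>\<mu> \<nu>. \<mu> \<subseteq> W \<Longrightarrow> \<nu> \<subseteq> W \<Longrightarrow> euler (G \<mu> \<nu>) = op_mult W K G \<mu> \<nu> + op_mult W G L \<mu> \<nu>"
    and K: "\<And>\<mu> \<nu>. vanishes_below 1 (K \<mu> \<nu>)" and L: "\<And>\<mu> \<nu>. vanishes_below 1 (L \<mu> \<nu>)"
    and G0: "\<And>\<mu> \<nu>. \<mu> \<subseteq> W \<Longrightarrow> \<nu> \<subseteq> W \<Longrightarrow> coeff2 (G \<mu> \<nu>) 0 0 = 0"
    and "\<mu> \<subseteq> W" "\<nu> \<subseteq> W"
  shows "G \<mu> \<nu> = 0"
proof -
  have "vanishes_below n (G \<mu> \<nu>)" if "\<mu> \<subseteq> W" "\<nu> \<subseteq> W" for n \<mu> \<nu>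
    using that
  proof (induction n arbitrary: \<mu> \<nu>)
    case (Suc n)
    have "vanishes_below (Suc n) (euler (G \<mu> \<nu>))"
    proof -
      have "vanishes_below (1 + n) (op_mult W K G \<mu> \<nu>)"
        unfolding op_mult_def
        by (rule vanishes_below_sum, rule vanishes_below_mult[OF K]) (use Suc in auto)
      moreover have "vanishes_below (n + 1) (op_mult W G L \<mu> \<nu>)"
        unfolding op_mult_def
        by (rule vanishes_below_sum, rule vanishes_below_mult[OF _ L]) (use Suc in auto)
      ultimately
      show ?thesis by (simp add: ode Suc.prems vanishes_below_def)
    qed
    then show ?case using G0 Suc.prems
      by (auto simp: vanishes_below_def coeff2_euler simp del: of_nat_add)
  qed (simp add: vanishes_below_0)
  with assms show ?thesis by (intro eq_0_if_vanishes) auto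
qed

section \<open>The exponential of a matrix of series\<close>

primrec op_power :: "int set \<Rightarrow> fock_matrix \<Rightarrow> nat \<Rightarrow> fock_matrix" where
  "op_power W A 0 = id_op"
| "op_power W A (Suc n) = op_mult W A (op_power W A n)"

definition op_exp :: "int set \<Rightarrow> fock_matrix \<Rightarrow> fock_matrix" where
  "op_exp W A \<mu> \<nu> = series_sum (\<lambda>n. cst (1 / fact n) * op_power W A n \<mu> \<nu>)"

lemma vanishes_below_op_power:
  assumes "\<And>\<mu> \<nu>. vanishes_below 1 (H \<mu> \<nu>)"
  shows "vanishes_below n (op_power W H n \<mu> \<nu>)"
proof (induction n arbitrary: \<mu> \<nu>)
  case (Suc n)
  then have "vanishes_below (1 + n) (op_mult W H (op_power W H n) \<mu> \<nu>)"
    unfolding op_mult_def by (intro vanishes_below_sum vanishes_below_mult assms)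
  then show ?case by simp
qed (simp add: vanishes_below_0)

text \<open>The \<open>n\<close>-th power of \<open>H\<close> starts in total degree \<open>n\<close>. This replaces convergence in all later
  arguments about the exponential.\<close>

lemma op_exp_truncate:
  assumes "\<And>\<mu> \<nu>. vanishes_below 1 (H \<mu> \<nu>)"
  shows "vanishes_below (Suc N) (op_exp W H \<mu> \<nu> - (\<Sum>n\<le>N. cst (1 / fact n) * op_power W H n \<mu> \<nu>))"
  unfolding vanishes_below_def
proof (intro allI impI)
  fix a b :: nat assume ab: "a + b < Suc N"
  have "coeff2 (op_exp W H \<mu> \<nu>) b a =
      Sum_any (\<lambda>n. coeff2 (cst (1 / fact n) * op_power W H n \<mu> \<nu>) b a)"
    by (simp add: op_exp_def series_sum_def)
  also have "\<dots> = (\<Sum>n\<le>N. coeff2 (cst (1 / fact n) * op_power W H n \<mu> \<nu>) b a)"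
  proof (rule Sum_any.expand_superset)
    show "{n. coeff2 (cst (1 / fact n) * op_power W H n \<mu> \<nu>) b a \<noteq> 0} \<subseteq> {..N}"
    proof (rule subsetI, rule ccontr)
      fix n assume n: "n \<in> {n. coeff2 (cst (1 / fact n) * op_power W H n \<mu> \<nu>) b a \<noteq> 0}" "n \<notin> {..N}"
      then have "a + b < n" using ab by simp
      then have "coeff2 (op_power W H n \<mu> \<nu>) b a = 0"
        using vanishes_below_op_power[OF assms] by (auto simp: vanishes_below_def)
      with n show False by (simp add: coeff2_cst_mult)
    qed
  qed simp
  finally show "coeff2 (op_exp W H \<mu> \<nu> - (\<Sum>n\<le>N. cst (1 / fact n) * op_power W H n \<mu> \<nu>)) b a = 0"
    by (simp add: fps_sum_nth)
qed

lemma op_mult_cong: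
  assumes "\<And>\<kappa>. \<kappa> \<subseteq> W \<Longrightarrow> A \<mu> \<kappa> = A' \<mu> \<kappa>" "\<And>\<kappa>. \<kappa> \<subseteq> W \<Longrightarrow> B \<kappa> \<nu> = B' \<kappa> \<nu>"
  shows "op_mult W A B \<mu> \<nu> = op_mult W A' B' \<mu> \<nu>"
  using assms by (simp add: op_mult_def)

lemma euler_op_mult:
  "euler (op_mult W A B \<mu> \<nu>) = op_mult W (\<lambda>\<mu> \<nu>. euler (A \<mu> \<nu>)) B \<mu> \<nu> + op_mult W A (\<lambda>\<mu> \<nu>. euler (B \<mu> \<nu>)) \<mu> \<nu>"
  by (simp add: op_mult_def euler_sum euler_mult sum.distrib)

lemma op_mult_linear:
  "op_mult W (\<lambda>\<mu> \<nu>. A \<mu> \<nu> + B \<mu> \<nu>) C \<mu> \<nu> = op_mult W A C \<mu> \<nu> + op_mult W B C \<mu> \<nu>"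
  "op_mult W C (\<lambda>\<mu> \<nu>. A \<mu> \<nu> + B \<mu> \<nu>) \<mu> \<nu> = op_mult W C A \<mu> \<nu> + op_mult W C B \<mu> \<nu>"
  "op_mult W (\<lambda>\<mu> \<nu>. A \<mu> \<nu> - B \<mu> \<nu>) C \<mu> \<nu> = op_mult W A C \<mu> \<nu> - op_mult W B C \<mu> \<nu>"
  "op_mult W C (\<lambda>\<mu> \<nu>. A \<mu> \<nu> - B \<mu> \<nu>) \<mu> \<nu> = op_mult W C A \<mu> \<nu> - op_mult W C B \<mu> \<nu>"
  "op_mult W C (\<lambda>\<mu> \<nu>. c * A \<mu> \<nu>) \<mu> \<nu> = c * op_mult W C A \<mu> \<nu>"
  "op_mult W (\<lambda>\<mu> \<nu>. c * A \<mu> \<nu>) C \<mu> \<nu> = c * op_mult W A C \<mu> \<nu>"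
  "op_mult W (\<lambda>\<mu> \<nu>. \<Sum>i\<in>I. F i \<mu> \<nu>) C \<mu> \<nu> = (\<Sum>i\<in>I. op_mult W (F i) C \<mu> \<nu>)"
  "op_mult W C (\<lambda>\<mu> \<nu>. \<Sum>i\<in>I. F i \<mu> \<nu>) \<mu> \<nu> = (\<Sum>i\<in>I. op_mult W C (F i) \<mu> \<nu>)"
  by (simp_all add: op_mult_def ring_distribs sum.distrib sum_subtractf sum_distrib_left sum_distrib_right mult_ac
      sum.swap[of _ I])

lemma op_power_commute:
  assumes W: "finite W"
    and comm: "\<And>\<mu> \<nu>. \<mu> \<subseteq> W \<Longrightarrow> \<nu> \<subseteq> W \<Longrightarrow> op_mult W K H \<mu> \<nu> = op_mult W H K \<mu> \<nu>"
    and "\<mu> \<subseteq> W" "\<nu> \<subseteq> W"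
  shows "op_mult W K (op_power W H n) \<mu> \<nu> = op_mult W (op_power W H n) K \<mu> \<nu>"
  using assms(3,4)
proof (induction n arbitrary: \<mu> \<nu>)
  case (Suc n)
  have "op_mult W K (op_power W H (Suc n)) \<mu> \<nu> = op_mult W (op_mult W K H) (op_power W H n) \<mu> \<nu>"
    by (simp add: op_mult_assoc)
  also have "\<dots> = op_mult W (op_mult W H K) (op_power W H n) \<mu> \<nu>"
    by (rule op_mult_cong) (simp_all add: comm Suc.prems)
  also have "\<dots> = op_mult W H (op_mult W K (op_power W H n)) \<mu> \<nu>" by (simp add: op_mult_assoc)
  also have "\<dots> = op_mult W H (op_mult W (op_power W H n) K) \<mu> \<nu>"
    by (rule op_mult_cong) (simp_all add: Suc)
  finally show ?case by (simp add: op_mult_assoc)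
qed (simp add: op_mult_id_left op_mult_id_right W)

lemma euler_op_power:
  assumes W: "finite W"
    and H: "\<And>\<mu> \<nu>. euler (H \<mu> \<nu>) = K \<mu> \<nu> + L \<mu> \<nu>"
    and K: "\<And>\<mu> \<nu>. \<mu> \<subseteq> W \<Longrightarrow> \<nu> \<subseteq> W \<Longrightarrow> op_mult W K H \<mu> \<nu> = op_mult W H K \<mu> \<nu>"
    and L: "\<And>\<mu> \<nu>. \<mu> \<subseteq> W \<Longrightarrow> \<nu> \<subseteq> W \<Longrightarrow> op_mult W L H \<mu> \<nu> = op_mult W H L \<mu> \<nu>"
    and "\<mu> \<subseteq> W" "\<nu> \<subseteq> W"
  shows "euler (op_power W H (Suc n) \<mu> \<nu>) =
    of_nat (Suc n) * (op_mult W K (op_power W H n) \<mu> \<nu> + op_mult W (op_power W H n) L \<mu> \<nu>)"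
  using assms(5,6)
proof (induction n arbitrary: \<mu> \<nu>)
  case 0
  have "op_power W H (Suc 0) \<mu> \<nu> = H \<mu> \<nu>" using 0 W by (simp add: op_mult_id_right)
  then show ?case using 0 W H by (simp add: op_mult_id_left op_mult_id_right)
next
  case (Suc n)
  let ?P = "op_power W H n" and ?S = "op_power W H (Suc n)"
  have 1: "op_mult W H (op_mult W K ?P) \<mu> \<nu> = op_mult W K ?S \<mu> \<nu>"
  proof -
    have "op_mult W H (op_mult W K ?P) \<mu> \<nu> = op_mult W (op_mult W H K) ?P \<mu> \<nu>"
      by (simp add: op_mult_assoc)
    also have "\<dots> = op_mult W (op_mult W K H) ?P \<mu> \<nu>"
      by (rule op_mult_cong) (simp_all add: K Suc.prems)
    finally show ?thesis by (simp add: op_mult_assoc)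
  qed
  have 2: "op_mult W H (op_mult W ?P L) \<mu> \<nu> = op_mult W ?S L \<mu> \<nu>"
    by (simp add: op_mult_assoc)
  have 3: "op_mult W L ?S \<mu> \<nu> = op_mult W ?S L \<mu> \<nu>"
    by (rule op_power_commute[OF W L Suc.prems])
  have "euler (op_power W H (Suc (Suc n)) \<mu> \<nu>) = euler (op_mult W H ?S \<mu> \<nu>)" by simp
  also have "\<dots> = op_mult W (\<lambda>\<mu> \<nu>. K \<mu> \<nu> + L \<mu> \<nu>) ?S \<mu> \<nu> + op_mult W H (\<lambda>\<mu> \<nu>. euler (?S \<mu> \<nu>)) \<mu> \<nu>"
    unfolding euler_op_mult H ..
  also have "op_mult W H (\<lambda>\<mu> \<nu>. euler (?S \<mu> \<nu>)) \<mu> \<nu> =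
      op_mult W H (\<lambda>\<mu> \<nu>. of_nat (Suc n) * (op_mult W K ?P \<mu> \<nu> + op_mult W ?P L \<mu> \<nu>)) \<mu> \<nu>"
    by (rule op_mult_cong) (use Suc in simp_all)
  also have "\<dots> = of_nat (Suc n) * (op_mult W K ?S \<mu> \<nu> + op_mult W ?S L \<mu> \<nu>)"
    by (simp only: op_mult_linear 1 2)
  also have "op_mult W (\<lambda>\<mu> \<nu>. K \<mu> \<nu> + L \<mu> \<nu>) ?S \<mu> \<nu> = op_mult W K ?S \<mu> \<nu> + op_mult W ?S L \<mu> \<nu>"
    by (simp only: op_mult_linear 3)
  finally show ?case by (simp add: algebra_simps del: op_power.simps)
qed

text \<open>As \<open>K\<close> and \<open>L\<close> commute with \<open>H\<close>, the Euler operator sends \<open>H\<^sup>n\<^sup>+\<^sup>1 / (n + 1)!\<close> to \<open>(K H\<^sup>n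
  + H\<^sup>n L) / n!\<close>. Summed up to \<open>n = N\<close> this is the claim modulo total degree above \<open>N\<close>.\<close>

lemma euler_op_exp:
  assumes W: "finite W"
    and H: "\<And>\<mu> \<nu>. euler (H \<mu> \<nu>) = K \<mu> \<nu> + L \<mu> \<nu>" and H0: "\<And>\<mu> \<nu>. vanishes_below 1 (H \<mu> \<nu>)"
    and K: "\<And>\<mu> \<nu>. \<mu> \<subseteq> W \<Longrightarrow> \<nu> \<subseteq> W \<Longrightarrow> op_mult W K H \<mu> \<nu> = op_mult W H K \<mu> \<nu>"
    and L: "\<And>\<mu> \<nu>. \<mu> \<subseteq> W \<Longrightarrow> \<nu> \<subseteq> W \<Longrightarrow> op_mult W L H \<mu> \<nu> = op_mult W H L \<mu> \<nu>"
    and \<mu>\<nu>: "\<mu> \<subseteq> W" "\<nu> \<subseteq> W"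
  shows "euler (op_exp W H \<mu> \<nu>) = op_mult W K (op_exp W H) \<mu> \<nu> + op_mult W (op_exp W H) L \<mu> \<nu>"
proof -
  define E where "E = op_exp W H"
  define S where "S = (\<lambda>N \<mu> \<nu>. \<Sum>n\<le>N. cst (1 / fact n) * op_power W H n \<mu> \<nu>)"
  have trunc: "vanishes_below (Suc N) (E \<mu> \<nu> - S N \<mu> \<nu>)" for N \<mu> \<nu>
    unfolding E_def S_def by (rule op_exp_truncate[OF H0])
  have S: "euler (S (Suc N) \<mu> \<nu>) = op_mult W K (S N) \<mu> \<nu> + op_mult W (S N) L \<mu> \<nu>" for N
  proof -
    have "euler (S (Suc N) \<mu> \<nu>) = (\<Sum>n\<le>N. cst (1 / fact (Suc n)) * euler (op_power W H (Suc n) \<mu> \<nu>))"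
      unfolding S_def sum.atMost_Suc_shift
      by (simp add: euler_add euler_sum euler_cst_mult id_op_def euler_1 euler_0 del: op_power.simps(2))
    also have "\<dots> = (\<Sum>n\<le>N. cst (1 / fact n) * (op_mult W K (op_power W H n) \<mu> \<nu> + op_mult W (op_power W H n) L \<mu> \<nu>))"
    proof (rule sum.cong[OF refl])
      fix n
      have "cst (1 / fact (Suc n)) * (of_nat (Suc n) * X) = cst (1 / fact n) * X" for X
      proof -
        have "(1 / fact (Suc n)) * of_nat (Suc n) = (1 / fact n :: complex)"
          by (simp add: divide_simps del: of_nat_Suc)
        then have "cst (1 / fact (Suc n)) * of_nat (Suc n) = cst (1 / fact n)"
          by (simp only: of_nat_series cst_hom[symmetric])
        then show ?thesis by (simp only: mult.assoc[symmetric])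
      qed
      then show "cst (1 / fact (Suc n)) * euler (op_power W H (Suc n) \<mu> \<nu>) =
         cst (1 / fact n) * (op_mult W K (op_power W H n) \<mu> \<nu> + op_mult W (op_power W H n) L \<mu> \<nu>)"
        by (simp only: euler_op_power[OF W H K L \<mu>\<nu>])
    qed
    also have "\<dots> = op_mult W K (S N) \<mu> \<nu> + op_mult W (S N) L \<mu> \<nu>"
      by (simp add: S_def op_mult_linear distrib_left sum.distrib)
    finally show ?thesis .
  qed
  have "euler (E \<mu> \<nu>) - (op_mult W K E \<mu> \<nu> + op_mult W E L \<mu> \<nu>) = 0"
  proof (rule eq_0_if_vanishes)
    fix N
    have "euler (E \<mu> \<nu>) - (op_mult W K E \<mu> \<nu> + op_mult W E L \<mu> \<nu>) =
       euler (E \<mu> \<nu> - S (Suc N) \<mu> \<nu>) - op_mult W K (\<lambda>\<mu> \<nu>. E \<mu> \<nu> - S N \<mu> \<nu>) \<mu> \<nu>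
        - op_mult W (\<lambda>\<mu> \<nu>. E \<mu> \<nu> - S N \<mu> \<nu>) L \<mu> \<nu>"
      by (simp add: euler_diff S op_mult_linear)
    also have "vanishes_below N \<dots>"
    proof (rule vanishes_below_diff[OF vanishes_below_diff[OF vanishes_below_euler]])
      show "vanishes_below N (E \<mu> \<nu> - S (Suc N) \<mu> \<nu>)"
        by (rule vanishes_below_mono[OF trunc]) simp
      have t: "vanishes_below N (E \<mu> \<nu> - S N \<mu> \<nu>)" for \<mu> \<nu>
        by (rule vanishes_below_mono[OF trunc]) simp
      show "vanishes_below N (op_mult W K (\<lambda>\<mu> \<nu>. E \<mu> \<nu> - S N \<mu> \<nu>) \<mu> \<nu>)"
        using vanishes_below_mult[OF vanishes_below_0 t] by (simp add: op_mult_def vanishes_below_sum)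
      show "vanishes_below N (op_mult W (\<lambda>\<mu> \<nu>. E \<mu> \<nu> - S N \<mu> \<nu>) L \<mu> \<nu>)"
        using vanishes_below_mult[OF t vanishes_below_0] by (simp add: op_mult_def vanishes_below_sum)
    qed
    finally show "vanishes_below N (euler (E \<mu> \<nu>) - (op_mult W K E \<mu> \<nu> + op_mult W E L \<mu> \<nu>))" .
  qed
  then show ?thesis by (simp add: E_def)
qed

lemma op_exp_const:
  assumes "\<And>\<mu> \<nu>. vanishes_below 1 (H \<mu> \<nu>)"
  shows "coeff2 (op_exp W H \<mu> \<nu>) 0 0 = id_op \<mu> \<nu>"
  using op_exp_truncate[OF assms, where N = 0] by (simp add: vanishes_below_1 cst_hom id_op_def)

section \<open>Second quantization over the ring of series\<close>

text \<open>\<open>\<Sum> s a b J (a + b) x\<^sup>a y\<^sup>b\<close>. The Hamiltonian and both terms of its Euler derivative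
  have this form for a common sequence \<open>J\<close> and different weights \<open>s\<close>, so that relations of the
  currents carry over to all three at once.\<close>

definition wseries :: "(nat \<Rightarrow> nat \<Rightarrow> complex) \<Rightarrow> (nat \<Rightarrow> complex) \<Rightarrow> series" where
  "wseries s J = Abs_fps (\<lambda>b. Abs_fps (\<lambda>a. s a b * J (a + b)))"

lemma coeff2_wseries: "coeff2 (wseries s J) b a = s a b * J (a + b)"
  by (simp add: wseries_def)

lemma wseries_commute:
  assumes comm: "\<And>k l. op_mult W (J k) (J l) \<mu> \<nu> = op_mult W (J l) (J k) \<mu> \<nu>"
  shows "op_mult W (\<lambda>\<mu> \<nu>. wseries s (\<lambda>k. J k \<mu> \<nu>)) (\<lambda>\<mu> \<nu>. wseries t (\<lambda>k. J k \<mu> \<nu>)) \<mu> \<nu> =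
         op_mult W (\<lambda>\<mu> \<nu>. wseries t (\<lambda>k. J k \<mu> \<nu>)) (\<lambda>\<mu> \<nu>. wseries s (\<lambda>k. J k \<mu> \<nu>)) \<mu> \<nu>"
proof (rule series_eqI)
  fix b a
  have L: "coeff2 (op_mult W (\<lambda>\<mu> \<nu>. wseries s (\<lambda>k. J k \<mu> \<nu>)) (\<lambda>\<mu> \<nu>. wseries t (\<lambda>k. J k \<mu> \<nu>)) \<mu> \<nu>) b a =
     (\<Sum>i=0..b. \<Sum>j=0..a. s j i * t (a - j) (b - i) * op_mult W (J (j + i)) (J (a - j + (b - i))) \<mu> \<nu>)"
    unfolding op_mult_def fps_sum_nth coeff2_mult coeff2_wseries sum_distrib_left
    by (simp add: sum.swap[of _ _ "Pow W"] mult_ac)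
  have "coeff2 (op_mult W (\<lambda>\<mu> \<nu>. wseries t (\<lambda>k. J k \<mu> \<nu>)) (\<lambda>\<mu> \<nu>. wseries s (\<lambda>k. J k \<mu> \<nu>)) \<mu> \<nu>) b a =
     coeff2 (\<Sum>\<kappa>\<in>Pow W. wseries s (\<lambda>k. J k \<kappa> \<nu>) * wseries t (\<lambda>k. J k \<mu> \<kappa>)) b a"
    by (simp add: op_mult_def mult.commute)
  also have "\<dots> = (\<Sum>i=0..b. \<Sum>j=0..a. s j i * t (a - j) (b - i) * op_mult W (J (a - j + (b - i))) (J (j + i)) \<mu> \<nu>)"
    unfolding op_mult_def fps_sum_nth coeff2_mult coeff2_wseries sum_distrib_left
    by (simp add: sum.swap[of _ _ "Pow W"] mult_ac)
  finally show "coeff2 (op_mult W (\<lambda>\<mu> \<nu>. wseries s (\<lambda>k. J k \<mu> \<nu>)) (\<lambda>\<mu> \<nu>. wseries t (\<lambda>k. J k \<mu> \<nu>)) \<mu> \<nu>) b a =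
     coeff2 (op_mult W (\<lambda>\<mu> \<nu>. wseries t (\<lambda>k. J k \<mu> \<nu>)) (\<lambda>\<mu> \<nu>. wseries s (\<lambda>k. J k \<mu> \<nu>)) \<mu> \<nu>) b a"
    unfolding L by (simp only: comm)
qed

lemma wseries_second_quantizes:
  assumes "\<And>k. second_quantizes W (J k) (A k)"
  shows "second_quantizes W (\<lambda>\<mu> \<nu>. wseries s (\<lambda>k. J k \<mu> \<nu>)) (\<lambda>i j. wseries s (\<lambda>k. A k i j))"
  unfolding second_quantizes_def
proof (intro ballI)
  fix i \<mu> \<nu> assume i: "i \<in> W" "\<mu> \<in> Pow W" "\<nu> \<in> Pow W"
  have l: "coeff2 (ann_left i (\<lambda>\<mu> \<nu>. wseries s (\<lambda>k. J k \<mu> \<nu>)) \<mu> \<nu>) b a = s a b * ann_left i (J (a + b)) \<mu> \<nu>" for a b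
    by (simp add: ann_left_def fsign_series coeff2_cst_mult coeff2_wseries)
  have r: "coeff2 (ann_right i (\<lambda>\<mu> \<nu>. wseries s (\<lambda>k. J k \<mu> \<nu>)) \<mu> \<nu>) b a = s a b * ann_right i (J (a + b)) \<mu> \<nu>" for a b
    by (simp add: ann_right_def fsign_series coeff2_cst_mult coeff2_wseries)
  have d: "ann_right j id_op \<mu> \<nu> = cst (ann_right j id_op \<mu> \<nu>)" for j
    by (simp add: ann_right_def id_op_def fsign_series cst_hom)
  show "ann_left i (\<lambda>\<mu> \<nu>. wseries s (\<lambda>k. J k \<mu> \<nu>)) \<mu> \<nu> =
     ann_right i (\<lambda>\<mu> \<nu>. wseries s (\<lambda>k. J k \<mu> \<nu>)) \<mu> \<nu> + (\<Sum>j\<in>W. wseries s (\<lambda>k. A k i j) * ann_right j id_op \<mu> \<nu>)"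
    using i
    by (intro series_eqI)
       (simp add: l r fps_sum_nth d mult.commute[of _ "cst _"] coeff2_cst_mult coeff2_wseries
         second_quantizesD[OF assms] distrib_left sum_distrib_left mult_ac)
qed

lemma euler_ann:
  "euler (ann_left i F \<mu> \<nu>) = ann_left i (\<lambda>\<mu> \<nu>. euler (F \<mu> \<nu>)) \<mu> \<nu>"
  "euler (ann_right i F \<mu> \<nu>) = ann_right i (\<lambda>\<mu> \<nu>. euler (F \<mu> \<nu>)) \<mu> \<nu>"
  by (simp_all add: ann_left_def ann_right_def fsign_series euler_cst_mult euler_0)

text \<open>Apply the Euler operator to the intertwining relation \<open>\<psi>\<^sup>*(P\<^sub>k) T = T \<psi>\<^sup>*(Q\<^sub>k)\<close>, where \<open>P
  = C - x B\<close> and \<open>Q = C + y B\<close>. The derivatives of \<open>P\<close> and \<open>Q\<close> contribute \<open>- x B\<close> and \<open>y B\<close>, and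
  these are exactly the terms that arise when \<open>\<psi>\<^sup>*(P\<^sub>k)\<close> is moved past \<open>K\<close> and \<open>\<psi>\<^sup>*(Q\<^sub>k)\<close> past
  \<open>L\<close>, because \<open>P D = x B\<close> and \<open>Q D' = y B\<close>. Hence \<open>E T - K T - T L\<close> satisfies the same
  intertwining relation as \<open>T\<close>, and it vanishes on the vacuum row.\<close>

lemma euler_intertwiner:
  fixes T K L :: fock_matrix and C B D D' :: "int \<Rightarrow> int \<Rightarrow> series" and P Q :: "int \<Rightarrow> int \<Rightarrow> series"
  defines "P \<equiv> \<lambda>k i. C k i - var_x * B k i" and "Q \<equiv> \<lambda>k i. C k i + var_y * B k i"
  assumes W: "W = {a..b}"
    and diag: "\<And>k. k \<in> W \<Longrightarrow> P k k \<noteq> 0"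
    and tri: "\<And>k i. i < k \<Longrightarrow> P k i = 0"
    and const: "\<And>k i. euler (C k i) = 0" "\<And>k i. euler (B k i) = 0"
    and inter: "\<And>k \<mu> \<nu>. k \<in> W \<Longrightarrow> \<mu> \<subseteq> W \<Longrightarrow> \<nu> \<subseteq> W \<Longrightarrow>
       (\<Sum>i\<in>W. P k i * ann_left i T \<mu> \<nu>) = (\<Sum>i\<in>W. Q k i * ann_right i T \<mu> \<nu>)"
    and K: "second_quantizes W K D"
    and PD: "\<And>k j. k \<in> W \<Longrightarrow> j \<in> W \<Longrightarrow> (\<Sum>i\<in>W. P k i * D i j) = var_x * B k j"
    and L: "second_quantizes W L D'"
    and QD: "\<And>k j. k \<in> W \<Longrightarrow> j \<in> W \<Longrightarrow> (\<Sum>i\<in>W. Q k i * D' i j) = var_y * B k j"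
    and vac: "\<And>\<nu>. \<nu> \<subseteq> W \<Longrightarrow> euler (T {} \<nu>) = op_mult W K T {} \<nu> + op_mult W T L {} \<nu>"
    and "\<mu> \<subseteq> W" "\<nu> \<subseteq> W"
  shows "euler (T \<mu> \<nu>) = op_mult W K T \<mu> \<nu> + op_mult W T L \<mu> \<nu>"
proof -
  have fW: "finite W" by (simp add: W)
  define \<Delta> where "\<Delta> = (\<lambda>\<mu> \<nu>. euler (T \<mu> \<nu>) - op_mult W K T \<mu> \<nu> - op_mult W T L \<mu> \<nu>)"
  have "\<Delta> \<mu> \<nu> = 0"
  proof (rule intertwiner_eq_0[OF W, of P _ Q])
    fix k \<mu> \<nu> assume k: "k \<in> W" and \<mu>\<nu>: "\<mu> \<subseteq> W" "\<nu> \<subseteq> W"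
    have eP: "euler (P k i) = - (var_x * B k i)" and eQ: "euler (Q k i) = var_y * B k i" for i
      by (simp_all add: P_def Q_def euler_diff euler_add euler_mult const euler_var_x euler_var_y)
    let ?BL = "\<Sum>i\<in>W. var_x * B k i * ann_left i T \<mu> \<nu>"
    let ?BR = "\<Sum>i\<in>W. var_y * B k i * ann_right i T \<mu> \<nu>"
    have 1: "(\<Sum>i\<in>W. P k i * euler (ann_left i T \<mu> \<nu>)) - ?BL = (\<Sum>i\<in>W. Q k i * euler (ann_right i T \<mu> \<nu>)) + ?BR"
      using arg_cong[OF inter[OF k \<mu>\<nu>], of euler]
      by (simp add: euler_sum euler_mult eP eQ sum.distrib sum_negf sum_subtractf add.commute)
    have 2: "(\<Sum>i\<in>W. P k i * ann_left i (op_mult W K T) \<mu> \<nu>) =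
       (\<Sum>i\<in>W. Q k i * ann_right i (op_mult W K T) \<mu> \<nu>) + ?BL"
    proof -
      have "(\<Sum>i\<in>W. P k i * ann_left i (op_mult W K T) \<mu> \<nu>) =
         (\<Sum>i\<in>W. P k i * op_mult W K (ann_left i T) \<mu> \<nu>) +
         (\<Sum>i\<in>W. \<Sum>j\<in>W. P k i * D i j * ann_left j T \<mu> \<nu>)"
        by (simp add: second_quantized_mult_left[OF fW K _ \<mu>\<nu>(1)] distrib_left sum.distrib sum_distrib_left mult.assoc)
      also have "(\<Sum>i\<in>W. \<Sum>j\<in>W. P k i * D i j * ann_left j T \<mu> \<nu>) = (\<Sum>j\<in>W. (\<Sum>i\<in>W. P k i * D i j) * ann_left j T \<mu> \<nu>)"
        by (subst sum.swap) (simp add: sum_distrib_right)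
      also have "\<dots> = ?BL" by (intro sum.cong refl) (simp add: PD k)
      also have "(\<Sum>i\<in>W. P k i * op_mult W K (ann_left i T) \<mu> \<nu>) =
          op_mult W K (\<lambda>\<mu> \<nu>. \<Sum>i\<in>W. P k i * ann_left i T \<mu> \<nu>) \<mu> \<nu>"
        by (simp only: op_mult_linear)
      also have "\<dots> = op_mult W K (\<lambda>\<mu> \<nu>. \<Sum>i\<in>W. Q k i * ann_right i T \<mu> \<nu>) \<mu> \<nu>"
        by (rule op_mult_cong) (simp_all add: inter k \<mu>\<nu>)
      also have "\<dots> = (\<Sum>i\<in>W. Q k i * ann_right i (op_mult W K T) \<mu> \<nu>)"
        by (simp only: op_mult_linear ann_right_op_mult)
      finally show ?thesis .
    qed
    have 3: "(\<Sum>i\<in>W. P k i * ann_left i (op_mult W T L) \<mu> \<nu>) =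
       (\<Sum>i\<in>W. Q k i * ann_right i (op_mult W T L) \<mu> \<nu>) + ?BR"
    proof -
      have "(\<Sum>i\<in>W. P k i * ann_left i (op_mult W T L) \<mu> \<nu>) =
          op_mult W (\<lambda>\<mu> \<nu>. \<Sum>i\<in>W. P k i * ann_left i T \<mu> \<nu>) L \<mu> \<nu>"
        by (simp only: op_mult_linear ann_left_op_mult)
      also have "\<dots> = op_mult W (\<lambda>\<mu> \<nu>. \<Sum>i\<in>W. Q k i * ann_right i T \<mu> \<nu>) L \<mu> \<nu>"
        by (rule op_mult_cong) (simp_all add: inter k \<mu>\<nu>)
      also have "\<dots> = (\<Sum>i\<in>W. Q k i * op_mult W (ann_right i T) L \<mu> \<nu>)"
        by (simp only: op_mult_linear)
      also have "\<dots> = (\<Sum>i\<in>W. Q k i * ann_right i (op_mult W T L) \<mu> \<nu>) +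
         (\<Sum>i\<in>W. \<Sum>j\<in>W. Q k i * D' i j * ann_right j T \<mu> \<nu>)"
        by (simp add: second_quantized_mult_right[OF fW L _ \<mu>\<nu>(2)] distrib_left sum.distrib sum_distrib_left mult.assoc)
      also have "(\<Sum>i\<in>W. \<Sum>j\<in>W. Q k i * D' i j * ann_right j T \<mu> \<nu>) = (\<Sum>j\<in>W. (\<Sum>i\<in>W. Q k i * D' i j) * ann_right j T \<mu> \<nu>)"
        by (subst sum.swap) (simp add: sum_distrib_right)
      also have "\<dots> = ?BR" by (intro sum.cong refl) (simp add: QD k)
      finally show ?thesis .
    qed
    have l: "(\<Sum>i\<in>W. P k i * ann_left i \<Delta> \<mu> \<nu>) = (\<Sum>i\<in>W. P k i * euler (ann_left i T \<mu> \<nu>))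
        - (\<Sum>i\<in>W. P k i * ann_left i (op_mult W K T) \<mu> \<nu>) - (\<Sum>i\<in>W. P k i * ann_left i (op_mult W T L) \<mu> \<nu>)"
      by (simp add: \<Delta>_def ann_left_diff euler_ann right_diff_distrib sum_subtractf)
    have r: "(\<Sum>i\<in>W. Q k i * ann_right i \<Delta> \<mu> \<nu>) = (\<Sum>i\<in>W. Q k i * euler (ann_right i T \<mu> \<nu>))
        - (\<Sum>i\<in>W. Q k i * ann_right i (op_mult W K T) \<mu> \<nu>) - (\<Sum>i\<in>W. Q k i * ann_right i (op_mult W T L) \<mu> \<nu>)"
      by (simp add: \<Delta>_def ann_right_diff euler_ann right_diff_distrib sum_subtractf)
    show "(\<Sum>i\<in>W. P k i * ann_left i \<Delta> \<mu> \<nu>) = (\<Sum>i\<in>W. Q k i * ann_right i \<Delta> \<mu> \<nu>)"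
      unfolding l r 2 3 using 1 by (simp add: algebra_simps)
  next
    show "\<Delta> {} \<nu> = 0" if "\<nu> \<subseteq> W" for \<nu> using vac[OF that] by (simp add: \<Delta>_def)
  qed (use assms in auto)
  then show ?thesis by (simp add: \<Delta>_def algebra_simps)
qed

section \<open>The transfer matrix of a window and its local relation\<close>

text \<open>By particle conservation at every vertex, the left edge of column \<open>j\<close> is occupied by as
  many particles as the top row has in excess of the bottom row to the left of \<open>j\<close>.\<close>

definition height :: "int set \<Rightarrow> int set \<Rightarrow> int \<Rightarrow> int" where
  "height \<mu> \<nu> j = int (card {s \<in> \<nu>. j < s}) - int (card {s \<in> \<mu>. j < s})"

text \<open>The vertex weight with the color \<open>d\<close> of the left edge and \<open>r\<close> of the right edge computed
  from the height. Heights different from 0 and 1 are not colors and get weight 0, which encodes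
  the interlacing of the two states.\<close>

definition column_weight :: "series \<Rightarrow> series \<Rightarrow> int \<Rightarrow> bool \<Rightarrow> bool \<Rightarrow> series" where
  "column_weight al be d t b = (let r = d + of_bool t - of_bool b in
     if d \<in> {0, 1} \<and> r \<in> {0, 1} then weight_plus var_x var_y al be (d = 1) (r = 1) t b else 0)"

text \<open>The weight of the only coloring that can conserve particles at every vertex. The condition
  on the cardinalities says that the edge to the right of the last column is empty.\<close>

definition window_transfer ::
  "int set \<Rightarrow> (int \<Rightarrow> series) \<Rightarrow> (int \<Rightarrow> complex) \<Rightarrow> (int \<Rightarrow> complex) \<Rightarrow> fock_matrix" where
  "window_transfer W om \<alpha> \<beta> \<mu> \<nu> = (if card \<mu> = card \<nu>
     then \<Prod>j\<in>W. om j * column_weight (cst (\<alpha> j)) (cst (\<beta> j)) (height \<mu> \<nu> j) (j \<in> \<nu>) (j \<in> \<mu>) else 0)"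

text \<open>The local form of the intertwining relation: \<open>(al, be)\<close> belongs to column \<open>k\<close> and \<open>(al',
  be')\<close> to column \<open>k + 1\<close> on its left, \<open>d\<close> is the height at the left edge of the pair, and \<open>t\<close>,
  \<open>b\<close> tell which sites are occupied on top and bottom. A site added at the bottom and a site
  removed at the top lower the heights further right by the same amount, so that only these two
  columns differ among the four terms. The sign \<open>(- 1)\<^sup>d\<close> compares the particles to the left in
  both rows.\<close>

lemma two_column_relation:
  fixes al be al' be' :: series
  shows "(1 - var_x * be) * (if b0 then 0 else (if b1 then - 1 else 1) *
            (column_weight al' be' d t1 b1 * column_weight al be (d + of_bool t1 - of_bool b1) t0 True))
       + (al' - var_x) * (if b1 then 0 else
            column_weight al' be' d t1 True * column_weight al be (d + of_bool t1 - 1) t0 b0)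
       = (if even d then 1 else - 1) *
         ((1 + var_y * be) * (if t0 then (if t1 then - 1 else 1) *
            (column_weight al' be' d t1 b1 * column_weight al be (d + of_bool t1 - of_bool b1) False b0) else 0)
       + (al' + var_y) * (if t1 then
            column_weight al' be' d False b1 * column_weight al be (d - of_bool b1) t0 b0 else 0))"
proof -
  consider "d = 0" | "d = 1" | "d \<noteq> 0 \<and> d \<noteq> 1" by blast
  then show ?thesis
  proof cases
    case 1
    then show ?thesis
      by (cases t1; cases b1; cases t0; cases b0) (simp_all add: column_weight_def algebra_simps)
  next
    case 2
    then show ?thesis
      by (cases t1; cases b1; cases t0; cases b0) (simp_all add: column_weight_def algebra_simps)
  next
    case 3
    then show ?thesis by (simp add: column_weight_def)
  qed
qed

lemma card_above:
  fixes k :: int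
  assumes "finite S"
  shows "int (card {s \<in> S. k < s}) = int (card {s \<in> S. k + 1 < s}) + of_bool (k + 1 \<in> S)"
proof (cases "k + 1 \<in> S")
  case True
  then have "{s \<in> S. k < s} = insert (k + 1) {s \<in> S. k + 1 < s}" by auto
  then show ?thesis using True assms by simp
next
  case False
  then have "{s \<in> S. k < s} = {s \<in> S. k + 1 < s}"
    by (auto simp: order_le_less dest: zless_imp_add1_zle)
  then show ?thesis using False by simp
qed

lemma height_step:
  assumes "finite \<mu>" "finite \<nu>"
  shows "height \<mu> \<nu> k = height \<mu> \<nu> (k + 1) + of_bool (k + 1 \<in> \<nu>) - of_bool (k + 1 \<in> \<mu>)"
  using card_above[OF assms(1), of k] card_above[OF assms(2), of k] by (simp add: height_def)

lemma height_insert: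
  assumes "finite \<mu>" "i \<notin> \<mu>"
  shows "height (insert i \<mu>) \<nu> j = height \<mu> \<nu> j - of_bool (j < i)"
proof (cases "j < i")
  case True
  then have "{s \<in> insert i \<mu>. j < s} = insert i {s \<in> \<mu>. j < s}" by auto
  then show ?thesis using True assms by (simp add: height_def)
next
  case False
  then have "{s \<in> insert i \<mu>. j < s} = {s \<in> \<mu>. j < s}" by auto
  then show ?thesis using False by (simp add: height_def)
qed

lemma height_remove:
  assumes "finite \<nu>" "i \<in> \<nu>"
  shows "height \<mu> (\<nu> - {i}) j = height \<mu> \<nu> j - of_bool (j < i)"
proof (cases "j < i")
  case True
  then have "{s \<in> \<nu>. j < s} = insert i {s \<in> \<nu> - {i}. j < s}" using assms by auto
  then show ?thesis using True assms by (simp add: height_def)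
next
  case False
  then have "{s \<in> \<nu> - {i}. j < s} = {s \<in> \<nu>. j < s}" by auto
  then show ?thesis using False by (simp add: height_def)
qed

lemma fsign_step:
  assumes "finite S"
  shows "fsign k S = fsign (k + 1) S * (if k + 1 \<in> S then - 1 else 1)"
proof -
  have "card {s \<in> S. k < s} = card {s \<in> S. k + 1 < s} + of_bool (k + 1 \<in> S)"
    using card_above[OF assms, of k] by (simp add: of_bool_def split: if_splits)
  then show ?thesis by (simp add: fsign_def)
qed

lemma fsign_height: "fsign j \<nu> = fsign j \<mu> * (if even (height \<mu> \<nu> j) then 1 else - 1)"
proof -
  have "even (height \<mu> \<nu> j) \<longleftrightarrow> (even (card {s \<in> \<nu>. j < s}) \<longleftrightarrow> even (card {s \<in> \<mu>. j < s}))"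
    by (simp add: height_def)
  then show ?thesis by (auto simp: fsign_def minus_one_power_iff)
qed

text \<open>All columns except \<open>k\<close> and \<open>k + 1\<close> contribute the same factor to the four terms; the rest
  is the local relation.\<close>

lemma window_transfer_interior:
  fixes \<alpha> \<beta> :: "int \<Rightarrow> complex" and om :: "int \<Rightarrow> series"
  assumes W: "finite W" and k: "k \<in> W" "k + 1 \<in> W" and \<mu>: "\<mu> \<subseteq> W" and \<nu>: "\<nu> \<subseteq> W"
  defines "T \<equiv> window_transfer W om \<alpha> \<beta>"
  shows "(1 - var_x * cst (\<beta> k)) * ann_left k T \<mu> \<nu> + (cst (\<alpha> (k + 1)) - var_x) * ann_left (k + 1) T \<mu> \<nu> =
    (1 + var_y * cst (\<beta> k)) * ann_right k T \<mu> \<nu> + (cst (\<alpha> (k + 1)) + var_y) * ann_right (k + 1) T \<mu> \<nu>"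
proof (cases "Suc (card \<mu>) = card \<nu>")
  case True
  have fin: "finite \<mu>" "finite \<nu>" using \<mu> \<nu> W by (auto intro: finite_subset)
  let ?w = "\<lambda>j. column_weight (cst (\<alpha> j)) (cst (\<beta> j))"
  let ?h = "height \<mu> \<nu>"
  \<comment> \<open>The factor common to all four terms: the columns below \<open>k\<close> see one particle less.\<close>
  define R where "R = om k * om (k + 1) * (\<Prod>j\<in>W - {k, k + 1}. om j * ?w j (?h j - of_bool (j < k)) (j \<in> \<nu>) (j \<in> \<mu>))"
  define d where "d = ?h (k + 1)"
  have hk: "?h k = d + of_bool (k + 1 \<in> \<nu>) - of_bool (k + 1 \<in> \<mu>)"
    unfolding d_def by (rule height_step[OF fin])
  have split: "(\<Prod>j\<in>W. g j) = g k * g (k + 1) * (\<Prod>j\<in>W - {k, k + 1}. g j)" for g :: "int \<Rightarrow> series"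
  proof -
    have "W = insert k (insert (k + 1) (W - {k, k + 1}))" using k by auto
    then have "(\<Prod>j\<in>W. g j) = (\<Prod>j\<in>insert k (insert (k + 1) (W - {k, k + 1})). g j)" by simp
    also have "\<dots> = g k * (g (k + 1) * (\<Prod>j\<in>W - {k, k + 1}. g j))"
      using W by (subst prod.insert) auto
    finally show ?thesis by (simp add: mult.assoc)
  qed
  have below: "j < k + 1 \<longleftrightarrow> j < k" if "j \<noteq> k" for j :: int using that by auto
  have L: "T (insert i \<mu>) \<nu> = R *
      (?w (k + 1) (d - of_bool (k + 1 < i)) (k + 1 \<in> \<nu>) (k + 1 \<in> insert i \<mu>) *
       ?w k (?h k - of_bool (k < i)) (k \<in> \<nu>) (k \<in> insert i \<mu>))"
    if "i \<in> {k, k + 1}" "i \<notin> \<mu>" for i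
  proof -
    have "(\<Prod>j\<in>W - {k, k + 1}. om j * ?w j (height (insert i \<mu>) \<nu> j) (j \<in> \<nu>) (j \<in> insert i \<mu>)) =
       (\<Prod>j\<in>W - {k, k + 1}. om j * ?w j (?h j - of_bool (j < k)) (j \<in> \<nu>) (j \<in> \<mu>))"
      using that by (intro prod.cong refl) (auto simp: height_insert[OF fin(1)] below)
    then show ?thesis using that True fin
      by (simp add: T_def window_transfer_def split R_def height_insert d_def mult_ac)
  qed
  have Ri: "T \<mu> (\<nu> - {i}) = R *
      (?w (k + 1) (d - of_bool (k + 1 < i)) (k + 1 \<in> \<nu> - {i}) (k + 1 \<in> \<mu>) *
       ?w k (?h k - of_bool (k < i)) (k \<in> \<nu> - {i}) (k \<in> \<mu>))"
    if "i \<in> {k, k + 1}" "i \<in> \<nu>" for i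
  proof -
    have "(\<Prod>j\<in>W - {k, k + 1}. om j * ?w j (height \<mu> (\<nu> - {i}) j) (j \<in> \<nu> - {i}) (j \<in> \<mu>)) =
       (\<Prod>j\<in>W - {k, k + 1}. om j * ?w j (?h j - of_bool (j < k)) (j \<in> \<nu>) (j \<in> \<mu>))"
      using that by (intro prod.cong refl) (auto simp: height_remove[OF fin(2)] below)
    moreover have "card \<mu> = card (\<nu> - {i})" using that True fin by simp
    ultimately show ?thesis using that fin
      by (simp add: T_def window_transfer_def split R_def height_remove d_def mult_ac)
  qed
  define S where "S = (fsign (k + 1) \<mu> :: series) * R"
  have s\<nu>: "(fsign (k + 1) \<nu> :: series) = fsign (k + 1) \<mu> * (if even d then 1 else - 1)"
    unfolding d_def by (rule fsign_height)
  have 1: "ann_left k T \<mu> \<nu> = S * (if k \<in> \<mu> then 0 else (if k + 1 \<in> \<mu> then - 1 else 1) *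
      (?w (k + 1) d (k + 1 \<in> \<nu>) (k + 1 \<in> \<mu>) * ?w k (d + of_bool (k + 1 \<in> \<nu>) - of_bool (k + 1 \<in> \<mu>)) (k \<in> \<nu>) True))"
    using L[of k] by (simp add: ann_left_def fsign_step[OF fin(1), of k] S_def hk mult_ac)
  have 2: "ann_left (k + 1) T \<mu> \<nu> = S * (if k + 1 \<in> \<mu> then 0 else
      ?w (k + 1) d (k + 1 \<in> \<nu>) True * ?w k (d + of_bool (k + 1 \<in> \<nu>) - 1) (k \<in> \<nu>) (k \<in> \<mu>))"
    using L[of "k + 1"] by (simp add: ann_left_def S_def hk mult_ac)
  have 3: "ann_right k T \<mu> \<nu> = S * ((if even d then 1 else - 1) * (if k \<in> \<nu> then (if k + 1 \<in> \<nu> then - 1 else 1) *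
      (?w (k + 1) d (k + 1 \<in> \<nu>) (k + 1 \<in> \<mu>) * ?w k (d + of_bool (k + 1 \<in> \<nu>) - of_bool (k + 1 \<in> \<mu>)) False (k \<in> \<mu>)) else 0))"
    using Ri[of k] by (simp add: ann_right_def fsign_step[OF fin(2), of k] s\<nu> S_def hk mult_ac)
  have 4: "ann_right (k + 1) T \<mu> \<nu> = S * ((if even d then 1 else - 1) * (if k + 1 \<in> \<nu> then
      ?w (k + 1) d False (k + 1 \<in> \<mu>) * ?w k (d - of_bool (k + 1 \<in> \<mu>)) (k \<in> \<nu>) (k \<in> \<mu>) else 0))"
    using Ri[of "k + 1"] by (simp add: ann_right_def s\<nu> S_def hk mult_ac)
  have dist: "p * (S * u) + q * (S * v) = S * (p * u + q * v)"
    "p * (S * (s * u)) + q * (S * (s * v)) = S * (s * (p * u + q * v))" for p q u v s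
    by (simp_all add: algebra_simps)
  show ?thesis unfolding 1 2 3 4 dist(2) unfolding dist(1) two_column_relation ..
next
  case False
  have fin: "finite \<mu>" "finite \<nu>" using \<mu> \<nu> W by (auto intro: finite_subset)
  have "card \<mu> \<noteq> card (\<nu> - {i})" if "i \<in> \<nu>" for i
    using False card_Suc_Diff1[OF fin(2) that] by simp
  then show ?thesis using False fin by (simp add: ann_left_def ann_right_def T_def window_transfer_def)
qed

text \<open>In the leftmost column the left edge is empty, and only one column is involved.\<close>

lemma window_transfer_boundary:
  fixes \<alpha> \<beta> :: "int \<Rightarrow> complex" and om :: "int \<Rightarrow> series"
  assumes W: "finite W" and k: "k \<in> W" "\<And>i. i \<in> W \<Longrightarrow> i \<le> k" and \<mu>: "\<mu> \<subseteq> W" and \<nu>: "\<nu> \<subseteq> W"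
  defines "T \<equiv> window_transfer W om \<alpha> \<beta>"
  shows "(1 - var_x * cst (\<beta> k)) * ann_left k T \<mu> \<nu> = (1 + var_y * cst (\<beta> k)) * ann_right k T \<mu> \<nu>"
proof (cases "Suc (card \<mu>) = card \<nu>")
  case True
  have fin: "finite \<mu>" "finite \<nu>" using \<mu> \<nu> W by (auto intro: finite_subset)
  let ?w = "\<lambda>j. column_weight (cst (\<alpha> j)) (cst (\<beta> j))"
  let ?h = "height \<mu> \<nu>"
  define R where "R = om k * (\<Prod>j\<in>W - {k}. om j * ?w j (?h j - of_bool (j < k)) (j \<in> \<nu>) (j \<in> \<mu>))"
  have empty: "{s \<in> \<mu>. k < s} = {}" "{s \<in> \<nu>. k < s} = {}" using \<mu> \<nu> k(2) by force+
  have hk: "?h k = 0" "(fsign k \<mu> :: series) = 1" "(fsign k \<nu> :: series) = 1"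
    by (simp_all add: height_def fsign_def empty)
  have L: "T (insert k \<mu>) \<nu> = R * ?w k 0 (k \<in> \<nu>) True" if "k \<notin> \<mu>"
  proof -
    have "(\<Prod>j\<in>W - {k}. om j * ?w j (height (insert k \<mu>) \<nu> j) (j \<in> \<nu>) (j \<in> insert k \<mu>)) =
       (\<Prod>j\<in>W - {k}. om j * ?w j (?h j - of_bool (j < k)) (j \<in> \<nu>) (j \<in> \<mu>))"
      using that by (intro prod.cong refl) (auto simp: height_insert[OF fin(1)])
    then show ?thesis using that True fin hk
      by (simp add: T_def window_transfer_def prod.remove[OF W k(1)] R_def height_insert mult_ac)
  qed
  have Ri: "T \<mu> (\<nu> - {k}) = R * ?w k 0 False (k \<in> \<mu>)" if "k \<in> \<nu>"
  proof -
    have "(\<Prod>j\<in>W - {k}. om j * ?w j (height \<mu> (\<nu> - {k}) j) (j \<in> \<nu> - {k}) (j \<in> \<mu>)) =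
       (\<Prod>j\<in>W - {k}. om j * ?w j (?h j - of_bool (j < k)) (j \<in> \<nu>) (j \<in> \<mu>))"
      using that by (intro prod.cong refl) (auto simp: height_remove[OF fin(2)])
    moreover have "card \<mu> = card (\<nu> - {k})" using that True fin by simp
    ultimately show ?thesis using that fin hk
      by (simp add: T_def window_transfer_def prod.remove[OF W k(1)] R_def height_remove mult_ac)
  qed
  show ?thesis using L Ri
    by (auto simp: ann_left_def ann_right_def hk column_weight_def algebra_simps)
next
  case False
  have fin: "finite \<mu>" "finite \<nu>" using \<mu> \<nu> W by (auto intro: finite_subset)
  have "card \<mu> \<noteq> card (\<nu> - {i})" if "i \<in> \<nu>" for i
    using False card_Suc_Diff1[OF fin(2) that] by simp
  then show ?thesis using False fin by (simp add: ann_left_def ann_right_def T_def window_transfer_def)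
qed

definition bidiagonal :: "(int \<Rightarrow> 'a::comm_ring_1) \<Rightarrow> (int \<Rightarrow> 'a) \<Rightarrow> int \<Rightarrow> int \<Rightarrow> 'a" where
  "bidiagonal p q k i = (if i = k then p k else if i = k + 1 then q i else 0)"

lemma sum_bidiagonal:
  assumes "finite W" "k \<in> W"
  shows "(\<Sum>i\<in>W. bidiagonal p q k i * f i) = p k * f k + (if k + 1 \<in> W then q (k + 1) * f (k + 1) else 0)"
proof -
  have "(\<Sum>i\<in>W. bidiagonal p q k i * f i) = (\<Sum>i\<in>W. (if i = k then p k * f k else 0) + (if i = k + 1 then q (k + 1) * f (k + 1) else 0))"
    by (intro sum.cong refl) (simp add: bidiagonal_def)
  then show ?thesis using assms by (simp add: sum.distrib)
qed

lemma bidiagonal_linear: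
  "bidiagonal p q k i - c * bidiagonal p' q' k i = bidiagonal (\<lambda>k. p k - c * p' k) (\<lambda>k. q k - c * q' k) k i"
  "bidiagonal p q k i + c * bidiagonal p' q' k i = bidiagonal (\<lambda>k. p k + c * p' k) (\<lambda>k. q k + c * q' k) k i"
  by (simp_all add: bidiagonal_def)

lemma euler_bidiagonal: "euler (bidiagonal (\<lambda>k. cst (p k)) (\<lambda>k. cst (q k)) k i) = 0"
  by (simp add: bidiagonal_def euler_cst euler_0)

section \<open>Resolvents and the vacuum entry\<close>

definition x_weight :: "nat \<Rightarrow> nat \<Rightarrow> complex" where
  "x_weight a b = (if b = 0 \<and> a > 0 then 1 else 0)"

definition y_weight :: "nat \<Rightarrow> nat \<Rightarrow> complex" where
  "y_weight a b = (if a = 0 \<and> b > 0 then - ((- 1) ^ b) else 0)"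

text \<open>The coefficient of \<open>x\<^sup>a y\<^sup>b\<close> in \<open>\<Sum> (x\<^sup>k - (- y)\<^sup>k) / k\<close>; the quotient is \<open>0\<close> for \<open>a =
  b = 0\<close>.\<close>

definition H_weight :: "nat \<Rightarrow> nat \<Rightarrow> complex" where
  "H_weight a b = (x_weight a b + y_weight a b) / of_nat (a + b)"

text \<open>Multiplying by \<open>C - x B\<close> makes the sum \<open>\<Sum> x\<^sup>k A\<^sub>k\<close> telescope, leaving only the term
  of \<open>x\<^sup>1\<close>. Here \<open>A\<close> and \<open>A'\<close> stand for the entries in two consecutive rows.\<close>

lemma x_resolvent:
  assumes rec: "\<And>n. A (Suc n) + c * A' (Suc n) = d * A n + A' n"
  shows "(1 - var_x * cst d) * wseries x_weight A + (cst c - var_x) * wseries x_weight A' = var_x * cst (d * A 0 + A' 0)"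
proof (rule series_eqI)
  fix b a
  have "coeff2 (var_x * cst (d * A 0 + A' 0)) b a = (if b = 0 \<and> a = 1 then d * A 0 + A' 0 else 0)"
    by (auto simp: coeff2_var_x_mult cst_def fps_const_def)
  then show "coeff2 ((1 - var_x * cst d) * wseries x_weight A + (cst c - var_x) * wseries x_weight A') b a =
        coeff2 (var_x * cst (d * A 0 + A' 0)) b a"
    using rec[of "a - 1"]
    by (cases a) (auto simp: left_diff_distrib mult.assoc coeff2_var_x_mult coeff2_cst_mult coeff2_wseries
      x_weight_def algebra_simps)
qed

lemma y_resolvent:
  assumes rec: "\<And>n. A (Suc n) + c * A' (Suc n) = d * A n + A' n"
  shows "(1 + var_y * cst d) * wseries y_weight A + (cst c + var_y) * wseries y_weight A' = var_y * cst (d * A 0 + A' 0)"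
proof (rule series_eqI)
  fix b a
  have "coeff2 (var_y * cst (d * A 0 + A' 0)) b a = (if a = 0 \<and> b = 1 then d * A 0 + A' 0 else 0)"
    by (auto simp: coeff2_var_y_mult cst_def fps_const_def)
  moreover have "(-1) ^ b * A (Suc b) + (-1)^b * (c * A' (Suc b)) = (-1)^b * (d * A b) + (-1)^b * A' b" for b
    using arg_cong[OF rec[of b], of "\<lambda>t. (-1) ^ b * t"] by (simp add: algebra_simps)
  ultimately show "coeff2 ((1 + var_y * cst d) * wseries y_weight A + (cst c + var_y) * wseries y_weight A') b a =
        coeff2 (var_y * cst (d * A 0 + A' 0)) b a"
    using rec[of 0]
    by (cases b) (auto simp: distrib_right mult.assoc coeff2_var_y_mult coeff2_cst_mult coeff2_wseries
      y_weight_def algebra_simps simp del: fps_mult_nth_0)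
qed

lemma wseries_add: "wseries s (\<lambda>k. A k + B k) = wseries s A + wseries s B"
  by (rule series_eqI) (simp add: coeff2_wseries distrib_left)

lemma wseries_0: "wseries s (\<lambda>k. 0) = 0"
  by (rule series_eqI) (simp add: coeff2_wseries)

lemma wseries_sum: "wseries s (\<lambda>k. \<Sum>i\<in>I. A k i) = (\<Sum>i\<in>I. wseries s (\<lambda>k. A k i))"
  by (induction I rule: infinite_finite_induct) (simp_all add: wseries_add wseries_0)

lemma x_geometric: "wseries x_weight (\<lambda>n. - (c ^ n)) * (1 - cst c * var_x) = - (cst c * var_x)"
proof -
  have "(1 - var_x * cst c) * wseries x_weight (\<lambda>n. - (c ^ n)) + (cst 0 - var_x) * wseries x_weight (\<lambda>n. 0) =
      var_x * cst (c * - (c ^ 0) + 0)"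
    by (rule x_resolvent) simp
  then show ?thesis by (simp add: wseries_0 cst_hom mult_ac)
qed

lemma y_geometric: "wseries y_weight (\<lambda>n. - (c ^ n)) * (1 + cst c * var_y) = - (cst c * var_y)"
proof -
  have "(1 + var_y * cst c) * wseries y_weight (\<lambda>n. - (c ^ n)) + (cst 0 + var_y) * wseries y_weight (\<lambda>n. 0) =
      var_y * cst (c * - (c ^ 0) + 0)"
    by (rule y_resolvent) simp
  then show ?thesis by (simp add: wseries_0 cst_hom mult_ac)
qed

text \<open>The scalar that gives the empty vertex weight 1 outside the sea \<open>Z\<close> and the vertex with
  occupied vertical and empty horizontal edges weight 1 inside it.\<close>

definition sea_factor :: "int set \<Rightarrow> (int \<Rightarrow> complex) \<Rightarrow> int \<Rightarrow> series" where
  "sea_factor Z \<beta> j = (if j \<in> Z then inverse (1 + cst (\<beta> j) * var_y) else inverse (1 - cst (\<beta> j) * var_x))"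

lemma inverse_y: "inverse (1 + cst c * var_y) * (1 + cst c * var_y) = 1"
proof -
  let ?f = "1 + cst c * var_y"
  have f0: "fps_nth ?f 0 = 1" by (simp add: cst_def var_y_def)
  then have "?f * fps_right_inverse ?f 1 = 1" by (intro fps_right_inverse) simp
  moreover have "inverse ?f = fps_right_inverse ?f 1"
    unfolding fps_inverse_def[of ?f] f0 fps_inverse_one ..
  ultimately show ?thesis by (simp only: mult.commute)
qed

lemma inverse_x: "inverse (1 - cst c * var_x) * (1 - cst c * var_x) = 1"
proof -
  let ?g = "1 - fps_const c * fps_X :: complex fps"
  let ?f = "1 - cst c * var_x"
  have f: "?f = fps_const ?g"
    by (simp add: cst_def var_x_def fps_const_sub[symmetric] del: fps_const_sub)
  have "inverse ?g * ?g = 1" by (rule inverse_mult_eq_1) simp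
  then have g: "?g * inverse ?g = 1" by (simp add: mult.commute)
  then have "?f * fps_right_inverse ?f (inverse ?g) = 1"
    unfolding f by (intro fps_right_inverse) simp
  moreover have "inverse ?f = fps_right_inverse ?f (inverse ?g)"
    unfolding f fps_inverse_def[of "fps_const ?g"] by simp
  ultimately show ?thesis by (simp only: mult.commute)
qed

lemma coeff2_0_mult: "coeff2 (f * g) 0 0 = coeff2 f 0 0 * coeff2 g 0 0"
  by (simp add: coeff2_mult)

lemma coeff2_0_prod: "coeff2 (\<Prod>j\<in>W. f j) 0 0 = (\<Prod>j\<in>W. coeff2 (f j) 0 0)"
  by (induction W rule: infinite_finite_induct) (simp_all add: coeff2_0_mult)

lemma coeff2_0_var: "coeff2 var_x 0 0 = 0" "coeff2 var_y 0 0 = 0"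
  by (simp_all add: var_x_def var_y_def)

lemma coeff2_0_sea_factor: "coeff2 (sea_factor Z \<beta> j) 0 0 = 1"
  using arg_cong[OF inverse_x, of "\<lambda>f. coeff2 f 0 0" "\<beta> j"] arg_cong[OF inverse_y, of "\<lambda>f. coeff2 f 0 0" "\<beta> j"]
  by (simp add: sea_factor_def coeff2_0_mult coeff2_0_var del: fps_mult_nth_0)

lemma euler_prod:
  assumes "\<And>j. j \<in> W \<Longrightarrow> euler (f j) = \<kappa> j * f j"
  shows "euler (\<Prod>j\<in>W. f j) = (\<Sum>j\<in>W. \<kappa> j) * (\<Prod>j\<in>W. f j)"
  using assms
  by (induction W rule: infinite_finite_induct) (simp_all add: euler_1 euler_mult algebra_simps)

text \<open>The vacuum entry of the transfer matrix is a product of these factors. Inside the sea the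
  logarithmic derivative of \<open>(1 - \<beta> x) / (1 + \<beta> y)\<close> is the sum of two geometric series, and
  these are the normal ordering constants of \<open>K\<close> and \<open>L\<close>.\<close>

lemma euler_sea_factor:
  "euler (sea_factor Z \<beta> j * (1 - cst (\<beta> j) * var_x)) =
   (if j \<in> Z then wseries x_weight (\<lambda>n. - (\<beta> j ^ n)) + wseries y_weight (\<lambda>n. - (\<beta> j ^ n)) else 0)
     * (sea_factor Z \<beta> j * (1 - cst (\<beta> j) * var_x))"
proof (cases "j \<in> Z")
  case True
  let ?u = "1 - cst (\<beta> j) * var_x" and ?p = "1 + cst (\<beta> j) * var_y"
  let ?v = "inverse ?p"
  let ?kx = "wseries x_weight (\<lambda>n. - (\<beta> j ^ n))" and ?ky = "wseries y_weight (\<lambda>n. - (\<beta> j ^ n))"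
  have u: "euler ?u = ?kx * ?u"
    unfolding x_geometric by (simp add: euler_diff euler_1 euler_cst_mult euler_var_x)
  have "euler ?v * ?p + ?v * euler ?p = 0"
    unfolding euler_mult[symmetric] inverse_y by (rule euler_1)
  moreover have "euler ?p = - (?ky * ?p)"
    unfolding y_geometric by (simp add: euler_add euler_1 euler_cst_mult euler_var_y)
  moreover have "(e - v * k) * p = 0" if "e * p + v * q = 0" "q = - (k * p)" for e v k p q :: series
    using that by (simp add: algebra_simps)
  ultimately have "(euler ?v - ?v * ?ky) * ?p = 0" by blast
  moreover have "?p \<noteq> 0" using inverse_y[of "\<beta> j"] by auto
  ultimately have v: "euler ?v = ?v * ?ky" by simp
  have "euler (?v * ?u) = (?kx + ?ky) * (?v * ?u)"
    by (simp only: euler_mult u v) (simp add: algebra_simps)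
  then show ?thesis using True by (simp only: sea_factor_def if_True)
next
  case False
  then show ?thesis by (simp add: sea_factor_def inverse_x euler_1)
qed

text \<open>At \<open>x = y = 0\<close> the vertex at which a particle leaves through the bottom, and no particle
  enters from the top, has weight 0. So no particle can move.\<close>

lemma window_transfer_const:
  assumes W: "finite W" and \<mu>: "\<mu> \<subseteq> W" and \<nu>: "\<nu> \<subseteq> W"
  shows "coeff2 (window_transfer W (sea_factor Z \<beta>) \<alpha> \<beta> \<mu> \<nu>) 0 0 = id_op \<mu> \<nu>"
proof (cases "card \<mu> = card \<nu>")
  case c: True
  have cw: "coeff2 (window_transfer W (sea_factor Z \<beta>) \<alpha> \<beta> \<mu> \<nu>) 0 0 =
      (\<Prod>j\<in>W. coeff2 (column_weight (cst (\<alpha> j)) (cst (\<beta> j)) (height \<mu> \<nu> j) (j \<in> \<nu>) (j \<in> \<mu>)) 0 0)"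
    using c by (simp add: window_transfer_def coeff2_0_prod coeff2_0_mult coeff2_0_sea_factor del: fps_mult_nth_0)
  show ?thesis
  proof (cases "\<mu> = \<nu>")
    case True
    then have "height \<mu> \<nu> j = 0" for j by (simp add: height_def)
    then have "coeff2 (column_weight (cst (\<alpha> j)) (cst (\<beta> j)) (height \<mu> \<nu> j) (j \<in> \<nu>) (j \<in> \<mu>)) 0 0 = 1" for j
      using True by (cases "j \<in> \<nu>") (simp_all add: column_weight_def coeff2_0_var)
    then show ?thesis unfolding cw using True by (simp add: id_op_def)
  next
    case False
    have "\<not> \<mu> \<subseteq> \<nu>" using False c card_subset_eq[of \<nu> \<mu>] \<nu> W finite_subset by blast
    then obtain j where j: "j \<in> \<mu>" "j \<notin> \<nu>" by auto
    have "coeff2 (column_weight (cst (\<alpha> j)) (cst (\<beta> j)) (height \<mu> \<nu> j) (j \<in> \<nu>) (j \<in> \<mu>)) 0 0 = 0"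
      using j by (auto simp: column_weight_def coeff2_0_var)
    moreover have "j \<in> W" using j \<mu> by auto
    ultimately show ?thesis unfolding cw using False
      by (subst prod_zero[OF W]) (auto simp: id_op_def)
  qed
next
  case False
  then show ?thesis by (auto simp: window_transfer_def id_op_def)
qed

section \<open>The identity on a window\<close>

text \<open>Both sides satisfy \<open>E F = K F + F L\<close> and have the identity as constant term.\<close>

lemma window_transfer_eq_exp:
  fixes \<alpha> \<beta> :: "int \<Rightarrow> complex" and Z :: "int set"
  assumes W: "W = {a..b}" and "\<mu> \<subseteq> W" "\<nu> \<subseteq> W"
  defines "J \<equiv> \<lambda>k. bilinear_op W Z (current_coeff \<alpha> \<beta> (int k))"
  shows "window_transfer W (sea_factor Z \<beta>) \<alpha> \<beta> \<mu> \<nu> =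
     op_exp W (\<lambda>\<mu> \<nu>. wseries H_weight (\<lambda>k. J k \<mu> \<nu>)) \<mu> \<nu>"
proof -
  have fW: "finite W" by (simp add: W)
  let ?A = "\<lambda>n. current_coeff \<alpha> \<beta> (int n)"
  define T where "T = window_transfer W (sea_factor Z \<beta>) \<alpha> \<beta>"
  define H where "H = (\<lambda>\<mu> \<nu>. wseries H_weight (\<lambda>k. J k \<mu> \<nu>))"
  define K where "K = (\<lambda>\<mu> \<nu>. wseries x_weight (\<lambda>k. J k \<mu> \<nu>))"
  define L where "L = (\<lambda>\<mu> \<nu>. wseries y_weight (\<lambda>k. J k \<mu> \<nu>))"
  have Jq: "second_quantizes W (J k) (?A k)" for k
    unfolding J_def by (rule bilinear_op_second_quantizes[OF fW])
  have Jvac: "J k {} \<nu> = - (\<Sum>i\<in>W \<inter> Z. ?A k i i) * id_op {} \<nu>" for k \<nu>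
    unfolding J_def by (rule bilinear_op_vacuum)
  have Jcomm: "op_mult W (J k) (J l) \<mu> \<nu> = op_mult W (J l) (J k) \<mu> \<nu>"
    if "\<mu> \<subseteq> W" "\<nu> \<subseteq> W" for k l \<mu> \<nu>
  proof (rule second_quantized_commute[OF W Jq Jq _ Jvac Jvac that])
    fix i j assume ij: "i \<in> W" "j \<in> W"
    show "(\<Sum>m\<in>W. ?A k i m * ?A l m j) = (\<Sum>m\<in>W. ?A l i m * ?A k m j)"
      using current_coeff_add[OF W ij, of \<alpha> \<beta> k l] current_coeff_add[OF W ij, of \<alpha> \<beta> l k]
      by (simp add: add.commute)
  qed
  have van: "vanishes_below 1 (H \<mu> \<nu>)" "vanishes_below 1 (K \<mu> \<nu>)" "vanishes_below 1 (L \<mu> \<nu>)" for \<mu> \<nu>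
    by (simp_all add: H_def K_def L_def vanishes_below_1 coeff2_wseries H_weight_def x_weight_def y_weight_def)
  have eH: "euler (H \<mu> \<nu>) = K \<mu> \<nu> + L \<mu> \<nu>" for \<mu> \<nu>
  proof (rule series_eqI)
    fix b a
    have "of_nat (a + b) * H_weight a b = x_weight a b + y_weight a b"
      by (simp add: H_weight_def x_weight_def y_weight_def del: of_nat_add)
    then show "coeff2 (euler (H \<mu> \<nu>)) b a = coeff2 (K \<mu> \<nu> + L \<mu> \<nu>) b a"
      unfolding coeff2_euler H_def K_def L_def
      by (simp add: coeff2_wseries mult.assoc[symmetric] distrib_right[symmetric] del: of_nat_add)
  qed
  have eE: "euler (op_exp W H \<mu> \<nu>) = op_mult W K (op_exp W H) \<mu> \<nu> + op_mult W (op_exp W H) L \<mu> \<nu>"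
    if "\<mu> \<subseteq> W" "\<nu> \<subseteq> W" for \<mu> \<nu>
  proof (rule euler_op_exp[OF fW eH van(1) _ _ that])
    fix \<mu> \<nu> assume s: "\<mu> \<subseteq> W" "\<nu> \<subseteq> W"
    show "op_mult W K H \<mu> \<nu> = op_mult W H K \<mu> \<nu>" "op_mult W L H \<mu> \<nu> = op_mult W H L \<mu> \<nu>"
      unfolding K_def H_def L_def by (rule wseries_commute, rule Jcomm[OF s])+
  qed
  let ?C = "bidiagonal (\<lambda>k. cst 1) (\<lambda>k. cst (\<alpha> k))" and ?B = "bidiagonal (\<lambda>k. cst (\<beta> k)) (\<lambda>k. cst 1)"
  have P: "?C k i - var_x * ?B k i = bidiagonal (\<lambda>k. 1 - var_x * cst (\<beta> k)) (\<lambda>k. cst (\<alpha> k) - var_x) k i" for k i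
    by (simp add: bidiagonal_linear cst_hom)
  have Q: "?C k i + var_y * ?B k i = bidiagonal (\<lambda>k. 1 + var_y * cst (\<beta> k)) (\<lambda>k. cst (\<alpha> k) + var_y) k i" for k i
    by (simp add: bidiagonal_linear cst_hom)
  \<comment> \<open>At the top of the window row \<open>k + 1\<close> is missing; it vanishes there by triangularity.\<close>
  have outside: "wseries s (\<lambda>n. ?A n (k + 1) j) = 0" if "k \<in> W" "k + 1 \<notin> W" "j \<in> W" for s k j
    using that W by (simp add: current_coeff_upper wseries_0)
  have row: "?A (Suc n) k j + \<alpha> (k + 1) * ?A (Suc n) (k + 1) j = \<beta> k * ?A n k j + ?A n (k + 1) j" for n k j
    by (rule current_coeff_row_relation)
  have B0: "\<beta> k * ?A 0 k j + ?A 0 (k + 1) j = (if j = k then \<beta> k else if j = k + 1 then 1 else 0)" for k j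
    by (simp add: current_coeff_0)
  have eT: "euler (T \<mu> \<nu>) = op_mult W K T \<mu> \<nu> + op_mult W T L \<mu> \<nu>"
    if "\<mu> \<subseteq> W" "\<nu> \<subseteq> W" for \<mu> \<nu>
  proof (rule euler_intertwiner[where C = ?C and B = ?B and D = "\<lambda>i j. wseries x_weight (\<lambda>k. ?A k i j)"
        and D' = "\<lambda>i j. wseries y_weight (\<lambda>k. ?A k i j)", OF W, unfolded P Q])
    fix k assume "k \<in> W"
    have "1 - var_x * cst (\<beta> k) \<noteq> 0"
    proof
      assume z: "1 - var_x * cst (\<beta> k) = 0"
      have "coeff2 (1 - var_x * cst (\<beta> k)) 0 0 = 1" by (simp add: coeff2_0_var)
      then show False unfolding z by simp
    qed
    then show "bidiagonal (\<lambda>k. 1 - var_x * cst (\<beta> k)) (\<lambda>k. cst (\<alpha> k) - var_x) k k \<noteq> 0"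
      by (simp only: bidiagonal_def simp_thms if_True)
  next
    fix k i :: int assume "i < k"
    then show "bidiagonal (\<lambda>k. 1 - var_x * cst (\<beta> k)) (\<lambda>k. cst (\<alpha> k) - var_x) k i = 0"
      by (simp add: bidiagonal_def)
  next
    fix k \<mu> \<nu> assume k: "k \<in> W" and s: "\<mu> \<subseteq> W" "\<nu> \<subseteq> W"
    show "(\<Sum>i\<in>W. bidiagonal (\<lambda>k. 1 - var_x * cst (\<beta> k)) (\<lambda>k. cst (\<alpha> k) - var_x) k i * ann_left i T \<mu> \<nu>) =
       (\<Sum>i\<in>W. bidiagonal (\<lambda>k. 1 + var_y * cst (\<beta> k)) (\<lambda>k. cst (\<alpha> k) + var_y) k i * ann_right i T \<mu> \<nu>)"
    proof (cases "k + 1 \<in> W")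
      case True
      then show ?thesis unfolding sum_bidiagonal[OF fW k] T_def
        using window_transfer_interior[OF fW k True s] by simp
    next
      case False
      then have "\<And>i. i \<in> W \<Longrightarrow> i \<le> k" using k W by auto
      then show ?thesis unfolding sum_bidiagonal[OF fW k] T_def
        using window_transfer_boundary[OF fW k _ s] False by simp
    qed
  next
    show "second_quantizes W K (\<lambda>i j. wseries x_weight (\<lambda>k. ?A k i j))"
      unfolding K_def by (rule wseries_second_quantizes[OF Jq])
  next
    fix k j assume k: "k \<in> W" and j: "j \<in> W"
    show "(\<Sum>i\<in>W. bidiagonal (\<lambda>k. 1 - var_x * cst (\<beta> k)) (\<lambda>k. cst (\<alpha> k) - var_x) k i * wseries x_weight (\<lambda>k. ?A k i j)) =
        var_x * ?B k j" (is "?lhs = _")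
    proof -
      have "?lhs = (1 - var_x * cst (\<beta> k)) * wseries x_weight (\<lambda>n. ?A n k j) + (cst (\<alpha> (k + 1)) - var_x) * wseries x_weight (\<lambda>n. ?A n (k + 1) j)"
        unfolding sum_bidiagonal[OF fW k] using outside[OF k _ j, of x_weight] by simp
      also have "\<dots> = var_x * cst (\<beta> k * ?A 0 k j + ?A 0 (k + 1) j)"
        by (rule x_resolvent[of "\<lambda>n. ?A n k j" "\<alpha> (k + 1)" "\<lambda>n. ?A n (k + 1) j", OF row])
      also have "\<dots> = var_x * ?B k j"
        unfolding B0 by (simp add: bidiagonal_def cst_hom)
      finally show ?thesis .
    qed
  next
    show "second_quantizes W L (\<lambda>i j. wseries y_weight (\<lambda>k. ?A k i j))"
      unfolding L_def by (rule wseries_second_quantizes[OF Jq])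
  next
    fix k j assume k: "k \<in> W" and j: "j \<in> W"
    show "(\<Sum>i\<in>W. bidiagonal (\<lambda>k. 1 + var_y * cst (\<beta> k)) (\<lambda>k. cst (\<alpha> k) + var_y) k i * wseries y_weight (\<lambda>k. ?A k i j)) =
        var_y * ?B k j" (is "?lhs = _")
    proof -
      have "?lhs = (1 + var_y * cst (\<beta> k)) * wseries y_weight (\<lambda>n. ?A n k j) + (cst (\<alpha> (k + 1)) + var_y) * wseries y_weight (\<lambda>n. ?A n (k + 1) j)"
        unfolding sum_bidiagonal[OF fW k] using outside[OF k _ j, of y_weight] by simp
      also have "\<dots> = var_y * cst (\<beta> k * ?A 0 k j + ?A 0 (k + 1) j)"
        by (rule y_resolvent[of "\<lambda>n. ?A n k j" "\<alpha> (k + 1)" "\<lambda>n. ?A n (k + 1) j", OF row])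
      also have "\<dots> = var_y * ?B k j"
        unfolding B0 by (simp add: bidiagonal_def cst_hom)
      finally show ?thesis .
    qed
  next
    fix \<nu> assume s: "\<nu> \<subseteq> W"
    have KL: "K {} \<kappa> = (if \<kappa> = {} then \<Sum>i\<in>W \<inter> Z. wseries x_weight (\<lambda>n. - (\<beta> i ^ n)) else 0)"
      "L {} \<kappa> = (if \<kappa> = {} then \<Sum>i\<in>W \<inter> Z. wseries y_weight (\<lambda>n. - (\<beta> i ^ n)) else 0)" for \<kappa>
    proof -
      have A: "?A n i i = \<beta> i ^ n" for n i by (simp add: current_coeff_def)
      show "K {} \<kappa> = (if \<kappa> = {} then \<Sum>i\<in>W \<inter> Z. wseries x_weight (\<lambda>n. - (\<beta> i ^ n)) else 0)"
        "L {} \<kappa> = (if \<kappa> = {} then \<Sum>i\<in>W \<inter> Z. wseries y_weight (\<lambda>n. - (\<beta> i ^ n)) else 0)"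
        by (simp_all add: K_def L_def Jvac id_op_def A wseries_0 wseries_sum[symmetric] sum_negf)
    qed
    have T0: "T {} \<kappa> = 0" if "\<kappa> \<noteq> {}" "\<kappa> \<subseteq> W" for \<kappa>
      using that fW finite_subset[of \<kappa> W] by (auto simp: T_def window_transfer_def)
    have T1: "T {} {} = (\<Prod>j\<in>W. sea_factor Z \<beta> j * (1 - cst (\<beta> j) * var_x))"
      by (simp add: T_def window_transfer_def height_def column_weight_def)
    have K1: "op_mult W K T {} \<nu> = K {} {} * T {} \<nu>"
      unfolding op_mult_def using fW
      by (subst sum.remove[of _ "{}"]) (auto simp: KL)
    have L1: "op_mult W T L {} \<nu> = T {} {} * L {} \<nu>"
      unfolding op_mult_def using fW
      by (subst sum.remove[of _ "{}"]) (auto simp: T0)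
    show "euler (T {} \<nu>) = op_mult W K T {} \<nu> + op_mult W T L {} \<nu>"
    proof (cases "\<nu> = {}")
      case True
      have KL0: "K {} {} + L {} {} = (\<Sum>j\<in>W. if j \<in> Z
          then wseries x_weight (\<lambda>n. - (\<beta> j ^ n)) + wseries y_weight (\<lambda>n. - (\<beta> j ^ n)) else 0)"
        using fW by (simp add: KL sum.inter_restrict sum.distrib[symmetric] cong: if_cong)
          (intro sum.cong refl, simp)
      have "euler (T {} {}) = (K {} {} + L {} {}) * T {} {}"
        unfolding T1 KL0 by (rule euler_prod, rule euler_sea_factor)
      then show ?thesis unfolding K1 L1 by (simp add: True algebra_simps)
    next
      case False
      then show ?thesis unfolding K1 L1 by (simp add: T0[OF False s] KL euler_0)
    qed
  qed (use that in \<open>simp_all add: euler_bidiagonal\<close>)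
  define G where "G = (\<lambda>\<mu> \<nu>. T \<mu> \<nu> - op_exp W H \<mu> \<nu>)"
  have "G \<mu> \<nu> = 0"
  proof (rule euler_ode_unique[of W G K L, OF _ van(2,3)])
    fix \<mu> \<nu> assume s: "\<mu> \<subseteq> W" "\<nu> \<subseteq> W"
    show "euler (G \<mu> \<nu>) = op_mult W K G \<mu> \<nu> + op_mult W G L \<mu> \<nu>"
      unfolding G_def euler_diff eT[OF s] eE[OF s] op_mult_linear by simp
    show "coeff2 (G \<mu> \<nu>) 0 0 = 0"
      using window_transfer_const[OF fW s] op_exp_const[OF van(1)] by (simp add: G_def T_def)
  qed (use assms in auto)
  then show ?thesis by (simp add: G_def T_def H_def)
qed

section \<open>Row transfer matrices as window matrices\<close>

lemma weight_plus_conservation: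
  assumes "weight_plus x y al be L R T B \<noteq> 0"
  shows "of_bool R = of_bool L + of_bool T - (of_bool B :: int)"
  using assms by (cases L; cases R; cases T; cases B) simp_all

text \<open>Outside the window the colors of the two sides of a column agree, so an occupied edge
  there would force infinitely many.\<close>

lemma constant_coloring_False:
  fixes c :: "int \<Rightarrow> bool"
  assumes fin: "finite {j. c j}"
    and above: "\<And>j. j > b \<Longrightarrow> c j = c (j - 1)" and below: "\<And>j. j < a \<Longrightarrow> c j = c (j - 1)"
    and j: "j \<ge> b \<or> j < a"
  shows "\<not> c j"
proof
  assume cj: "c j"
  show False
  proof (cases "j \<ge> b")
    case True
    have "c (j + int n)" for n
    proof (induction n)
      case (Suc n)
      then show ?case using above[of "j + int n + 1"] True by (simp add: add_ac)
    qed (simp add: cj)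
    then have "range (\<lambda>n. j + int n) \<subseteq> {j. c j}" by auto
    moreover have "infinite (range (\<lambda>n. j + int n))" by (rule range_inj_infinite) (simp add: inj_def)
    ultimately show False using fin finite_subset by blast
  next
    case False
    have "c (j - int n)" for n
    proof (induction n)
      case (Suc n)
      then show ?case using below[of "j - int n"] False j by (simp add: algebra_simps)
    qed (simp add: cj)
    then have "range (\<lambda>n. j - int n) \<subseteq> {j. c j}" by auto
    moreover have "infinite (range (\<lambda>n. j - int n))" by (rule range_inj_infinite) (simp add: inj_def)
    ultimately show False using fin finite_subset by blast
  qed
qed

lemma height_above: "(\<And>s. s \<in> S \<union> S' \<Longrightarrow> s \<le> j) \<Longrightarrow> height S S' j = 0"
proof -
  assume "\<And>s. s \<in> S \<union> S' \<Longrightarrow> s \<le> j"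
  then have "{s \<in> S. j < s} = {}" "{s \<in> S'. j < s} = {}" by force+
  then show ?thesis by (simp only: height_def card.empty)
qed

lemma height_below: "(\<And>s. s \<in> S \<union> S' \<Longrightarrow> j < s) \<Longrightarrow> height S S' j = int (card S') - int (card S)"
proof -
  assume "\<And>s. s \<in> S \<union> S' \<Longrightarrow> j < s"
  then have "{s \<in> S. j < s} = S" "{s \<in> S'. j < s} = S'" by auto
  then show ?thesis by (simp add: height_def)
qed

text \<open>A coloring with nonzero weight has the height as its color, hence is unique. It exists if
  and only if all heights are 0 or 1 and the last one is 0; otherwise both sides are 0. The
  sites in \<open>F\<close>, filled in both states, may lie below or above the window; the columns outside
  the window then have weight 1 because \<open>F\<close> is the part of the sea outside the window.\<close>

lemma row_transfer_window:
  fixes \<alpha> \<beta> :: "int \<Rightarrow> complex"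
  assumes W: "W = {a..b}" "a \<le> b" and F: "F \<inter> W = {}" "\<And>j. j \<notin> W \<Longrightarrow> j \<in> F \<longleftrightarrow> j \<in> Z"
    and S: "S \<subseteq> W" and S': "S' \<subseteq> W"
  shows "row_transfer (\<lambda>j L R T B. sea_factor Z \<beta> j * weight_plus var_x var_y (cst (\<alpha> j)) (cst (\<beta> j)) L R T B)
     (S \<union> F) (S' \<union> F) = window_transfer W (sea_factor Z \<beta>) \<alpha> \<beta> S S'"
proof -
  define g where "g = (\<lambda>c j. sea_factor Z \<beta> j * weight_plus var_x var_y (cst (\<alpha> j)) (cst (\<beta> j))
     (c j) (c (j - 1)) (j \<in> S' \<union> F) (j \<in> S \<union> F))"
  define f where "f = (\<lambda>c. if finite {j. c j} then Prod_any (g c) else 0)"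
  let ?h = "height S S'"
  define c0 where "c0 = (\<lambda>j. ?h j = 1)"
  have fW: "finite W" and fin: "finite S" "finite S'" using W S S' by (auto intro: finite_subset)
  have outside: "g c j \<noteq> 0 \<Longrightarrow> c j = c (j - 1)" "\<not> c j \<Longrightarrow> \<not> c (j - 1) \<Longrightarrow> g c j = 1"
    if "j \<notin> W" for c j
  proof -
    have m: "j \<in> S' \<union> F \<longleftrightarrow> j \<in> F" "j \<in> S \<union> F \<longleftrightarrow> j \<in> F" "j \<in> F \<longleftrightarrow> j \<in> Z"
      using that S S' F(2)[of j] by auto
    show "g c j \<noteq> 0 \<Longrightarrow> c j = c (j - 1)"
      unfolding g_def m by (cases "c j"; cases "c (j - 1)"; cases "j \<in> Z") simp_all
    show "g c j = 1" if "\<not> c j" "\<not> c (j - 1)"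
      unfolding g_def m using that inverse_x[of "\<beta> j"] inverse_y[of "\<beta> j"]
      by (cases "j \<in> Z") (simp_all add: sea_factor_def)
  qed
  have support: "finite {j. g c j \<noteq> 1}" if "finite {j. c j}" for c
  proof (rule finite_subset)
    show "{j. g c j \<noteq> 1} \<subseteq> W \<union> {j. c j} \<union> (\<lambda>j. j + 1) ` {j. c j}"
    proof
      fix j assume "j \<in> {j. g c j \<noteq> 1}"
      then have "j \<in> W \<or> c j \<or> c (j - 1)" using outside(2) by blast
      moreover have "c (j - 1) \<Longrightarrow> j \<in> (\<lambda>j. j + 1) ` {j. c j}" by (rule image_eqI[of _ _ "j - 1"]) auto
      ultimately show "j \<in> W \<union> {j. c j} \<union> (\<lambda>j. j + 1) ` {j. c j}" by blast
    qed
    show "finite (W \<union> {j. c j} \<union> (\<lambda>j. j + 1) ` {j. c j})" using that fW by simp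
  qed
  define good where "good \<longleftrightarrow> card S = card S' \<and> (\<forall>j\<in>W. ?h j \<in> {0, 1})"
  have h_top: "?h j = 0" if "j \<ge> b" for j using S S' W that by (intro height_above) auto
  have h_bot: "?h j = int (card S') - int (card S)" if "j < a" for j
    using S S' W that by (intro height_below) auto
  have unique: "good \<and> c = c0" if "f c \<noteq> 0" for c
  proof -
    have cf: "finite {j. c j}" using that by (auto simp: f_def split: if_splits)
    have nz: "g c j \<noteq> 0" for j
    proof
      assume "g c j = 0"
      then have "Prod_any (g c) = 0"
        unfolding Prod_any.expand_set by (intro prod_zero[OF support[OF cf]]) force
      with that cf show False by (simp add: f_def)
    qed
    have out: "c j = c (j - 1)" if "j \<notin> W" for j
      by (rule outside(1)[OF that nz])
    have end_: "\<not> c j" if "j \<ge> b \<or> j < a" for j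
      by (rule constant_coloring_False[OF cf out out that]) (simp_all add: W)
    \<comment> \<open>From the empty left end to the right: every vertex conserves particles.\<close>
    have ch: "of_bool (c j) = ?h j" if "j \<ge> a - 1" for j
    proof (cases "j \<ge> b")
      case True
      then show ?thesis using end_[of j] h_top[of j] by simp
    next
      case False
      then have "j \<le> b" by simp
      then show ?thesis using that
      proof (induction j rule: int_le_induct)
        case base
        then show ?case using end_[of b] h_top[of b] by simp
      next
        case (step j)
        have "j \<in> W" using step W by auto
        then have m: "j \<in> S' \<union> F \<longleftrightarrow> j \<in> S'" "j \<in> S \<union> F \<longleftrightarrow> j \<in> S" using F(1) by auto
        have "weight_plus var_x var_y (cst (\<alpha> j)) (cst (\<beta> j)) (c j) (c (j - 1)) (j \<in> S') (j \<in> S) \<noteq> 0"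
          using nz[of j] unfolding g_def m by auto
        from weight_plus_conservation[OF this] show ?case
          using step height_step[OF fin, of "j - 1"] by simp
      qed
    qed
    have "card S = card S'" using ch[of "a - 1"] end_[of "a - 1"] h_bot[of "a - 1"] by simp
    moreover have "?h j \<in> {0, 1}" if "j \<in> W" for j
      using ch[of j] that W by (auto simp flip: ch)
    moreover have "c j = c0 j" for j
    proof (cases "j \<ge> a - 1")
      case True
      then show ?thesis using ch[of j] by (auto simp: c0_def of_bool_def split: if_splits)
    next
      case False
      then show ?thesis using end_[of j] h_bot[of j] \<open>card S = card S'\<close> by (simp add: c0_def)
    qed
    ultimately show ?thesis by (auto simp: good_def)
  qed
  have "row_transfer (\<lambda>j L R T B. sea_factor Z \<beta> j * weight_plus var_x var_y (cst (\<alpha> j)) (cst (\<beta> j)) L R T B)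
     (S \<union> F) (S' \<union> F) = Sum_any f"
    unfolding row_transfer_def f_def g_def ..
  also have "\<dots> = sum f {c0}"
    by (rule Sum_any.expand_superset) (use unique in auto)
  also have "\<dots> = window_transfer W (sea_factor Z \<beta>) \<alpha> \<beta> S S'"
  proof (cases good)
    case True
    then have card: "card S = card S'" and h01: "\<And>j. j \<in> W \<Longrightarrow> ?h j \<in> {0, 1}" by (auto simp: good_def)
    have h_out: "?h j = 0" if "j \<ge> b \<or> j < a" for j using h_top h_bot card that by auto
    have "{j. c0 j} \<subseteq> W"
    proof
      fix j assume "j \<in> {j. c0 j}"
      then have "?h j = 1" by (simp add: c0_def)
      then have "\<not> (j \<ge> b \<or> j < a)" using h_out[of j] by auto
      then show "j \<in> W" using W by auto
    qed
    then have c0f: "finite {j. c0 j}" using fW finite_subset by blast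
    have "Prod_any (g c0) = (\<Prod>j\<in>W. g c0 j)"
    proof (rule Prod_any.expand_superset[OF fW], rule subsetI, rule ccontr)
      fix j assume j: "j \<in> {j. g c0 j \<noteq> 1}" "j \<notin> W"
      then have "?h j = 0" "?h (j - 1) = 0" using W by (auto intro!: h_out)
      then have "g c0 j = 1" by (intro outside(2)[OF j(2)]) (simp_all add: c0_def)
      with j show False by simp
    qed
    also have "\<dots> = (\<Prod>j\<in>W. sea_factor Z \<beta> j * column_weight (cst (\<alpha> j)) (cst (\<beta> j)) (?h j) (j \<in> S') (j \<in> S))"
    proof (intro prod.cong refl)
      fix j assume j: "j \<in> W"
      have m: "j \<in> S' \<union> F \<longleftrightarrow> j \<in> S'" "j \<in> S \<union> F \<longleftrightarrow> j \<in> S" using F(1) j by auto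
      have r: "?h j + of_bool (j \<in> S') - of_bool (j \<in> S) = ?h (j - 1)"
        using height_step[OF fin, of "j - 1"] by simp
      have "?h (j - 1) \<in> {0, 1}"
        using h01[of "j - 1"] h_out[of "j - 1"] j W by (cases "j = a") auto
      then show "g c0 j = sea_factor Z \<beta> j * column_weight (cst (\<alpha> j)) (cst (\<beta> j)) (?h j) (j \<in> S') (j \<in> S)"
        unfolding g_def m column_weight_def r Let_def using h01[OF j] by (simp add: c0_def)
    qed
    finally show ?thesis using c0f card by (simp add: f_def window_transfer_def)
  next
    case False
    then have "f c0 = 0" using unique by blast
    moreover have "window_transfer W (sea_factor Z \<beta>) \<alpha> \<beta> S S' = 0"
    proof (cases "card S = card S'")
      case True
      then obtain j where j: "j \<in> W" "?h j \<notin> {0, 1}" using False by (auto simp: good_def)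
      then have "column_weight (cst (\<alpha> j)) (cst (\<beta> j)) (?h j) (j \<in> S') (j \<in> S) = 0"
        unfolding column_weight_def Let_def by simp
      then show ?thesis using fW j(1)
        by (auto simp: window_transfer_def intro!: prod_zero bexI[of _ j])
    qed (simp add: window_transfer_def)
    ultimately show ?thesis by simp
  qed
  finally show ?thesis .
qed

text \<open>Left and right edges exchange their roles: the left edge of column \<open>- j\<close> is the right edge
  of column \<open>j\<close> in the reflected row, that is, the left edge of column \<open>j - 1\<close> there.\<close>

lemma row_transfer_reflect:
  "row_transfer w \<mu> \<nu> = row_transfer (\<lambda>j L R T B. w (- j) R L T B) (uminus ` \<mu>) (uminus ` \<nu>)"
proof -
  define l where "l = (\<lambda>(c :: int \<Rightarrow> bool) j. c (- j - 1))"
  have ll: "l (l c) = c" for c by (simp add: l_def)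
  then have bij: "bij l" by (intro o_bij[of l l]) (auto simp: fun_eq_iff)
  have neg: "j \<in> uminus ` A \<longleftrightarrow> - j \<in> A" for j :: int and A by force
  have fin: "finite {j. l c j} \<longleftrightarrow> finite {j. c j}" for c
  proof -
    have "{j. l c j} = (\<lambda>j. - j - 1) ` {j. c j}" for c
    proof (intro set_eqI iffI)
      fix j assume "j \<in> {j. l c j}"
      then show "j \<in> (\<lambda>j. - j - 1) ` {j. c j}" by (intro image_eqI[of _ _ "- j - 1"]) (auto simp: l_def)
    qed (auto simp: l_def)
    from this[of c] this[of "l c"] show ?thesis unfolding ll by (metis finite_imageI)
  qed
  show ?thesis unfolding row_transfer_def
  proof (rule Sum_any.reindex_cong[OF bij, symmetric], rule ext)
    fix c
    have "Prod_any (\<lambda>j. w (- j) (l c (j - 1)) (l c j) (j \<in> uminus ` \<nu>) (j \<in> uminus ` \<mu>)) =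
        Prod_any (\<lambda>j. w j (c j) (c (j - 1)) (j \<in> \<nu>) (j \<in> \<mu>))"
      by (rule Prod_any.reindex_cong[of uminus, symmetric])
         (auto simp: l_def neg fun_eq_iff bij_uminus)
    then show "((\<lambda>c. if finite {j. c j} then Prod_any (\<lambda>j. w (- j) (c (j - 1)) (c j) (j \<in> uminus ` \<nu>) (j \<in> uminus ` \<mu>)) else 0) \<circ> l) c =
       (if finite {j. c j} then Prod_any (\<lambda>j. w j (c j) (c (j - 1)) (j \<in> \<nu>) (j \<in> \<mu>)) else 0)"
      by (simp add: fin)
  qed
qed

lemma weight_minus_reflect: "weight_minus x y \<alpha> \<beta> R L T B = weight_plus x y \<beta> \<alpha> L R T B"
  by (cases L; cases R; cases T; cases B) (simp_all add: mult.commute)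

lemma T_plus_window:
  assumes W: "W = {- N..N}" "N \<ge> 0" and S: "S \<subseteq> W" "S' \<subseteq> W"
  shows "T_plus \<alpha> \<beta> (S \<union> {..< - N}) (S' \<union> {..< - N}) = window_transfer W (sea_factor {..0} \<beta>) \<alpha> \<beta> S S'"
proof -
  have o: "omega j (\<beta> j) = sea_factor {..0} \<beta> j" for j by (simp add: omega_def sea_factor_def)
  show ?thesis unfolding T_plus_def o
    by (rule row_transfer_window[OF W(1) _ _ _ S]) (use W in auto)
qed

text \<open>The reflection moves the filled sites above the window and turns the sea into \<open>{0..}\<close>.\<close>

lemma T_minus_window:
  assumes W: "W = {- N..N}" "N \<ge> 0" and S: "S \<subseteq> W" "S' \<subseteq> W"
  shows "T_minus \<alpha> \<beta> (uminus ` S \<union> {..< - N}) (uminus ` S' \<union> {..< - N}) =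
    window_transfer W (sea_factor {0..} (\<lambda>j. \<alpha> (- j))) (\<lambda>j. \<beta> (- j)) (\<lambda>j. \<alpha> (- j)) S S'"
proof -
  have o: "omega (- j) (\<alpha> (- j)) = sea_factor {0..} (\<lambda>j. \<alpha> (- j)) j" for j
    by (simp add: omega_def sea_factor_def)
  have "uminus ` (uminus ` A \<union> {..< - N}) = A \<union> {N<..}" for A :: "int set"
    by (auto simp: image_Un image_image image_uminus_lessThan)
  then show ?thesis unfolding T_minus_def row_transfer_reflect[of _ "uminus ` S \<union> _"] o weight_minus_reflect
    by (simp only:) (rule row_transfer_window[OF W(1) _ _ _ S], use W in auto)
qed

section \<open>Currents as window matrices\<close>

lemma hop_eq:
  "psi i (psi_star j (ket \<nu>)) \<mu> = (if i \<in> \<mu> \<and> j \<in> \<nu> \<and> \<mu> - {i} = \<nu> - {j} then fsign i \<mu> * fsign j \<nu> else 0)"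
  unfolding psi_def psi_star_ket wedge_sign_fsign by (simp add: ket_def)

text \<open>The reflection replaces the particles above a site by those below it. In each of the two
  states this changes the sign by the parity of the number of the remaining particles, which is
  the same for both states.\<close>

lemma hop_reflect:
  assumes "finite \<mu>" "finite \<nu>"
  shows "psi i (psi_star j (ket (uminus ` \<nu>))) (uminus ` \<mu>) = psi (- i) (psi_star (- j) (ket \<nu>)) \<mu>"
proof -
  have neg: "j \<in> uminus ` A \<longleftrightarrow> - j \<in> A" for j :: int and A by force
  have minus: "uminus ` A - {j} = uminus ` (A - {- j})" for j :: int and A by force
  have inj: "uminus ` A = uminus ` B \<longleftrightarrow> A = B" for A B :: "int set"
    by (rule inj_image_eq_iff) simp
  have sgn: "(fsign i (uminus ` S) :: complex) = (- 1) ^ (card S - 1) * fsign (- i) S"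
    if "finite S" "- i \<in> S" for i S
  proof -
    have "{s \<in> uminus ` S. i < s} = uminus ` {s \<in> S. s < - i}" by (auto simp: neg)
    then have c: "card {s \<in> uminus ` S. i < s} = card {s \<in> S. s < - i}"
      by (simp add: card_image)
    have "S - {- i} = {s \<in> S. s < - i} \<union> {s \<in> S. - i < s}" by auto
    moreover have "card ({s \<in> S. s < - i} \<union> {s \<in> S. - i < s}) = card {s \<in> S. s < - i} + card {s \<in> S. - i < s}"
      using that(1) by (intro card_Un_disjoint) auto
    ultimately have "card S - 1 = card {s \<in> S. s < - i} + card {s \<in> S. - i < s}"
      using that card_Diff_singleton[of "- i" S] by simp
    then have "(- 1 :: complex) ^ (card S - 1) * fsign (- i) S = (- 1) ^ card {s \<in> S. s < - i} * (fsign (- i) S * fsign (- i) S)"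
      by (simp add: fsign_def power_add)
    then show ?thesis by (simp add: fsign_def c)
  qed
  show ?thesis
  proof (cases "- i \<in> \<mu> \<and> - j \<in> \<nu> \<and> \<mu> - {- i} = \<nu> - {- j}")
    case True
    then have "card \<mu> = card \<nu>" using assms by (metis card_Suc_Diff1)
    then show ?thesis using True assms sgn[of \<mu> i] sgn[of \<nu> j]
      by (simp add: hop_eq neg minus inj power_add[symmetric] power_mult_distrib[symmetric] mult_ac
          flip: mult_2)
  next
    case False
    then show ?thesis by (auto simp: hop_eq neg minus inj)
  qed
qed

text \<open>The products \<open>\<psi>\<^sub>i \<psi>\<^sub>j\<^sup>*\<close> and \<open>- \<psi>\<^sub>j\<^sup>* \<psi>\<^sub>i\<close> differ only by the constant \<open>\<delta>\<^sub>i\<^sub>j\<close>.\<close>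

lemma normal_order_eq:
  assumes "\<And>k. finite {s \<in> \<mu>. k < s}"
  shows "normal_psi_psi_star i j (ket \<nu>) \<mu> =
    psi i (psi_star j (ket \<nu>)) \<mu> - (if i = j \<and> i \<le> 0 \<and> \<mu> = \<nu> then 1 else 0)"
  using psi_star_psi[OF assms, of j i "ket \<nu>"]
  by (auto simp: normal_psi_psi_star_def ket_def)

lemma normal_order_nonzero:
  assumes "\<And>k. finite {s \<in> \<mu>. k < s}" "normal_psi_psi_star i j (ket \<nu>) \<mu> \<noteq> 0"
  shows "i = j \<and> \<mu> = \<nu> \<or> i \<noteq> j \<and> i \<in> \<mu> \<and> i \<notin> \<nu> \<and> j \<in> \<nu> \<and> j \<notin> \<mu> \<and> \<mu> - {i} = \<nu> - {j}"
  using assms(2) unfolding normal_order_eq[OF assms(1)] hop_eq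
  by (cases "i = j") (auto split: if_splits)

lemma finite_above_sea:
  assumes "finite S"
  shows "finite {s \<in> S \<union> {..<c}. (k::int) < s}"
proof (rule finite_subset)
  show "{s \<in> S \<union> {..<c}. k < s} \<subseteq> S \<union> {k<..<c}" by auto
qed (use assms in auto)

text \<open>A hop cannot involve a site that is filled in both states or empty in both states. The
  diagonal terms outside the window vanish by normal ordering.\<close>

lemma current_window:
  assumes W: "W = {- N..N}" "N \<ge> 0" and S: "S \<subseteq> W" "S' \<subseteq> W"
  shows "current \<alpha> \<beta> k (S \<union> {..< - N}) (S' \<union> {..< - N}) = bilinear_op W {..0} (current_coeff \<alpha> \<beta> k) S S'"
proof -
  let ?F = "{..< - N}"
  have fin: "finite S" "finite S'" "finite W" using W S by (auto intro: finite_subset)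
  let ?n = "\<lambda>i j. normal_psi_psi_star i j (ket (S' \<union> ?F)) (S \<union> ?F)"
  have above: "finite {s \<in> S \<union> ?F. k < s}" for k by (rule finite_above_sea[OF fin(1)])
  have cut: "(A \<union> ?F) \<inter> W = A" if "A \<subseteq> W" for A using that W by auto
  have eq: "S \<union> ?F = S' \<union> ?F \<longleftrightarrow> S = S'" using cut[OF S(1)] cut[OF S(2)] by metis
  have inside: "?n i j = psi i (psi_star j (ket S')) S - (if i = j \<and> i \<le> 0 then id_op S S' else 0)"
    if ij: "i \<in> W" "j \<in> W" for i j
  proof -
    have s: "(fsign i (A \<union> ?F) :: complex) = fsign i A" if "i \<in> W" for i A
    proof -
      have "{s \<in> A \<union> ?F. i < s} = {s \<in> A. i < s}" using that W by auto
      then show ?thesis by (simp add: fsign_def)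
    qed
    have "(S \<union> ?F) - {i} = (S' \<union> ?F) - {j} \<longleftrightarrow> S - {i} = S' - {j}"
    proof -
      have "(A \<union> ?F) - {i} = (A - {i}) \<union> ?F" if "i \<in> W" for A i using that W by auto
      moreover have "(S - {i}) \<union> ?F = (S' - {j}) \<union> ?F \<longleftrightarrow> S - {i} = S' - {j}"
        using cut[of "S - {i}"] cut[of "S' - {j}"] S by (metis Diff_subset subset_trans)
      ultimately show ?thesis using ij by simp
    qed
    moreover have "i \<in> S \<union> ?F \<longleftrightarrow> i \<in> S" "j \<in> S' \<union> ?F \<longleftrightarrow> j \<in> S'" using ij W by auto
    ultimately show ?thesis
      unfolding normal_order_eq[OF above] hop_eq using ij by (auto simp: s eq id_op_def)
  qed
  have outside: "?n i j = 0" if "i \<notin> W \<or> j \<notin> W" for i j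
  proof (cases "i = j")
    case False
    show ?thesis
    proof (rule ccontr)
      assume "?n i j \<noteq> 0"
      from normal_order_nonzero[OF above this] False have "i \<in> S \<union> ?F" "i \<notin> S' \<union> ?F" "j \<in> S' \<union> ?F" "j \<notin> S \<union> ?F"
        by blast+
      with S that show False by auto
    qed
  next
    case True
    then have "i \<notin> W" using that by simp
    then consider "i < - N" | "i > N" using W by force
    then show ?thesis
    proof cases
      case 1
      then have "i \<in> S \<union> ?F" "i \<in> S' \<union> ?F" "i \<le> 0" using W by auto
      then have d: "(S \<union> ?F) - {i} = (S' \<union> ?F) - {i} \<longleftrightarrow> S \<union> ?F = S' \<union> ?F" by (metis insert_Diff)
      show ?thesis
        unfolding normal_order_eq[OF above] hop_eq True[symmetric] d
        using \<open>i \<in> S \<union> ?F\<close> \<open>i \<in> S' \<union> ?F\<close> \<open>i \<le> 0\<close> by auto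
    next
      case 2
      then have "i \<notin> S \<union> ?F" "\<not> i \<le> 0" using S W by auto
      then show ?thesis unfolding normal_order_eq[OF above] hop_eq by simp
    qed
  qed
  let ?c = "current_coeff \<alpha> \<beta> k"
  have "current \<alpha> \<beta> k (S \<union> ?F) (S' \<union> ?F) = (\<Sum>(i, j)\<in>W \<times> W. ?c i j * ?n i j)"
    unfolding current_def
  proof (rule Sum_any.expand_superset)
    show "{p. (case p of (i, j) \<Rightarrow> ?c i j * ?n i j) \<noteq> 0} \<subseteq> W \<times> W"
      using outside by fastforce
  qed (use fin in simp)
  also have "\<dots> = (\<Sum>i\<in>W. \<Sum>j\<in>W. ?c i j * ?n i j)"
    by (rule sum.cartesian_product[symmetric])
  also have "\<dots> = (\<Sum>i\<in>W. \<Sum>j\<in>W. ?c i j * psi i (psi_star j (ket S')) S) -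
      (\<Sum>i\<in>W. \<Sum>j\<in>W. if i = j then (if i \<le> 0 then ?c i i * id_op S S' else 0) else 0)"
    unfolding sum_subtractf[symmetric]
    by (intro sum.cong refl) (auto simp: inside right_diff_distrib)
  also have "(\<Sum>i\<in>W. \<Sum>j\<in>W. if i = j then (if i \<le> 0 then ?c i i * id_op S S' else 0) else 0) =
      (\<Sum>i\<in>W \<inter> {..0}. ?c i i) * id_op S S'"
    using fin by (simp add: sum.inter_restrict sum_distrib_right if_distrib[of "\<lambda>t. t * _"] cong: if_cong)
  finally show ?thesis by (simp add: bilinear_op_def)
qed

lemma bilinear_op_reflect:
  assumes W: "finite W" "uminus ` W = W" and S: "S \<subseteq> W" "S' \<subseteq> W"
  shows "bilinear_op W Z A (uminus ` S) (uminus ` S') = bilinear_op W (uminus ` Z) (\<lambda>i j. A (- i) (- j)) S S'"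
proof -
  have fin: "finite S" "finite S'" using W S by (auto intro: finite_subset)
  have re: "(\<Sum>i\<in>W. f i) = (\<Sum>i\<in>W. f (- i))" for f :: "int \<Rightarrow> complex"
    by (subst (1) W(2)[symmetric], subst sum.reindex) auto
  have "(\<Sum>i\<in>W. \<Sum>j\<in>W. A i j * psi i (psi_star j (ket (uminus ` S'))) (uminus ` S)) =
      (\<Sum>i\<in>W. \<Sum>j\<in>W. A (- i) (- j) * psi i (psi_star j (ket S')) S)"
    by (subst re, subst (2) re) (simp add: hop_reflect[OF fin])
  moreover have "(\<Sum>i\<in>W \<inter> Z. A i i) = (\<Sum>i\<in>W \<inter> uminus ` Z. A (- i) (- i))"
  proof -
    have "W \<inter> Z = uminus ` (W \<inter> uminus ` Z)"
      by (subst image_Int) (simp_all add: W(2) image_image)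
    then show ?thesis by (simp add: sum.reindex)
  qed
  moreover have "uminus ` S = uminus ` S' \<longleftrightarrow> S = S'" by (rule inj_image_eq_iff) simp
  ultimately show ?thesis by (simp add: bilinear_op_def id_op_def)
qed

lemma esym_reflect: "esym (uminus ` I) f r = esym I (\<lambda>a. f (- a)) r"
proof -
  have "esym (uminus ` I) f r = (\<Sum>S | S \<subseteq> I \<and> card S = r. \<Prod>a\<in>uminus ` S. f a)"
    unfolding esym_def
    by (rule sum.reindex_bij_witness[where i = "image uminus" and j = "image uminus"])
       (auto simp: image_image card_image)
  then show ?thesis by (simp add: esym_def prod.reindex)
qed

lemma hsym_reflect:
  assumes "finite I"
  shows "hsym (uminus ` I) f s = hsym I (\<lambda>a. f (- a)) s"
  using assms
proof (induction I arbitrary: s rule: finite_induct)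
  case (insert a I)
  then have "- a \<notin> uminus ` I" by auto
  then show ?case using insert by (simp add: hsym_insert)
qed (simp add: hsym_empty)

text \<open>The two cases of the coefficient are mirror images of each other; the sum over \<open>(r, s)\<close> is
  turned into the other one by exchanging the two indices.\<close>

lemma current_coeff_reflect:
  "current_coeff \<alpha> \<beta> (- int k) i j = current_coeff (\<lambda>a. \<beta> (- a)) (\<lambda>a. \<alpha> (- a)) (int k) (- i) (- j)"
proof (cases "k > 0 \<and> j < i")
  case True
  let ?I = "{j+1..i-1}"
  have I: "{- i + 1..- j - 1} = uminus ` ?I" "{- i..- j} = uminus ` {j..i}"
    by (simp_all add: image_uminus_atLeastAtMost) 
  have e: "esym {- i + 1..- j - 1} (\<lambda>a. - \<beta> (- a)) r = esym ?I (\<lambda>a. - \<beta> a) r" for r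
    unfolding I esym_reflect by simp
  have h: "hsym {- i..- j} (\<lambda>a. \<alpha> (- a)) s = hsym {j..i} \<alpha> s" for s
    unfolding I by (simp add: hsym_reflect del: image_uminus_atLeastAtMost)
  have "current_coeff \<alpha> \<beta> (- int k) i j = (1 - \<alpha> j * \<beta> j) *
      Sum_any (\<lambda>(r, s). if int r - int s = j - i + int k then hsym {j..i} \<alpha> r * esym ?I (\<lambda>a. - \<beta> a) s else 0)"
    using True by (simp add: current_coeff_def)
  also have "Sum_any (\<lambda>(r, s). if int r - int s = j - i + int k then hsym {j..i} \<alpha> r * esym ?I (\<lambda>a. - \<beta> a) s else 0) =
        Sum_any (\<lambda>(r, s). if int r - int s = i - j - int k then esym ?I (\<lambda>a. - \<beta> a) r * hsym {j..i} \<alpha> s else 0)"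
    by (rule Sum_any.reindex_cong[OF bij_swap]) (auto simp: fun_eq_iff mult.commute)
  also have "(1 - \<alpha> j * \<beta> j) * \<dots> = (1 - \<beta> j * \<alpha> j) *
      Sum_any (\<lambda>(r, s). if int r - int s = - j - - i - int k
        then esym {- i + 1..- j - 1} (\<lambda>a. - \<beta> (- a)) r * hsym {- i..- j} (\<lambda>a. \<alpha> (- a)) s else 0)"
    unfolding e h by (simp add: mult.commute)
  also have "\<dots> = current_coeff (\<lambda>a. \<beta> (- a)) (\<lambda>a. \<alpha> (- a)) (int k) (- i) (- j)"
    using True by (simp only: current_coeff_def minus_minus) simp
  finally show ?thesis .
next
  case False
  then show ?thesis by (auto simp: current_coeff_def)
qed

section \<open>Hamiltonians, powers and partitions\<close>

lemma series_sum_H: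
  "series_sum (\<lambda>k. if k \<ge> 1 then cst (1 / of_nat k) * (var_x ^ k - (- var_y) ^ k) * cst (f k) else 0) = wseries H_weight f"
proof (rule series_eqI)
  fix b a
  let ?t = "\<lambda>k. if k \<ge> 1 then cst (1 / of_nat k) * (var_x ^ k - (- var_y) ^ k) * cst (f k) else 0"
  have x: "coeff2 (var_x ^ k) b a = (if b = 0 \<and> a = k then 1 else 0)" for k
    by (simp add: var_x_def fps_X_power_nth)
  have y: "coeff2 ((- var_y) ^ k) b a = (if a = 0 \<and> b = k then (- 1) ^ k else 0)" for k
  proof -
    have "(- var_y) ^ k = cst ((- 1) ^ k) * var_y ^ k"
      by (simp add: power_minus[of var_y] cst_power cst_hom)
    then show ?thesis by (simp add: coeff2_cst_mult) (simp add: var_y_def fps_X_power_nth)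
  qed
  have t: "coeff2 (?t k) b a = (if k = a + b then H_weight a b * f (a + b) else 0)" for k
  proof (cases "k \<ge> 1")
    case True
    have "coeff2 (?t k) b a = 1 / of_nat k * f k * (coeff2 (var_x ^ k) b a - coeff2 ((- var_y) ^ k) b a)"
      using True by (simp add: mult_ac coeff2_cst_mult)
    then show ?thesis using True unfolding x y
      by (auto simp: H_weight_def x_weight_def y_weight_def)
  next
    case False
    then show ?thesis by (auto simp: H_weight_def x_weight_def y_weight_def)
  qed
  have "coeff2 (series_sum ?t) b a = Sum_any (\<lambda>k. coeff2 (?t k) b a)"
    by (simp add: series_sum_def)
  also have "\<dots> = (\<Sum>k\<in>{a + b}. if k = a + b then H_weight a b * f (a + b) else 0)"
    unfolding t by (rule Sum_any.expand_superset) auto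
  finally show "coeff2 (series_sum ?t) b a = coeff2 (wseries H_weight f) b a"
    by (simp only: coeff2_wseries) simp
qed

text \<open>\<open>e\<close> embeds the window states into the basis of the Fock space. It suffices that no path
  which starts in the window leaves it (first alternative), or that no path which ends in the
  window comes from outside (second alternative): \<open>H_plus\<close> has the first property, \<open>H_minus\<close> the
  second.\<close>

lemma mat_power_embed:
  assumes fW: "finite W" and inj: "inj_on e (Pow W)" and fock: "e ` Pow W \<subseteq> fock_basis"
    and H: "\<And>S S'. S \<subseteq> W \<Longrightarrow> S' \<subseteq> W \<Longrightarrow> H (e S) (e S') = h S S'"
    and closed: "(\<forall>\<kappa>\<in>fock_basis - e ` Pow W. \<forall>S\<in>Pow W. H \<kappa> (e S) = 0) \<or>
                 (\<forall>\<kappa>\<in>fock_basis - e ` Pow W. \<forall>S\<in>Pow W. H (e S) \<kappa> = 0)"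
    and S: "S \<subseteq> W" and S': "S' \<subseteq> W"
  shows "mat_power H n (e S) (e S') = op_power W h n S S'"
  using S
proof (induction n arbitrary: S)
  case 0
  then show ?case using inj S' by (auto simp: id_op_def inj_on_def)
next
  case (Suc n)
  have zero: "H (e S) \<kappa> * mat_power H n \<kappa> (e S') = 0" if \<kappa>: "\<kappa> \<in> fock_basis - e ` Pow W" for \<kappa>
  proof (cases "\<forall>\<kappa>\<in>fock_basis - e ` Pow W. \<forall>S\<in>Pow W. H (e S) \<kappa> = 0")
    case True
    then show ?thesis using \<kappa> Suc.prems by simp
  next
    case False
    with closed have c: "H \<kappa> (e S) = 0" if "\<kappa> \<in> fock_basis - e ` Pow W" "S \<in> Pow W" for \<kappa> S
      using that by blast
    have "mat_power H n \<kappa> (e S') = 0" if "\<kappa> \<in> fock_basis - e ` Pow W" for \<kappa>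
      using that
    proof (induction n arbitrary: \<kappa>)
      case 0
      then show ?case using S' by auto
    next
      case (Suc n)
      have "(if \<rho> \<in> fock_basis then H \<kappa> \<rho> * mat_power H n \<rho> (e S') else 0) = 0" for \<rho>
        using Suc.IH[of \<rho>] c[OF Suc.prems] by (cases "\<rho> \<in> e ` Pow W") auto
      then show ?case by (simp add: mat_mult_def)
    qed
    then show ?thesis using \<kappa> by simp
  qed
  have "mat_power H (Suc n) (e S) (e S') = (\<Sum>\<kappa>\<in>e ` Pow W. if \<kappa> \<in> fock_basis then H (e S) \<kappa> * mat_power H n \<kappa> (e S') else 0)"
    unfolding mat_power.simps mat_mult_def
    by (rule Sum_any.expand_superset) (use fW zero in auto)
  also have "\<dots> = (\<Sum>\<rho>\<in>Pow W. h S \<rho> * op_power W h n \<rho> S')"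
    unfolding sum.reindex[OF inj] using fock Suc
    by (intro sum.cong refl) (auto simp: H)
  finally show ?case by (simp add: op_mult_def)
qed

lemma mat_exp_embed:
  assumes "finite W" "inj_on e (Pow W)" "e ` Pow W \<subseteq> fock_basis"
    and "\<And>S S'. S \<subseteq> W \<Longrightarrow> S' \<subseteq> W \<Longrightarrow> H (e S) (e S') = h S S'"
    and "(\<forall>\<kappa>\<in>fock_basis - e ` Pow W. \<forall>S\<in>Pow W. H \<kappa> (e S) = 0) \<or>
         (\<forall>\<kappa>\<in>fock_basis - e ` Pow W. \<forall>S\<in>Pow W. H (e S) \<kappa> = 0)"
    and "S \<subseteq> W" "S' \<subseteq> W"
  shows "mat_exp H (e S) (e S') = op_exp W h S S'"
  unfolding mat_exp_def op_exp_def by (simp only: mat_power_embed[OF assms])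

text \<open>The partition is built by adding the sites of \<open>S\<close> from below: a new top site \<open>t\<close> adds a
  new largest part and raises the charge by one.\<close>

lemma window_state_in_fock:
  assumes "finite S" "\<And>s. s \<in> S \<Longrightarrow> a \<le> s"
  shows "\<exists>m \<xi>. is_partition \<xi> \<and> S \<union> {..<a} = sites m \<xi>"
  using assms
proof (induction S rule: finite_linorder_max_induct)
  case empty
  have "{..<a} = sites (a - 1) (\<lambda>_. 0)"
  proof (intro set_eqI iffI)
    fix s assume "s \<in> {..<a}"
    then have "s = a - 1 - int (nat (a - 1 - s)) + int 0" by simp
    then show "s \<in> sites (a - 1) (\<lambda>_. 0)" unfolding sites_def by blast
  qed (auto simp: sites_def)
  moreover have "is_partition (\<lambda>_. 0)" by (simp add: is_partition_def antimono_def)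
  ultimately show ?case by auto
next
  case (insert t S)
  then obtain m \<xi> where \<xi>: "is_partition \<xi>" "S \<union> {..<a} = sites m \<xi>" by auto
  have "m + int (\<xi> 0) \<in> sites m \<xi>" unfolding sites_def by (rule image_eqI[of _ _ 0]) auto
  then have top: "m + int (\<xi> 0) < t"
    using insert.hyps insert.prems[of t] \<xi>(2)[symmetric] by auto
  define \<xi>' where "\<xi>' = (\<lambda>k. case k of 0 \<Rightarrow> nat (t - (m + 1)) | Suc k \<Rightarrow> \<xi> k)"
  have "m + 1 \<le> t" using top by linarith
  then have l0: "int (\<xi>' 0) = t - (m + 1)" by (simp add: \<xi>'_def)
  have "antimono \<xi>'"
  proof (rule monotoneI)
    fix i j :: nat assume "i \<le> j"
    show "\<xi>' i \<ge> \<xi>' j"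
    proof (cases i)
      case 0
      have "\<xi> k \<le> \<xi> 0" for k using \<xi>(1) by (auto simp: is_partition_def antimono_def)
      moreover have "\<xi> 0 \<le> \<xi>' 0" using l0 top by linarith
      ultimately show ?thesis using 0 by (cases j) (auto simp: \<xi>'_def intro: order_trans)
    next
      case (Suc i')
      then obtain j' where "j = Suc j'" "i' \<le> j'" using \<open>i \<le> j\<close> by (cases j) auto
      then show ?thesis using Suc \<xi>(1) by (simp add: \<xi>'_def is_partition_def antimono_def)
    qed
  qed
  moreover have "finite {k. \<xi>' k \<noteq> 0}"
  proof (rule finite_subset)
    show "{k. \<xi>' k \<noteq> 0} \<subseteq> insert 0 (Suc ` {k. \<xi> k \<noteq> 0})"
    proof
      fix k assume "k \<in> {k. \<xi>' k \<noteq> 0}"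
      then show "k \<in> insert 0 (Suc ` {k. \<xi> k \<noteq> 0})" by (cases k) (auto simp: \<xi>'_def)
    qed
  qed (use \<xi>(1) in \<open>simp add: is_partition_def\<close>)
  moreover have "insert t S \<union> {..<a} = sites (m + 1) \<xi>'"
  proof -
    have "sites (m + 1) \<xi>' = insert t (sites m \<xi>)"
      unfolding sites_def
      by (subst UNIV_nat_eq, simp only: image_insert image_image) (simp add: \<xi>'_def \<open>m + 1 \<le> t\<close>)
    then show ?thesis using \<xi>(2) by auto
  qed
  ultimately show ?case by (auto simp: is_partition_def)
qed

lemma sites_window:
  assumes "is_partition \<xi>"
  shows "\<exists>N0. \<forall>N\<ge>N0. \<exists>S\<subseteq>{- N..N}. sites m \<xi> = S \<union> {..< - N}"
proof -
  have anti: "\<xi> k \<le> \<xi> 0" for k using assms by (auto simp: is_partition_def antimono_def)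
  obtain K where K: "\<And>k. k \<ge> K \<Longrightarrow> \<xi> k = 0"
  proof -
    have "finite {k. \<xi> k \<noteq> 0}" using assms by (simp add: is_partition_def)
    then obtain K where "\<forall>k\<in>{k. \<xi> k \<noteq> 0}. k < K" using finite_nat_set_iff_bounded by blast
    then show ?thesis using that[of K] by force
  qed
  define N0 where "N0 = max (m + int (\<xi> 0)) (int K - m)"
  show ?thesis
  proof (intro exI[of _ N0] allI impI)
    fix N assume N: "N \<ge> N0"
    have below: "{..< - N} \<subseteq> sites m \<xi>"
    proof
      fix s assume "s \<in> {..< - N}"
      then have s: "int K \<le> m - s" using N by (simp add: N0_def)
      then have "\<xi> (nat (m - s)) = 0" by (intro K) simp
      then have "s = m - int (nat (m - s)) + int (\<xi> (nat (m - s)))" using s by simp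
      then show "s \<in> sites m \<xi>" unfolding sites_def by blast
    qed
    have above: "s \<le> N" if s: "s \<in> sites m \<xi>" for s
    proof -
      obtain k where "s = m - int k + int (\<xi> k)" using s by (auto simp: sites_def)
      then show ?thesis using anti[of k] N by (simp add: N0_def)
    qed
    show "\<exists>S\<subseteq>{- N..N}. sites m \<xi> = S \<union> {..< - N}"
      using below above by (intro exI[of _ "sites m \<xi> \<inter> {- N..N}"]) force
  qed
qed

text \<open>\<open>J\<^sub>k\<close> with \<open>k > 0\<close> moves one particle down. Starting in the window it neither leaves
  through the filled sites at the bottom nor rises above the top. For the same reason \<open>J\<^sub>-\<^sub>k\<close>,
  which moves one particle up, does not lead into the window from outside.\<close>

lemma current_outside_window:
  assumes W: "W = {- N..N}" and S: "S \<subseteq> W" and k: "k > 0"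
    and \<kappa>: "\<kappa> \<in> fock_basis" "\<And>R. R \<subseteq> W \<Longrightarrow> \<kappa> \<noteq> R \<union> {..< - N}"
  shows "current \<alpha> \<beta> k \<kappa> (S \<union> {..< - N}) = 0" "current \<alpha> \<beta> (- k) (S \<union> {..< - N}) \<kappa> = 0"
proof -
  let ?F = "{..< - N}"
  have finS: "finite S" using S W finite_subset by blast
  obtain m \<xi> where \<xi>: "\<kappa> = sites m \<xi>" "is_partition \<xi>" using \<kappa>(1) by (auto simp: fock_basis_def)
  obtain M R where "finite R" "\<kappa> = R \<union> {..<M}"
    using sites_window[OF \<xi>(2), of m] \<xi>(1) finite_subset[OF _ finite_atLeastAtMost_int] by (metis order_refl)
  then have above\<kappa>: "finite {s \<in> \<kappa>. c < s}" for c using finite_above_sea by simp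
  have aboveS: "finite {s \<in> S \<union> ?F. c < s}" for c by (rule finite_above_sea[OF finS])
  have nS: "\<kappa> \<noteq> S \<union> ?F" by (rule \<kappa>(2)[OF S])
  have move: False if "\<kappa> - {i} = (S \<union> ?F) - {j}" "i \<in> W" "i \<in> \<kappa>" "j \<in> W" for i j
  proof -
    have "(S \<union> ?F) - {j} = (S - {j}) \<union> ?F" using \<open>j \<in> W\<close> W by auto
    then have "\<kappa> = insert i (S - {j}) \<union> ?F"
      using insert_Diff[OF \<open>i \<in> \<kappa>\<close>] that(1) by simp
    moreover have "insert i (S - {j}) \<subseteq> W" using \<open>i \<in> W\<close> S by auto
    ultimately show False using \<kappa>(2) by blast
  qed
  have z: "current_coeff \<alpha> \<beta> k i j * normal_psi_psi_star i j (ket (S \<union> ?F)) \<kappa> = 0" for i j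
  proof (rule ccontr)
    assume nz: "current_coeff \<alpha> \<beta> k i j * normal_psi_psi_star i j (ket (S \<union> ?F)) \<kappa> \<noteq> 0"
    then have "i \<le> j" using k by (auto simp: current_coeff_def split: if_splits)
    have "normal_psi_psi_star i j (ket (S \<union> ?F)) \<kappa> \<noteq> 0" using nz by simp
    from normal_order_nonzero[OF above\<kappa> this] nS
    have 1: "i \<in> \<kappa>" "i \<notin> S \<union> ?F" "j \<in> S \<union> ?F" "\<kappa> - {i} = (S \<union> ?F) - {j}" by blast+
    from 1(2,3) \<open>i \<le> j\<close> S W have "i \<in> W" "j \<in> W" by auto
    with move[of i j] 1 show False by blast
  qed
  show "current \<alpha> \<beta> k \<kappa> (S \<union> ?F) = 0"
    unfolding current_def case_prod_unfold z by (rule Sum_any.neutral)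
  have z': "current_coeff \<alpha> \<beta> (- k) i j * normal_psi_psi_star i j (ket \<kappa>) (S \<union> ?F) = 0" for i j
  proof (rule ccontr)
    assume nz: "current_coeff \<alpha> \<beta> (- k) i j * normal_psi_psi_star i j (ket \<kappa>) (S \<union> ?F) \<noteq> 0"
    then have "j \<le> i" using k by (auto simp: current_coeff_def split: if_splits)
    have "normal_psi_psi_star i j (ket \<kappa>) (S \<union> ?F) \<noteq> 0" using nz by simp
    from normal_order_nonzero[OF aboveS this] nS
    have 1: "j \<in> \<kappa>" "j \<notin> S \<union> ?F" "i \<in> S \<union> ?F" "\<kappa> - {j} = (S \<union> ?F) - {i}" by (metis (no_types))+
    from 1(2,3) \<open>j \<le> i\<close> S W have "i \<in> W" "j \<in> W" by auto
    with move[of j i] 1 show False by blast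
  qed
  show "current \<alpha> \<beta> (- k) (S \<union> ?F) \<kappa> = 0"
    unfolding current_def case_prod_unfold z' by (rule Sum_any.neutral)
qed

section \<open>The theorem on the Fock space\<close>

lemma wseries_H_eq_0: "(\<And>k. k > 0 \<Longrightarrow> f k = 0) \<Longrightarrow> wseries H_weight f = 0"
  by (rule series_eqI) (auto simp: coeff2_wseries H_weight_def x_weight_def y_weight_def)

lemma H_plus_series: "H_plus \<alpha> \<beta> \<mu> \<nu> = wseries H_weight (\<lambda>k. current \<alpha> \<beta> (int k) \<mu> \<nu>)"
  unfolding H_plus_def by (rule series_sum_H)

lemma H_minus_series: "H_minus \<alpha> \<beta> \<mu> \<nu> = wseries H_weight (\<lambda>k. current \<alpha> \<beta> (- int k) \<mu> \<nu>)"
  unfolding H_minus_def by (rule series_sum_H)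

lemma window_states:
  assumes W: "W = {- N..N}"
  shows "inj_on (\<lambda>S. S \<union> {..< - N}) (Pow W)" "S \<subseteq> W \<Longrightarrow> S \<union> {..< - N} \<in> fock_basis"
proof -
  have cut: "(A \<union> {..< - N}) \<inter> W = A" if "A \<subseteq> W" for A using that W by auto
  show "inj_on (\<lambda>S. S \<union> {..< - N}) (Pow W)" by (rule inj_onI) (metis Pow_iff cut)
  show "S \<union> {..< - N} \<in> fock_basis" if "S \<subseteq> W"
  proof -
    have "finite S" using that W finite_subset by blast
    moreover have "\<And>s. s \<in> S \<Longrightarrow> - N \<le> s" using that W by auto
    ultimately show ?thesis using window_state_in_fock[of S "- N"] by (auto simp: fock_basis_def)
  qed
qed

lemma T_plus_eq_exp_window:
  assumes W: "W = {- N..N}" "N \<ge> 0" and S: "S \<subseteq> W" "S' \<subseteq> W"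
  shows "T_plus \<alpha> \<beta> (S \<union> {..< - N}) (S' \<union> {..< - N}) = mat_exp (H_plus \<alpha> \<beta>) (S \<union> {..< - N}) (S' \<union> {..< - N})"
proof -
  let ?h = "\<lambda>\<mu> \<nu>. wseries H_weight (\<lambda>k. bilinear_op W {..0} (current_coeff \<alpha> \<beta> (int k)) \<mu> \<nu>)"
  let ?e = "\<lambda>S. S \<union> {..< - N}"
  have "mat_exp (H_plus \<alpha> \<beta>) (?e S) (?e S') = op_exp W ?h S S'"
  proof (rule mat_exp_embed[where e = ?e and H = "H_plus \<alpha> \<beta>" and h = ?h, OF _ window_states(1)[OF W(1)] _ _ _ S])
    show "?e ` Pow W \<subseteq> fock_basis" using window_states(2)[OF W(1)] by auto
    show "H_plus \<alpha> \<beta> (?e S) (?e S') = ?h S S'" if "S \<subseteq> W" "S' \<subseteq> W" for S S'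
      by (simp add: H_plus_series current_window[OF W that])
    have "H_plus \<alpha> \<beta> \<kappa> (?e S) = 0" if "\<kappa> \<in> fock_basis - ?e ` Pow W" "S \<in> Pow W" for \<kappa> S
      unfolding H_plus_series
      by (rule wseries_H_eq_0, rule current_outside_window(1)[OF W(1)]) (use that in auto)
    then show "(\<forall>\<kappa>\<in>fock_basis - ?e ` Pow W. \<forall>S\<in>Pow W. H_plus \<alpha> \<beta> \<kappa> (?e S) = 0) \<or>
        (\<forall>\<kappa>\<in>fock_basis - ?e ` Pow W. \<forall>S\<in>Pow W. H_plus \<alpha> \<beta> (?e S) \<kappa> = 0)" by blast
  qed (simp add: W)
  then show ?thesis
    by (simp only: T_plus_window[OF W S] window_transfer_eq_exp[OF W(1) S])
qed

text \<open>The window states are labelled by their reflections, so that the two sides become the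
  window matrices with \<open>\<alpha>\<close> and \<open>\<beta>\<close> reflected and exchanged.\<close>

lemma T_minus_eq_exp_window:
  assumes W: "W = {- N..N}" "N \<ge> 0" and S: "S \<subseteq> W" "S' \<subseteq> W"
  shows "T_minus \<alpha> \<beta> (S \<union> {..< - N}) (S' \<union> {..< - N}) = mat_exp (H_minus \<alpha> \<beta>) (S \<union> {..< - N}) (S' \<union> {..< - N})"
proof -
  let ?a = "\<lambda>j. \<beta> (- j)" and ?b = "\<lambda>j. \<alpha> (- j)"
  let ?h = "\<lambda>\<mu> \<nu>. wseries H_weight (\<lambda>k. bilinear_op W {0..} (current_coeff ?a ?b (int k)) \<mu> \<nu>)"
  let ?e = "\<lambda>S. uminus ` S \<union> {..< - N}"
  have fW: "finite W" and mW: "uminus ` W = W" using W by simp_all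
  have sub: "uminus ` A \<subseteq> W" if "A \<subseteq> W" for A using image_mono[OF that, of uminus] mW by simp
  have mm: "uminus ` uminus ` A = A" for A :: "int set" by (simp add: image_image)
  let ?R = "uminus ` S" and ?R' = "uminus ` S'"
  have R: "?R \<subseteq> W" "?R' \<subseteq> W" using S sub by auto
  have "mat_exp (H_minus \<alpha> \<beta>) (?e ?R) (?e ?R') = op_exp W ?h ?R ?R'"
  proof (rule mat_exp_embed[where e = ?e and H = "H_minus \<alpha> \<beta>" and h = ?h, OF _ _ _ _ _ R])
    show "inj_on ?e (Pow W)"
    proof (rule inj_onI)
      fix A B assume AB: "A \<in> Pow W" "B \<in> Pow W" "?e A = ?e B"
      have "uminus ` A = uminus ` B"
        by (rule inj_onD[OF window_states(1)[OF W(1)] AB(3)]) (use AB sub in blast)+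
      then show "A = B" by (metis mm)
    qed
    show "?e ` Pow W \<subseteq> fock_basis" using window_states(2)[OF W(1)] sub by auto
    show "H_minus \<alpha> \<beta> (?e S) (?e S') = ?h S S'" if S: "S \<subseteq> W" "S' \<subseteq> W" for S S'
    proof -
      have "current \<alpha> \<beta> (- int k) (?e S) (?e S') = bilinear_op W {0..} (current_coeff ?a ?b (int k)) S S'" for k
        unfolding current_window[OF W sub[OF S(1)] sub[OF S(2)]] bilinear_op_reflect[OF fW mW S]
          current_coeff_reflect by simp
      then show ?thesis by (simp add: H_minus_series)
    qed
    have "H_minus \<alpha> \<beta> (?e S) \<kappa> = 0" if \<kappa>: "\<kappa> \<in> fock_basis - ?e ` Pow W" and S: "S \<in> Pow W" for \<kappa> S
    proof -
      have "\<kappa> \<noteq> A \<union> {..< - N}" if "A \<subseteq> W" for A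
      proof
        assume "\<kappa> = A \<union> {..< - N}"
        then have "\<kappa> = ?e (uminus ` A)" by (simp add: mm)
        with \<kappa> sub[OF that] show False by blast
      qed
      with \<kappa> S sub show ?thesis unfolding H_minus_series
        by (intro wseries_H_eq_0 current_outside_window(2)[OF W(1)]) auto
    qed
    then show "(\<forall>\<kappa>\<in>fock_basis - ?e ` Pow W. \<forall>S\<in>Pow W. H_minus \<alpha> \<beta> \<kappa> (?e S) = 0) \<or>
        (\<forall>\<kappa>\<in>fock_basis - ?e ` Pow W. \<forall>S\<in>Pow W. H_minus \<alpha> \<beta> (?e S) \<kappa> = 0)" by blast
  qed (simp add: W)
  then have "mat_exp (H_minus \<alpha> \<beta>) (?e ?R) (?e ?R') = T_minus \<alpha> \<beta> (?e ?R) (?e ?R')"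
    by (simp only: T_minus_window[OF W R] window_transfer_eq_exp[OF W(1) R])
  then show ?thesis by (simp only: mm)
qed

theorem theorem6p10:
  fixes \<alpha> \<beta> :: "int \<Rightarrow> complex"
    and l m :: int
    and \<mu> \<nu> :: "nat \<Rightarrow> nat"
  assumes "is_partition \<mu>" and "is_partition \<nu>"
  shows "T_plus \<alpha> \<beta> (sites l \<mu>) (sites m \<nu>) = mat_exp (H_plus \<alpha> \<beta>) (sites l \<mu>) (sites m \<nu>)
       \<and> T_minus \<alpha> \<beta> (sites l \<mu>) (sites m \<nu>) = mat_exp (H_minus \<alpha> \<beta>) (sites l \<mu>) (sites m \<nu>)"
proof -
  obtain M where M: "\<forall>N\<ge>M. \<exists>S\<subseteq>{- N..N}. sites l \<mu> = S \<union> {..< - N}"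
    using sites_window[OF assms(1), of l] by (elim exE)
  obtain M' where M': "\<forall>N\<ge>M'. \<exists>S\<subseteq>{- N..N}. sites m \<nu> = S \<union> {..< - N}"
    using sites_window[OF assms(2), of m] by (elim exE)
  define N where "N = max 0 (max M M')"
  have "N \<ge> M" "N \<ge> M'" by (simp_all add: N_def)
  obtain S where S: "S \<subseteq> {- N..N}" and \<mu>: "sites l \<mu> = S \<union> {..< - N}"
    using M[rule_format, OF \<open>N \<ge> M\<close>] by (elim exE conjE)
  obtain S' where S': "S' \<subseteq> {- N..N}" and \<nu>: "sites m \<nu> = S' \<union> {..< - N}"
    using M'[rule_format, OF \<open>N \<ge> M'\<close>] by (elim exE conjE)
  have "N \<ge> 0" by (simp add: N_def)
  show ?thesis unfolding \<mu> \<nu>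
    using T_plus_eq_exp_window[OF refl \<open>N \<ge> 0\<close> S S'] T_minus_eq_exp_window[OF refl \<open>N \<ge> 0\<close> S S'] by (rule conjI)
qed

end
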